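(* Fix $K\ge1$. Let Assumptions (A) and (B) of the context hold for the indices $0\le k<K$ (through the corresponding half-steps), and consider the paired exact and discrete ISTA or basic FISTA iterations of the context. Set $$\delta_h^{(k)}=a_h\eta^{(k)}\bigl[\varepsilon_{g,h}(\overline{\mathbf z}^{(k)})+L_h^\sharp\varepsilon_{I,h}(\overline{\mathbf z}^{(k)})\bigr]+\varepsilon_{{\rm rec},h}(\mathbf z^{(k+1/2)})+\kappa_h\bigl[d_h(\mathbf z^{(k+1/2)})+\varepsilon_{s,h}^{(k)}\bigr]+(a_h-1)\varepsilon_{I,h}(\mathbf z^{(k+1/2)})+\varepsilon_{R,h}^{(k)}.$$ Then, for $0\le k<K$, $$e^{(k+1)}\le a_h(1+\eta^{(k)}L_h^\sharp)\,\overline e^{(k)}+\delta_h^{(k)}.$$ For basic FISTA let $\Omega=\max_{0\le k<K}|\omega^{(k)}|$, and for ISTA set $\Omega=0$. If both the reference and discrete initial extrapolated points equal their initial iterates ($\overline{\mathbf z}^{(0)}=\mathbf z^{(0)}$, $\overline{\mathbf z}_h^{(0)}=\mathbf z_h^{(0)}$), then $$\max_{0\le k\le K}e^{(k)}\le M_h^Ke^{(0)}+\sum_{k=0}^{K-1}M_h^{K-1-k}\delta_h^{(k)},\qquad M_h=\max\Bigl\{1,(1+2\Omega)\max_{0\le k<K}a_h(1+\eta^{(k)}L_h^\sharp)\Bigr\}.$$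
   Context: **Continuous setting.** $(\mathcal M,g)$ is a compact, connected, oriented $C^3$ two-dimensional surface without boundary embedded in $\mathbb R^3$; $\mathcal Q=(0,1)\times\mathcal M$; $\mathcal H=L^2(\mathcal Q)\times L^2(\mathcal Q;T\mathcal M)$ with $\|(\rho,\mathbf m)\|_{\mathcal H}^2=\|\rho\|_{L^2}^2+\|\mathbf m\|_{L^2}^2$. $\rho_0,\rho_1\in L^2(\mathcal M)$ are nonnegative with integral one. $\mathbb G\psi=(\partial_t\psi,\nabla_g\psi)$, $B(\psi)=(\rho_1,\psi(1))_{L^2(\mathcal M)}-(\rho_0,\psi(0))_{L^2(\mathcal M)}$, $V=\{\psi\in H^1(\mathcal Q):\int_{\mathcal Q}\psi=0\}$, $\mathcal C=\{\mathbf z\in\mathcal H:(\mathbf z,\mathbb G\psi)_{\mathcal H}=B(\psi)\ \forall\psi\in H^1(\mathcal Q)\}$, and $P_{\mathcal C}$ is the orthogonal projection onto $\mathcal C$. For $\mathbf z\in\mathcal H$, $\varphi[\mathbf z]\in V$ is the unique solution of $(\mathbb G\varphi,\mathbb G\psi)_{\mathcal H}=B(\psi)-(\mathbf z,\mathbb G\psi)_{\mathcal H}$ for all $\psi\in V$; one has $P_{\mathcal C}\mathbf z=\mathbf z+\mathbb G\varphi[\mathbf z]$. The energy $\mathcal Y(\rho,\mathbf m)=\int_0^1\int_{\mathcal M}L(\rho,\mathbf m)\,d\sigma_g\,dt+\int_0^1\mathcal F(\rho(t,\cdot))\,dt$ is proper, lower semicontinuous and convex, with $\mathcal F(\rho)=\int_{\mathcal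 M}F_E(x,\rho(x))\,d\sigma_g$ for local interactions; $\nabla\mathcal Y$ is its gradient (pair of variational derivatives) in $\mathcal H$ where it exists. **Mesh and spaces.** $\mathcal M_h\subset\mathbb R^3$ is a triangulated approximation of $\mathcal M$ with vertices $V_1,\dots,V_{N_v}$ and geometric correspondence $p_h:\mathcal M_h\to\mathcal M$, a bijection. $S_h$ is the space of continuous piecewise linear functions on $\mathcal M_h$ with nodal basis $\psi_i$; $A_i=\int_{\mathcal M_h}\psi_i$. Let $N_t\ge2$, $\tau=1/N_t$, $t_j=j\tau$, $w_0=w_{N_t}=\tau/2$, $w_j=\tau$ otherwise. $S_\tau$ is the continuous piecewise linear space in time with nodal basis $\phi_j$; $Q_h=S_\tau\otimes S_h$, $u_h=\sum_ju_{h,j}\phi_j$. $(\cdot,\cdot)_{\mathcal M_h}$ is the $L^2(\mathcal M_h)$ inner product, $\nabla_{g_h}$ the elementwise surface gradient. $\rho_{0,h},\rho_{1,h}\in S_h$ are discrete endpoint densities of unit mass on $\mathcal M_h$ (for continuous data, the nodal interpolants of $\rho_\ell\circ p_h$ divided by their integrals, which are assumed positive). **Recovered derivatives.** $(G_\tau u)_0=(-3u_0+4u_1-u_2)/(2\tau)$, $(G_\tau u)_j=(u_{j+1}-u_{j-1})/(2\tau)$ for $1\le j<N_t$, $(G_\tau u)_{N_t}=(3u_{N_t}-4u_{N_t-1}+u_{N_t-2})/(2\tau)$. At each $V_i$ a fixed connected vertex patch is projected onto a local plane, and in planar coordinates centred at $V_i$ one least-squares fits a quadratic parametrization $r_i:\mathbb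 R^2\to\mathbb R^3$ to the patch vertices and a quadratic polynomial $q_i$ to the values of $u_h$; with $J_i=Dr_i(0)$, $(G_hu_h)(V_i)=J_i(J_i^\top J_i)^{-1}\nabla q_i(0)$, extended by nodal interpolation, with component matrices $B_x,B_y,B_z$; and $G_h\cdot\mathbf m_h=B_xm_x+B_ym_y+B_zm_z$. $\mathbf n_i$ is a unit normal to the range of $J_i$, $\Pi_i=I-\mathbf n_i\mathbf n_i^\top$. $X_h$ is the space of pairs $(\rho_h,\mathbf m_h)\in Q_h\times(Q_h)^3$ with nodal values $\mathbf m_{h,ji}\in\mathbf n_i^\perp$. $\mathbb G_h\varphi_h=(G_\tau\varphi_h,G_h\varphi_h)$. **Metric and discrete energy.** $\|\mathbf z_h\|_h^2=\sum_{j,i}w_jA_i(|\rho_{h,ji}|^2+|\mathbf m_{h,ji}|^2)$; $\mathcal Y_h(\mathbf z_h)=\sum_{j,i}w_jA_i[L(\rho_{h,ji},\mathbf m_{h,ji})+F_E(V_i,\rho_{h,ji})]$ (for a nonlocal $\mathcal F$, the interaction part is replaced by a corresponding discretization); $\nabla_h\mathcal Y_h$ is the gradient with respect to the inner product of $\|\cdot\|_h$ on $X_h$. **Discrete Poisson problem.** $V_h=\{v_h\in Q_h:\sum_jw_j(v_{h,j},1)_{\mathcal M_h}=0\}$, $$\mathfrak a_h(u_h,v_h)=\sum_{j=1}^{N_t}\tau\Bigl(\tfrac{u_{h,j}-u_{h,j-1}}\tau,\tfrac{v_{h,j}-v_{h,j-1}}\tau\Bigr)_{\mathcal M_h}+\sum_{j=0}^{N_t}w_j(\nabla_{g_h}u_{h,j},\nabla_{g_h}v_{h,j})_{\mathcal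 M_h},$$ $$\ell_h(\mathbf z_h;v_h)=\sum_jw_j\bigl(G_\tau\rho_{h,j}+G_h\cdot\mathbf m_{h,j}+b_{h,j}(\mathbf z_h),v_{h,j}\bigr)_{\mathcal M_h},$$ $b_{h,0}=-2(\rho_{0,h}-\rho_{h,0})/\tau$, $b_{h,N_t}=2(\rho_{1,h}-\rho_{h,N_t})/\tau$, $b_{h,j}=0$ otherwise, where $\rho_{h,0},\rho_{h,N_t}$ are the first and last time layers of $\rho_h$. $\|v_h\|_{a,h}=\mathfrak a_h(v_h,v_h)^{1/2}$ on $V_h$, and $\|\cdot\|_{V_h^*}$ is the dual norm. $\mathcal R_h$ replaces the two endpoint density layers by $\rho_{0,h},\rho_{1,h}$ and projects nodal momenta by $\Pi_i$. **Lifting and interpolation.** $T_hu=u\circ p_h$, $T_h^{-1}u_h=u_h\circ p_h^{-1}$. $\mathcal J_h$ is the linear lift of pairs: $T_h^{-1}$ on the density; $T_h^{-1}$ followed by pointwise orthogonal projection onto $T\mathcal M$ on the momentum. $\mathcal I_h\mathbf z\in X_h$ has nodal values $\rho(t_j,p_h(V_i))$ and $\Pi_i\mathbf m(t_j,p_h(V_i))$. $\varepsilon_{I,h}(\mathbf z)=\|\mathbf z-\mathcal J_h\mathcal I_h\mathbf z\|_{\mathcal H}$. **Reference problem and error quantities.** For smooth $\mathbf z=(\rho,\mathbf m)$ let $f=\partial_t\rho+\operatorname{div}_g\mathbf m$, $a_0=\rho_0-\rho(0)$, $a_1=\rho_1-\rho(1)$, $b_0=-2a_0/\tau$, $b_{N_t}=2a_1/\tau$,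 $b_j=0$ otherwise, and $\ell_h^{\rm ref}(\mathbf z;v_h)=\sum_jw_j(T_h[f(t_j)+b_j],v_{h,j})_{\mathcal M_h}$; $\varphi_h[\mathbf z]\in V_h$ solves $\mathfrak a_h(\varphi_h[\mathbf z],v_h)=\ell_h^{\rm ref}(\mathbf z;v_h)$ for all $v_h\in V_h$. Define $$\varepsilon_{{\rm rec},h}(\mathbf z)=\|\mathbb G\varphi[\mathbf z]-\mathcal J_h\mathbb G_h\varphi_h[\mathbf z]\|_{\mathcal H},\qquad d_h(\mathbf z)=\|\ell_h(\mathcal I_h\mathbf z;\cdot)-\ell_h^{\rm ref}(\mathbf z;\cdot)\|_{V_h^*},$$ $$\kappa_h=\sup_{0\ne v_h\in V_h}\frac{\|\mathcal J_h\mathbb G_hv_h\|_{\mathcal H}}{\|v_h\|_{a,h}},\qquad\Lambda_h=\sup_{0\ne\mathbf v_h\in X_h}\frac{\|\ell_h(\mathbf v_h;\cdot)-\ell_h(\mathbf 0;\cdot)\|_{V_h^*}}{\|\mathbf v_h\|_h},\qquad a_h=1+\kappa_h\Lambda_hC_{\rm inv},$$ $$\varepsilon_{g,h}(\mathbf z)=\|\nabla\mathcal Y(\mathbf z)-\mathcal J_h\nabla_h\mathcal Y_h(\mathcal I_h\mathbf z)\|_{\mathcal H},\qquad L_h^\sharp=C_{\rm lift}L_hC_{\rm inv}.$$ **Assumption (A).** The triangulations are connected and shape regular; all quadratic design matrices have rank six and all $J_i$ rank two; $p_h$ is uniformly regular; and there are constants with $\|\mathcal J_h\mathbf v_h\|_{\mathcal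 H}\le C_{\rm lift}\|\mathbf v_h\|_h$ for all pairs in the ambient discrete space $Q_h\times(Q_h)^3$ and $\|\mathbf v_h\|_h\le C_{\rm inv}\|\mathcal J_h\mathbf v_h\|_{\mathcal H}$ for $\mathbf v_h\in X_h$. **Iterations.** With the same prescribed steps $\eta^{(k)}>0$, $$\mathbf z^{(k+1/2)}=\overline{\mathbf z}^{(k)}-\eta^{(k)}\nabla\mathcal Y(\overline{\mathbf z}^{(k)}),\quad\mathbf z^{(k+1)}=P_{\mathcal C}\mathbf z^{(k+1/2)};\qquad\mathbf z_h^{(k+1/2)}=\overline{\mathbf z}_h^{(k)}-\eta^{(k)}\nabla_h\mathcal Y_h(\overline{\mathbf z}_h^{(k)}),\quad\mathbf z_h^{(k+1)}=\widehat P_h\mathbf z_h^{(k+1/2)}.$$ Here $\widehat P_h\mathbf z_h^{(k+1/2)}=\mathcal R_h(\mathbf z_h^{(k+1/2)}+\mathbb G_h\widehat\varphi_h^{(k)})$ with $\widehat\varphi_h^{(k)}\in V_h$ an inexact solution of the discrete Poisson problem with load $\ell_h(\mathbf z_h^{(k+1/2)};\cdot)$; its residual norm is $\varepsilon_{s,h}^{(k)}=\|\mathfrak a_h(\widehat\varphi_h^{(k)},\cdot)-\ell_h(\mathbf z_h^{(k+1/2)};\cdot)\|_{V_h^*}$, and $\varepsilon_{R,h}^{(k)}=\|\mathcal J_h[\mathcal R_h(\mathbf z_h^{(k+1/2)}+\mathbb G_h\widehat\varphi_h^{(k)})-(\mathbf z_h^{(k+1/2)}+\mathbb G_h\widehat\varphi_h^{(k)})]\|_{\mathcal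 H}$. For ISTA, $\overline{\mathbf z}^{(k)}=\mathbf z^{(k)}$ and $\overline{\mathbf z}_h^{(k)}=\mathbf z_h^{(k)}$ for all $k$. For basic FISTA, $\overline{\mathbf z}^{(k+1)}=\mathbf z^{(k+1)}+\omega^{(k)}(\mathbf z^{(k+1)}-\mathbf z^{(k)})$, and likewise for the discrete iterates, with common $\omega^{(k)}=(\tau^{(k)}-1)/\tau^{(k+1)}$, $\tau^{(0)}=1$, $\tau^{(k+1)}=\frac12(1+\sqrt{1+4(\tau^{(k)})^2})$ (acceleration parameters, not the time step $\tau$). Errors: $e^{(k)}=\|\mathbf z^{(k)}-\mathcal J_h\mathbf z_h^{(k)}\|_{\mathcal H}$, $\overline e^{(k)}=\|\overline{\mathbf z}^{(k)}-\mathcal J_h\overline{\mathbf z}_h^{(k)}\|_{\mathcal H}$. **Assumption (B).** For the finite index range considered, the reference fields $\overline{\mathbf z}^{(k)},\mathbf z^{(k+1/2)}$ are smooth (so that all quantities above are defined for them); the discrete extrapolated states $\overline{\mathbf z}_h^{(k)}$ and interpolated reference states $\mathcal I_h\overline{\mathbf z}^{(k)}$ lie in a convex region of $X_h$ on which $\nabla_h\mathcal Y_h$ is $L_h$-Lipschitz in $\|\cdot\|_h$; and all evaluated energy gradients exist. *)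

theory Defs
  imports "HOL-Analysis.Analysis"
begin

section \<open>Surfaces in three-space\<close>

text \<open>A function is of class \<open>C\<^sup>k\<^sup>+\<^sup>1\<close> on an open set iff it is differentiable there and all its
  directional derivatives are of class \<open>C\<^sup>k\<close>.\<close>

primrec Ck :: "nat \<Rightarrow> ('a::real_normed_vector \<Rightarrow> 'b::real_normed_vector) \<Rightarrow> 'a set \<Rightarrow> bool" where
  "Ck 0 f U = continuous_on U f"
| "Ck (Suc k) f U =
    (\<exists>f'. (\<forall>x\<in>U. (f has_derivative f' x) (at x)) \<and> (\<forall>v. Ck k (\<lambda>x. f' x v) U))"

definition area_normal :: "(real^2 \<Rightarrow> real^3) \<Rightarrow> real^2 \<Rightarrow> real^3" where
  "area_normal X u = cross3 (frechet_derivative X (at u) (axis 1 1)) (frechet_derivative X (at u) (axis 2 1))"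

definition regular_param :: "nat \<Rightarrow> (real^3) set \<Rightarrow> (real^2) set \<Rightarrow> (real^2 \<Rightarrow> real^3) \<Rightarrow> bool" where
  "regular_param k M U X \<longleftrightarrow>
     open U \<and> Ck k X U \<and> inj_on X U \<and> X ` U \<subseteq> M \<and> (\<forall>u\<in>U. area_normal X u \<noteq> 0)"

definition tangent_space :: "(real^3) set \<Rightarrow> real^3 \<Rightarrow> (real^3) set" where
  "tangent_space M x =
     {v. \<exists>\<gamma>. range \<gamma> \<subseteq> M \<and> \<gamma> 0 = x \<and> (\<gamma> has_vector_derivative v) (at (0::real))}"

definition embedded_C3_surface :: "(real^3) set \<Rightarrow> bool" where
  "embedded_C3_surface M \<longleftrightarrow>
     (\<forall>x\<in>M. \<exists>U X Y. regular_param 3 M U X \<and> x \<in> X ` U \<and>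
        openin (top_of_set M) (X ` U) \<and> homeomorphism U (X ` U) X Y)"

definition unit_normal_field :: "(real^3) set \<Rightarrow> (real^3 \<Rightarrow> real^3) \<Rightarrow> bool" where
  "unit_normal_field M \<nu> \<longleftrightarrow>
     continuous_on M \<nu> \<and> (\<forall>x\<in>M. norm (\<nu> x) = 1 \<and> (\<forall>v\<in>tangent_space M x. \<nu> x \<bullet> v = 0))"

text \<open>The charts cover \<open>M\<close> by relatively open sets homeomorphic to open subsets of the plane, so
  \<open>M\<close> has no boundary; an orientation is given by a continuous unit normal field.\<close>

definition closed_oriented_surface :: "(real^3) set \<Rightarrow> bool" where
  "closed_oriented_surface M \<longleftrightarrow>
     M \<noteq> {} \<and> compact M \<and> connected M \<and> embedded_C3_surface M \<and> (\<exists>\<nu>. unit_normal_field M \<nu>)"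

text \<open>The Riemannian area measure is the Borel measure on \<open>M\<close> given in every regular
  parametrization by the area element \<open>sqrt (det (DX\<^sup>T DX)) = |\<partial>\<^sub>1X \<times> \<partial>\<^sub>2X|\<close>; these values
  determine it uniquely.\<close>

definition area_measure :: "(real^3) set \<Rightarrow> (real^3) measure \<Rightarrow> bool" where
  "area_measure M \<sigma> \<longleftrightarrow>
     space \<sigma> = M \<and> sets \<sigma> = sets (restrict_space borel M) \<and>
     (\<forall>U X A. regular_param 1 M U X \<longrightarrow> A \<in> sets borel \<longrightarrow> A \<subseteq> U \<longrightarrow>
        emeasure \<sigma> (X ` A) = (\<integral>\<^sup>+u\<in>A. ennreal (norm (area_normal X u)) \<partial>lborel))"

definition tangent_proj :: "(real^3) set \<Rightarrow> real^3 \<Rightarrow> real^3 \<Rightarrow> real^3" where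
  "tangent_proj M x v =
     (THE w. w \<in> tangent_space M x \<and> (\<forall>u\<in>tangent_space M x. (v - w) \<bullet> u = 0))"

text \<open>Derivatives within \<open>M\<close> are determined on tangent vectors only, hence the gradient is required
  to be tangential.\<close>

definition surf_grad :: "(real^3) set \<Rightarrow> (real^3 \<Rightarrow> real) \<Rightarrow> real^3 \<Rightarrow> real^3" where
  "surf_grad M f x =
     (THE w. w \<in> tangent_space M x \<and> (f has_derivative (\<lambda>v. w \<bullet> v)) (at x within M))"

definition surf_div :: "(real^3) set \<Rightarrow> (real^3 \<Rightarrow> real^3) \<Rightarrow> real^3 \<Rightarrow> real" where
  "surf_div M m x = (\<Sum>d\<in>UNIV. surf_grad M (\<lambda>y. m y $ d) x $ d)"

text \<open>Class \<open>C\<^sup>1\<close> on a set that need not be open, such as \<open>[0,1] \<times> M\<close>.\<close>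

definition C1_on :: "'a::real_normed_vector set \<Rightarrow> ('a \<Rightarrow> 'b::real_normed_vector) \<Rightarrow> bool" where
  "C1_on S f \<longleftrightarrow>
     (\<exists>f'. (\<forall>x\<in>S. (f has_derivative f' x) (at x within S)) \<and> (\<forall>v. continuous_on S (\<lambda>x. f' x v)))"


section \<open>Square-integrable functions\<close>

definition L2 :: "'a measure \<Rightarrow> ('a \<Rightarrow> 'b::euclidean_space) \<Rightarrow> bool" where
  "L2 \<mu> f \<longleftrightarrow> f \<in> borel_measurable \<mu> \<and> integrable \<mu> (\<lambda>x. (norm (f x))\<^sup>2)"

definition L2_inner :: "'a measure \<Rightarrow> ('a \<Rightarrow> 'b::euclidean_space) \<Rightarrow> ('a \<Rightarrow> 'b) \<Rightarrow> real" where
  "L2_inner \<mu> f g = (\<integral>x. f x \<bullet> g x \<partial>\<mu>)"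

definition L2_norm :: "'a measure \<Rightarrow> ('a \<Rightarrow> 'b::euclidean_space) \<Rightarrow> real" where
  "L2_norm \<mu> f = sqrt (\<integral>x. (norm (f x))\<^sup>2 \<partial>\<mu>)"

text \<open>Integral of an extended real function; the value is \<open>\<infinity>\<close> when both parts are infinite.\<close>

definition ereal_integral :: "'a measure \<Rightarrow> ('a \<Rightarrow> ereal) \<Rightarrow> ereal" where
  "ereal_integral \<mu> f =
     enn2ereal (\<integral>\<^sup>+x. e2ennreal (f x) \<partial>\<mu>) - enn2ereal (\<integral>\<^sup>+x. e2ennreal (- f x) \<partial>\<mu>)"


section \<open>The continuous problem\<close>

record problem =
  surf :: "(real^3) set"
  area :: "(real^3) measure"
  rho0 :: "real^3 \<Rightarrow> real"
  rho1 :: "real^3 \<Rightarrow> real"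
  lagr :: "real \<Rightarrow> real^3 \<Rightarrow> ereal"

text \<open>A pair \<open>(\<rho>, m)\<close> is one function of \<open>(t, x)\<close> with values \<open>(\<rho>(t,x), m(t,x))\<close>; the norm and inner
  product of the product type \<^typ>\<open>real \<times> (real^3)\<close> are the Euclidean ones.\<close>

type_synonym field = "real \<times> (real^3) \<Rightarrow> real \<times> (real^3)"

abbreviation unit_time :: "real measure" where
  "unit_time \<equiv> restrict_space lborel {0<..<1}"

definition Qmeas :: "problem \<Rightarrow> (real \<times> (real^3)) measure" where
  "Qmeas P = unit_time \<Otimes>\<^sub>M area P"

definition Qclosed :: "problem \<Rightarrow> (real \<times> (real^3)) set" where
  "Qclosed P = {0..1} \<times> surf P"

definition Hspace :: "problem \<Rightarrow> field set" where
  "Hspace P = {z. L2 (Qmeas P) z \<and> (AE q in Qmeas P. snd (z q) \<in> tangent_space (surf P) (snd q))}"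

abbreviation Hinner :: "problem \<Rightarrow> field \<Rightarrow> field \<Rightarrow> real" where
  "Hinner P \<equiv> L2_inner (Qmeas P)"

abbreviation Hnorm :: "problem \<Rightarrow> field \<Rightarrow> real" where
  "Hnorm P \<equiv> L2_norm (Qmeas P)"

text \<open>Elements of \<open>H\<close> are classes of functions modulo null sets.\<close>

definition Heq :: "problem \<Rightarrow> field \<Rightarrow> field \<Rightarrow> bool" where
  "Heq P z w \<longleftrightarrow> (AE q in Qmeas P. z q = w q)"

text \<open>Smooth means class \<open>C\<^sup>1\<close> up to the initial and final time, the regularity at which
  all derivatives and point values of a reference field are defined.\<close>

definition smooth_field :: "problem \<Rightarrow> field \<Rightarrow> bool" where
  "smooth_field P z \<longleftrightarrow>
     C1_on (Qclosed P) z \<and> (\<forall>q\<in>Qclosed P. snd (z q) \<in> tangent_space (surf P) (snd q))"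

definition classical_grad :: "problem \<Rightarrow> (real \<times> (real^3) \<Rightarrow> real) \<Rightarrow> field" where
  "classical_grad P \<psi> = (\<lambda>(t, x).
     (vector_derivative (\<lambda>s. \<psi> (s, x)) (at t within {0..1}), surf_grad (surf P) (\<lambda>y. \<psi> (t, y)) x))"

definition classical_div :: "problem \<Rightarrow> field \<Rightarrow> real \<times> (real^3) \<Rightarrow> real" where
  "classical_div P z = (\<lambda>(t, x).
     vector_derivative (\<lambda>s. fst (z (s, x))) (at t within {0..1})
       + surf_div (surf P) (\<lambda>y. snd (z (t, y))) x)"

text \<open>\<open>H\<^sup>1(Q)\<close> is the completion of \<open>C\<^sup>1([0,1] \<times> M)\<close>, and the trace at time \<open>s\<close> is the continuous
  extension of the restriction \<open>\<psi> \<mapsto> \<psi>(s)\<close>. Gradient and trace are unique up to null sets; a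
  representative is chosen.\<close>

definition H1_approx ::
    "problem \<Rightarrow> (real \<times> (real^3) \<Rightarrow> real) \<Rightarrow> field \<Rightarrow> (nat \<Rightarrow> real \<times> (real^3) \<Rightarrow> real) \<Rightarrow> bool" where
  "H1_approx P \<psi> g \<psi>n \<longleftrightarrow>
     (\<forall>n. C1_on (Qclosed P) (\<psi>n n)) \<and>
     (\<lambda>n. L2_norm (Qmeas P) (\<lambda>q. \<psi>n n q - \<psi> q)) \<longlonglongrightarrow> 0 \<and>
     (\<lambda>n. L2_norm (Qmeas P) (\<lambda>q. classical_grad P (\<psi>n n) q - g q)) \<longlonglongrightarrow> 0"

definition is_grad :: "problem \<Rightarrow> (real \<times> (real^3) \<Rightarrow> real) \<Rightarrow> field \<Rightarrow> bool" where
  "is_grad P \<psi> g \<longleftrightarrow> g \<in> Hspace P \<and> (\<exists>\<psi>n. H1_approx P \<psi> g \<psi>n)"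

definition H1 :: "problem \<Rightarrow> (real \<times> (real^3) \<Rightarrow> real) set" where
  "H1 P = {\<psi>. L2 (Qmeas P) \<psi> \<and> (\<exists>g. is_grad P \<psi> g)}"

definition grad :: "problem \<Rightarrow> (real \<times> (real^3) \<Rightarrow> real) \<Rightarrow> field" where
  "grad P \<psi> = (SOME g. is_grad P \<psi> g)"

definition time_trace :: "problem \<Rightarrow> real \<Rightarrow> (real \<times> (real^3) \<Rightarrow> real) \<Rightarrow> real^3 \<Rightarrow> real" where
  "time_trace P s \<psi> =
     (SOME a. L2 (area P) a \<and> (\<exists>\<psi>n. H1_approx P \<psi> (grad P \<psi>) \<psi>n \<and>
        (\<lambda>n. L2_norm (area P) (\<lambda>x. \<psi>n n (s, x) - a x)) \<longlonglongrightarrow> 0))"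

definition Bfun :: "problem \<Rightarrow> (real \<times> (real^3) \<Rightarrow> real) \<Rightarrow> real" where
  "Bfun P \<psi> = L2_inner (area P) (rho1 P) (time_trace P 1 \<psi>)
            - L2_inner (area P) (rho0 P) (time_trace P 0 \<psi>)"

definition Vspace :: "problem \<Rightarrow> (real \<times> (real^3) \<Rightarrow> real) set" where
  "Vspace P = {\<psi> \<in> H1 P. (\<integral>q. \<psi> q \<partial>Qmeas P) = 0}"

definition Cset :: "problem \<Rightarrow> field set" where
  "Cset P = {z \<in> Hspace P. \<forall>\<psi>\<in>H1 P. Hinner P z (grad P \<psi>) = Bfun P \<psi>}"

text \<open>\<open>w\<close> is the orthogonal projection of \<open>z\<close> onto the affine space \<open>C\<close>.\<close>

definition is_proj_C :: "problem \<Rightarrow> field \<Rightarrow> field \<Rightarrow> bool" where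
  "is_proj_C P z w \<longleftrightarrow> w \<in> Cset P \<and> (\<forall>c\<in>Cset P. Hinner P (\<lambda>q. z q - w q) (\<lambda>q. c q - w q) = 0)"

definition poisson_solution :: "problem \<Rightarrow> field \<Rightarrow> (real \<times> (real^3) \<Rightarrow> real) \<Rightarrow> bool" where
  "poisson_solution P z \<phi> \<longleftrightarrow> \<phi> \<in> Vspace P \<and>
     (\<forall>\<psi>\<in>Vspace P. Hinner P (grad P \<phi>) (grad P \<psi>) = Bfun P \<psi> - Hinner P z (grad P \<psi>))"

definition density :: "problem \<Rightarrow> (real^3 \<Rightarrow> real) \<Rightarrow> bool" where
  "density P \<rho> \<longleftrightarrow> L2 (area P) \<rho> \<and> (AE x in area P. 0 \<le> \<rho> x) \<and> (\<integral>x. \<rho> x \<partial>area P) = 1"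

definition continuous_setting :: "problem \<Rightarrow> bool" where
  "continuous_setting P \<longleftrightarrow>
     closed_oriented_surface (surf P) \<and> area_measure (surf P) (area P) \<and>
     density P (rho0 P) \<and> density P (rho1 P)"


section \<open>The energy\<close>

text \<open>\<open>Local F\<^sub>E\<close> is a local interaction with density \<open>F\<^sub>E(x, \<rho>)\<close>. \<open>Nonlocal F F\<^sub>h\<close> is an arbitrary
  functional \<open>F\<close> of a density on \<open>M\<close> together with its chosen discretization \<open>F\<^sub>h\<close>, a functional
  of the nodal values of a discrete density.\<close>

datatype 'v interaction =
  Local "real^3 \<Rightarrow> real \<Rightarrow> ereal"
| Nonlocal "(real^3 \<Rightarrow> real) \<Rightarrow> ereal" "('v \<Rightarrow> real) \<Rightarrow> ereal"

fun interaction_energy :: "problem \<Rightarrow> 'v interaction \<Rightarrow> (real^3 \<Rightarrow> real) \<Rightarrow> ereal" where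
  "interaction_energy P (Local FE) \<rho> = ereal_integral (area P) (\<lambda>x. FE x (\<rho> x))"
| "interaction_energy P (Nonlocal F Fh) \<rho> = F \<rho>"

definition energy :: "problem \<Rightarrow> 'v interaction \<Rightarrow> field \<Rightarrow> ereal" where
  "energy P E z =
     ereal_integral unit_time (\<lambda>t. ereal_integral (area P) (\<lambda>x. lagr P (fst (z (t, x))) (snd (z (t, x)))))
   + ereal_integral unit_time (\<lambda>t. interaction_energy P E (\<lambda>x. fst (z (t, x))))"

definition proper_lsc_convex :: "problem \<Rightarrow> (field \<Rightarrow> ereal) \<Rightarrow> bool" where
  "proper_lsc_convex P Y \<longleftrightarrow>
     (\<forall>z\<in>Hspace P. Y z \<noteq> -\<infinity>) \<and> (\<exists>z\<in>Hspace P. Y z \<noteq> \<infinity>) \<and>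
     (\<forall>z\<in>Hspace P. \<forall>zn. (\<forall>n. zn n \<in> Hspace P) \<and> (\<lambda>n. Hnorm P (\<lambda>q. zn n q - z q)) \<longlonglongrightarrow> 0 \<longrightarrow>
        Y z \<le> liminf (\<lambda>n. Y (zn n))) \<and>
     (\<forall>z\<in>Hspace P. \<forall>w\<in>Hspace P. \<forall>s\<in>{0<..<1}.
        Y (\<lambda>q. (1 - s) *\<^sub>R z q + s *\<^sub>R w q) \<le> ereal (1 - s) * Y z + ereal s * Y w)"

text \<open>The gradient is the pair of variational derivatives, as an element of \<open>H\<close>: it represents the
  directional derivatives along smooth directions, which are dense in \<open>H\<close>. (Along a general direction
  of \<open>H\<close> an energy such as the kinetic one is infinite at arbitrarily small distance.)\<close>

definition has_energy_grad :: "problem \<Rightarrow> 'v interaction \<Rightarrow> field \<Rightarrow> field \<Rightarrow> bool" where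
  "has_energy_grad P E z g \<longleftrightarrow>
     g \<in> Hspace P \<and>
     (\<forall>v. smooth_field P v \<longrightarrow>
        (\<forall>\<^sub>F s in nhds 0. \<bar>energy P E (\<lambda>q. z q + s *\<^sub>R v q)\<bar> \<noteq> \<infinity>) \<and>
        ((\<lambda>s. real_of_ereal (energy P E (\<lambda>q. z q + s *\<^sub>R v q))) has_real_derivative Hinner P g v) (at 0))"

definition energy_grad :: "problem \<Rightarrow> 'v interaction \<Rightarrow> field \<Rightarrow> field" where
  "energy_grad P E z = (SOME g. has_energy_grad P E z g)"


section \<open>The mesh\<close>

text \<open>Vertices are indexed by a finite type \<open>'v\<close>, and triangles are triples of vertex indices. \<open>plane D i\<close>
  is an orthonormal basis of the local plane at vertex \<open>i\<close>, and \<open>nrm D i\<close> the unit normal used in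
  the nodal tangency condition.\<close>

record 'v discr =
  vtx :: "'v \<Rightarrow> real^3"
  tris :: "('v \<times> 'v \<times> 'v) set"
  corr :: "real^3 \<Rightarrow> real^3"
  Nt :: nat
  patch :: "'v \<Rightarrow> 'v set"
  plane :: "'v \<Rightarrow> (real^3) \<times> (real^3)"
  nrm :: "'v \<Rightarrow> real^3"
  rho0h :: "'v \<Rightarrow> real"
  rho1h :: "'v \<Rightarrow> real"

fun tri_verts :: "'v \<times> 'v \<times> 'v \<Rightarrow> 'v set" where
  "tri_verts (a, b, c) = {a, b, c}"

definition tri_hull :: "'v discr \<Rightarrow> 'v \<times> 'v \<times> 'v \<Rightarrow> (real^3) set" where
  "tri_hull D T = convex hull (vtx D ` tri_verts T)"

fun tri_area :: "'v discr \<Rightarrow> 'v \<times> 'v \<times> 'v \<Rightarrow> real" where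
  "tri_area D (a, b, c) = norm (cross3 (vtx D b - vtx D a) (vtx D c - vtx D a)) / 2"

fun tri_span :: "'v discr \<Rightarrow> 'v \<times> 'v \<times> 'v \<Rightarrow> (real^3) set" where
  "tri_span D (a, b, c) = span {vtx D b - vtx D a, vtx D c - vtx D a}"

fun tri_map :: "'v discr \<Rightarrow> 'v \<times> 'v \<times> 'v \<Rightarrow> real^2 \<Rightarrow> real^3" where
  "tri_map D (a, b, c) u = vtx D a + (u $ 1) *\<^sub>R (vtx D b - vtx D a) + (u $ 2) *\<^sub>R (vtx D c - vtx D a)"

definition mesh :: "'v discr \<Rightarrow> (real^3) set" where
  "mesh D = (\<Union>T\<in>tris D. tri_hull D T)"

definition triangulation :: "'v::finite discr \<Rightarrow> bool" where
  "triangulation D \<longleftrightarrow>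
     inj (vtx D) \<and> (\<Union>T\<in>tris D. tri_verts T) = UNIV \<and>
     (\<forall>T\<in>tris D. 0 < tri_area D T) \<and> inj_on tri_verts (tris D) \<and>
     (\<forall>T\<in>tris D. \<forall>S\<in>tris D.
        tri_hull D T \<inter> tri_hull D S = convex hull (vtx D ` (tri_verts T \<inter> tri_verts S)))"

definition shape_regular :: "'v discr \<Rightarrow> real \<Rightarrow> bool" where
  "shape_regular D \<gamma> \<longleftrightarrow> (\<forall>T\<in>tris D. (diameter (tri_hull D T))\<^sup>2 \<le> \<gamma> * tri_area D T)"

text \<open>Regularity of \<open>p\<^sub>h\<close>: a homeomorphism that is \<open>C\<^sup>1\<close> on every closed triangle, with derivative
  and inverse derivative along the triangle bounded by \<open>c\<close>.\<close>

definition regular_corr :: "problem \<Rightarrow> 'v discr \<Rightarrow> real \<Rightarrow> bool" where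
  "regular_corr P D c \<longleftrightarrow>
     bij_betw (corr D) (mesh D) (surf P) \<and> continuous_on (mesh D) (corr D) \<and>
     (\<forall>T\<in>tris D. \<exists>p'.
        (\<forall>x\<in>tri_hull D T. (corr D has_derivative p' x) (at x within tri_hull D T)) \<and>
        (\<forall>v. continuous_on (tri_hull D T) (\<lambda>x. p' x v)) \<and>
        (\<forall>x\<in>tri_hull D T. \<forall>v\<in>tri_span D T. norm (p' x v) \<le> c * norm v \<and> norm v \<le> c * norm (p' x v)))"

text \<open>The integral over \<open>M\<^sub>h\<close>, by affine parametrization of each triangle over the unit triangle.\<close>

definition mesh_integral :: "'v discr \<Rightarrow> (real^3 \<Rightarrow> real) \<Rightarrow> real" where
  "mesh_integral D f =
     (\<Sum>T\<in>tris D. 2 * tri_area D T *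
        (LINT u:{u::real^2. 0 \<le> u $ 1 \<and> 0 \<le> u $ 2 \<and> u $ 1 + u $ 2 \<le> 1}|lborel. f (tri_map D T u)))"


section \<open>Discrete spaces\<close>

text \<open>Elements of \<open>S\<^sub>h\<close> are represented by their nodal values \<open>'v \<Rightarrow> 'b\<close>, and elements of \<open>Q\<^sub>h\<close> by
  nodal values indexed by time layer and vertex, set to zero beyond the last layer \<open>N\<^sub>t\<close>.\<close>

definition hat :: "'v discr \<Rightarrow> 'v \<Rightarrow> real^3 \<Rightarrow> real" where
  "hat D i x = (THE y. \<exists>a b c \<alpha> \<beta> \<gamma>. (a, b, c) \<in> tris D \<and> 0 \<le> \<alpha> \<and> 0 \<le> \<beta> \<and> 0 \<le> \<gamma> \<and> \<alpha> + \<beta> + \<gamma> = 1 \<and>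
     x = \<alpha> *\<^sub>R vtx D a + \<beta> *\<^sub>R vtx D b + \<gamma> *\<^sub>R vtx D c \<and>
     y = (if i = a then \<alpha> else if i = b then \<beta> else if i = c then \<gamma> else 0))"

definition pl :: "'v::finite discr \<Rightarrow> ('v \<Rightarrow> 'b::real_vector) \<Rightarrow> real^3 \<Rightarrow> 'b" where
  "pl D u x = (\<Sum>i\<in>UNIV. hat D i x *\<^sub>R u i)"

definition tau :: "'v discr \<Rightarrow> real" where
  "tau D = 1 / real (Nt D)"

definition tnode :: "'v discr \<Rightarrow> nat \<Rightarrow> real" where
  "tnode D j = real j * tau D"

definition wt :: "'v discr \<Rightarrow> nat \<Rightarrow> real" where
  "wt D j = (if j = 0 \<or> j = Nt D then tau D / 2 else tau D)"

definition time_hat :: "'v discr \<Rightarrow> nat \<Rightarrow> real \<Rightarrow> real" where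
  "time_hat D j t = max 0 (1 - \<bar>t - tnode D j\<bar> / tau D)"

definition Qh :: "'v discr \<Rightarrow> (nat \<Rightarrow> 'v \<Rightarrow> 'b::zero) set" where
  "Qh D = {u. \<forall>j i. Nt D < j \<longrightarrow> u j i = 0}"

definition Qh_eval :: "'v::finite discr \<Rightarrow> (nat \<Rightarrow> 'v \<Rightarrow> 'b::real_vector) \<Rightarrow> real \<Rightarrow> real^3 \<Rightarrow> 'b" where
  "Qh_eval D u t x = (\<Sum>j\<le>Nt D. time_hat D j t *\<^sub>R pl D (u j) x)"

type_synonym 'v dfield = "nat \<Rightarrow> 'v \<Rightarrow> real \<times> (real^3)"

definition Xh :: "'v discr \<Rightarrow> 'v dfield set" where
  "Xh D = {z \<in> Qh D. \<forall>j i. snd (z j i) \<bullet> nrm D i = 0}"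

definition nodal_area :: "'v discr \<Rightarrow> 'v \<Rightarrow> real" where
  "nodal_area D i = mesh_integral D (hat D i)"

definition mass :: "'v::finite discr \<Rightarrow> ('v \<Rightarrow> real) \<Rightarrow> ('v \<Rightarrow> real) \<Rightarrow> real" where
  "mass D u v = mesh_integral D (\<lambda>x. pl D u x * pl D v x)"

fun tri_grad :: "'v discr \<Rightarrow> ('v \<Rightarrow> real) \<Rightarrow> 'v \<times> 'v \<times> 'v \<Rightarrow> real^3" where
  "tri_grad D u (a, b, c) = (THE w. w \<in> tri_span D (a, b, c) \<and>
     w \<bullet> (vtx D b - vtx D a) = u b - u a \<and> w \<bullet> (vtx D c - vtx D a) = u c - u a)"

text \<open>The inner product \<open>(\<nabla>u, \<nabla>v)\<close> on \<open>M\<^sub>h\<close>; elementwise gradients are constant on each triangle.\<close>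

definition stiff :: "'v discr \<Rightarrow> ('v \<Rightarrow> real) \<Rightarrow> ('v \<Rightarrow> real) \<Rightarrow> real" where
  "stiff D u v = (\<Sum>T\<in>tris D. tri_area D T * (tri_grad D u T \<bullet> tri_grad D v T))"

definition h_inner :: "'v::finite discr \<Rightarrow> 'v dfield \<Rightarrow> 'v dfield \<Rightarrow> real" where
  "h_inner D z w = (\<Sum>j\<le>Nt D. \<Sum>i\<in>UNIV. wt D j * nodal_area D i * (z j i \<bullet> w j i))"

definition h_norm :: "'v::finite discr \<Rightarrow> 'v dfield \<Rightarrow> real" where
  "h_norm D z = sqrt (h_inner D z z)"


section \<open>Recovered derivatives\<close>

definition Gtau :: "'v discr \<Rightarrow> (nat \<Rightarrow> 'v \<Rightarrow> real) \<Rightarrow> nat \<Rightarrow> 'v \<Rightarrow> real" where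
  "Gtau D u j i =
     (if j = 0 then (- 3 * u 0 i + 4 * u 1 i - u 2 i) / (2 * tau D)
      else if j < Nt D then (u (j + 1) i - u (j - 1) i) / (2 * tau D)
      else if j = Nt D then (3 * u (Nt D) i - 4 * u (Nt D - 1) i + u (Nt D - 2) i) / (2 * tau D)
      else 0)"

definition planar :: "'v discr \<Rightarrow> 'v \<Rightarrow> real^3 \<Rightarrow> real^2" where
  "planar D i x = vector [fst (plane D i) \<bullet> (x - vtx D i), snd (plane D i) \<bullet> (x - vtx D i)]"

definition monomials :: "real^2 \<Rightarrow> real^6" where
  "monomials \<xi> = vector [1, \<xi> $ 1, \<xi> $ 2, (\<xi> $ 1)\<^sup>2, \<xi> $ 1 * \<xi> $ 2, (\<xi> $ 2)\<^sup>2]"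

text \<open>Rows of vertices outside the patch are zero, which does not affect the rank.\<close>

definition design :: "'v::finite discr \<Rightarrow> 'v \<Rightarrow> real^6^'v" where
  "design D i = (\<chi> k. if k \<in> patch D i then monomials (planar D i (vtx D k)) else 0)"

definition ls_error :: "'v discr \<Rightarrow> 'v \<Rightarrow> ('v \<Rightarrow> real) \<Rightarrow> real^6 \<Rightarrow> real" where
  "ls_error D i y c = (\<Sum>k\<in>patch D i. (c \<bullet> monomials (planar D i (vtx D k)) - y k)\<^sup>2)"

definition quad_fit :: "'v discr \<Rightarrow> 'v \<Rightarrow> ('v \<Rightarrow> real) \<Rightarrow> real^2 \<Rightarrow> real" where
  "quad_fit D i y \<xi> = (THE c. \<forall>c'. ls_error D i y c \<le> ls_error D i y c') \<bullet> monomials \<xi>"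

definition param_fit :: "'v discr \<Rightarrow> 'v \<Rightarrow> real^2 \<Rightarrow> real^3" where
  "param_fit D i \<xi> = (\<chi> d. quad_fit D i (\<lambda>k. vtx D k $ d) \<xi>)"

definition Jmat :: "'v discr \<Rightarrow> 'v \<Rightarrow> real^2^3" where
  "Jmat D i = matrix (frechet_derivative (param_fit D i) (at 0))"

definition Gh :: "'v discr \<Rightarrow> ('v \<Rightarrow> real) \<Rightarrow> 'v \<Rightarrow> real^3" where
  "Gh D u i = (Jmat D i ** matrix_inv (transpose (Jmat D i) ** Jmat D i)) *v
     (\<chi> a. frechet_derivative (quad_fit D i u) (at 0) (axis a 1))"

definition Gh_div :: "'v discr \<Rightarrow> ('v \<Rightarrow> real^3) \<Rightarrow> 'v \<Rightarrow> real" where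
  "Gh_div D m i = (\<Sum>d\<in>UNIV. Gh D (\<lambda>k. m k $ d) i $ d)"

definition GGh :: "'v discr \<Rightarrow> (nat \<Rightarrow> 'v \<Rightarrow> real) \<Rightarrow> 'v dfield" where
  "GGh D u = (\<lambda>j i. (Gtau D u j i, Gh D (u j) i))"

definition Pi_nrm :: "'v discr \<Rightarrow> 'v \<Rightarrow> real^3 \<Rightarrow> real^3" where
  "Pi_nrm D i m = m - (nrm D i \<bullet> m) *\<^sub>R nrm D i"

definition adjacent :: "'v discr \<Rightarrow> ('v \<times> 'v) set" where
  "adjacent D = {(k, l). \<exists>T\<in>tris D. k \<in> tri_verts T \<and> l \<in> tri_verts T}"

text \<open>The vertex patches and local planes, and the choice of the unit normals \<open>n\<^sub>i\<close>.\<close>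

definition recovery_data :: "'v::finite discr \<Rightarrow> bool" where
  "recovery_data D \<longleftrightarrow> (\<forall>i.
     i \<in> patch D i \<and>
     (\<forall>k\<in>patch D i. (i, k) \<in> (adjacent D \<inter> patch D i \<times> patch D i)\<^sup>*) \<and>
     norm (fst (plane D i)) = 1 \<and> norm (snd (plane D i)) = 1 \<and> fst (plane D i) \<bullet> snd (plane D i) = 0 \<and>
     norm (nrm D i) = 1 \<and> (\<forall>\<xi>. nrm D i \<bullet> (Jmat D i *v \<xi>) = 0))"

definition endpoint_density :: "problem \<Rightarrow> 'v::finite discr \<Rightarrow> (real^3 \<Rightarrow> real) \<Rightarrow> ('v \<Rightarrow> real) \<Rightarrow> bool" where
  "endpoint_density P D \<rho> \<rho>h \<longleftrightarrow>
     mesh_integral D (pl D \<rho>h) = 1 \<and>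
     (continuous_on (surf P) \<rho> \<longrightarrow>
        (let I = (\<lambda>i. \<rho> (corr D (vtx D i))) in
           0 < mesh_integral D (pl D I) \<and> (\<forall>i. \<rho>h i = I i / mesh_integral D (pl D I))))"

definition discrete_setting :: "problem \<Rightarrow> 'v::finite discr \<Rightarrow> bool" where
  "discrete_setting P D \<longleftrightarrow>
     2 \<le> Nt D \<and> triangulation D \<and> bij_betw (corr D) (mesh D) (surf P) \<and> recovery_data D \<and>
     endpoint_density P D (rho0 P) (rho0h D) \<and> endpoint_density P D (rho1 P) (rho1h D)"


section \<open>Discrete energy\<close>

fun discrete_energy :: "problem \<Rightarrow> 'v::finite discr \<Rightarrow> 'v interaction \<Rightarrow> 'v dfield \<Rightarrow> ereal" where
  "discrete_energy P D (Local FE) z =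
     (\<Sum>j\<le>Nt D. \<Sum>i\<in>UNIV. ereal (wt D j * nodal_area D i) *
        (lagr P (fst (z j i)) (snd (z j i)) + FE (vtx D i) (fst (z j i))))"
| "discrete_energy P D (Nonlocal F Fh) z =
     (\<Sum>j\<le>Nt D. \<Sum>i\<in>UNIV. ereal (wt D j * nodal_area D i) * lagr P (fst (z j i)) (snd (z j i)))
     + (\<Sum>j\<le>Nt D. ereal (wt D j) * Fh (\<lambda>i. fst (z j i)))"

definition has_discrete_grad ::
    "problem \<Rightarrow> 'v::finite discr \<Rightarrow> 'v interaction \<Rightarrow> 'v dfield \<Rightarrow> 'v dfield \<Rightarrow> bool" where
  "has_discrete_grad P D E z g \<longleftrightarrow>
     z \<in> Xh D \<and> g \<in> Xh D \<and>
     (\<exists>r>0. \<forall>v\<in>Xh D. h_norm D v < r \<longrightarrow> \<bar>discrete_energy P D E (\<lambda>j i. z j i + v j i)\<bar> \<noteq> \<infinity>) \<and>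
     (\<forall>\<epsilon>>0. \<exists>r>0. \<forall>v\<in>Xh D. h_norm D v < r \<longrightarrow>
        \<bar>real_of_ereal (discrete_energy P D E (\<lambda>j i. z j i + v j i))
          - real_of_ereal (discrete_energy P D E z) - h_inner D g v\<bar> \<le> \<epsilon> * h_norm D v)"

definition discrete_grad :: "problem \<Rightarrow> 'v::finite discr \<Rightarrow> 'v interaction \<Rightarrow> 'v dfield \<Rightarrow> 'v dfield" where
  "discrete_grad P D E z = (THE g. has_discrete_grad P D E z g)"

definition convex_region :: "'v discr \<Rightarrow> 'v dfield set \<Rightarrow> bool" where
  "convex_region D R \<longleftrightarrow> R \<subseteq> Xh D \<and>
     (\<forall>z\<in>R. \<forall>w\<in>R. \<forall>s\<in>{0..1}. (\<lambda>j i. (1 - s) *\<^sub>R z j i + s *\<^sub>R w j i) \<in> R)"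

definition grad_lipschitz ::
    "problem \<Rightarrow> 'v::finite discr \<Rightarrow> 'v interaction \<Rightarrow> 'v dfield set \<Rightarrow> real \<Rightarrow> bool" where
  "grad_lipschitz P D E R Lh \<longleftrightarrow> 0 \<le> Lh \<and>
     (\<forall>z\<in>R. \<exists>g. has_discrete_grad P D E z g) \<and>
     (\<forall>z\<in>R. \<forall>w\<in>R. h_norm D (\<lambda>j i. discrete_grad P D E z j i - discrete_grad P D E w j i)
        \<le> Lh * h_norm D (\<lambda>j i. z j i - w j i))"


section \<open>Discrete Poisson problem\<close>

definition Vh :: "'v::finite discr \<Rightarrow> (nat \<Rightarrow> 'v \<Rightarrow> real) set" where
  "Vh D = {v \<in> Qh D. (\<Sum>j\<le>Nt D. wt D j * mesh_integral D (pl D (v j))) = 0}"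

definition a_form :: "'v::finite discr \<Rightarrow> (nat \<Rightarrow> 'v \<Rightarrow> real) \<Rightarrow> (nat \<Rightarrow> 'v \<Rightarrow> real) \<Rightarrow> real" where
  "a_form D u v =
     (\<Sum>j=1..Nt D. tau D * mass D (\<lambda>i. (u j i - u (j - 1) i) / tau D) (\<lambda>i. (v j i - v (j - 1) i) / tau D))
   + (\<Sum>j\<le>Nt D. wt D j * stiff D (u j) (v j))"

definition a_norm :: "'v::finite discr \<Rightarrow> (nat \<Rightarrow> 'v \<Rightarrow> real) \<Rightarrow> real" where
  "a_norm D v = sqrt (a_form D v v)"

definition dual_norm :: "'v::finite discr \<Rightarrow> ((nat \<Rightarrow> 'v \<Rightarrow> real) \<Rightarrow> real) \<Rightarrow> real" where
  "dual_norm D l = (SUP v\<in>Vh D - {\<lambda>j i. 0}. \<bar>l v\<bar> / a_norm D v)"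

definition b_load :: "'v discr \<Rightarrow> 'v dfield \<Rightarrow> nat \<Rightarrow> 'v \<Rightarrow> real" where
  "b_load D z j i =
     (if j = 0 then - 2 * (rho0h D i - fst (z 0 i)) / tau D
      else if j = Nt D then 2 * (rho1h D i - fst (z (Nt D) i)) / tau D
      else 0)"

definition load :: "'v::finite discr \<Rightarrow> 'v dfield \<Rightarrow> (nat \<Rightarrow> 'v \<Rightarrow> real) \<Rightarrow> real" where
  "load D z v = (\<Sum>j\<le>Nt D. wt D j * mass D
     (\<lambda>i. Gtau D (\<lambda>l k. fst (z l k)) j i + Gh_div D (\<lambda>k. snd (z j k)) i + b_load D z j i) (v j))"

definition Rh :: "'v discr \<Rightarrow> 'v dfield \<Rightarrow> 'v dfield" where
  "Rh D z = (\<lambda>j i.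
     (if j = 0 then rho0h D i else if j = Nt D then rho1h D i else fst (z j i), Pi_nrm D i (snd (z j i))))"


section \<open>Lifting, interpolation and error quantities\<close>

definition lift :: "problem \<Rightarrow> 'v::finite discr \<Rightarrow> 'v dfield \<Rightarrow> field" where
  "lift P D z = (\<lambda>(t, x). let y = Qh_eval D z t (inv_into (mesh D) (corr D) x)
     in (fst y, tangent_proj (surf P) x (snd y)))"

definition interp :: "'v discr \<Rightarrow> field \<Rightarrow> 'v dfield" where
  "interp D z = (\<lambda>j i. if j \<le> Nt D
     then (fst (z (tnode D j, corr D (vtx D i))), Pi_nrm D i (snd (z (tnode D j, corr D (vtx D i)))))
     else 0)"

definition eps_I :: "problem \<Rightarrow> 'v::finite discr \<Rightarrow> field \<Rightarrow> real" where
  "eps_I P D z = Hnorm P (\<lambda>q. z q - lift P D (interp D z) q)"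

definition b_ref :: "problem \<Rightarrow> 'v discr \<Rightarrow> field \<Rightarrow> nat \<Rightarrow> real^3 \<Rightarrow> real" where
  "b_ref P D z j x =
     (if j = 0 then - 2 * (rho0 P x - fst (z (0, x))) / tau D
      else if j = Nt D then 2 * (rho1 P x - fst (z (1, x))) / tau D
      else 0)"

definition load_ref :: "problem \<Rightarrow> 'v::finite discr \<Rightarrow> field \<Rightarrow> (nat \<Rightarrow> 'v \<Rightarrow> real) \<Rightarrow> real" where
  "load_ref P D z v = (\<Sum>j\<le>Nt D. wt D j * mesh_integral D (\<lambda>x.
     (classical_div P z (tnode D j, corr D x) + b_ref P D z j (corr D x)) * pl D (v j) x))"

definition phi_h :: "problem \<Rightarrow> 'v::finite discr \<Rightarrow> field \<Rightarrow> nat \<Rightarrow> 'v \<Rightarrow> real" where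
  "phi_h P D z = (THE \<phi>. \<phi> \<in> Vh D \<and> (\<forall>v\<in>Vh D. a_form D \<phi> v = load_ref P D z v))"

text \<open>Here \<open>\<phi>\<close> stands for the solution \<open>\<phi>[z]\<close> of the continuous Poisson problem with datum \<open>z\<close>.\<close>

definition eps_rec :: "problem \<Rightarrow> 'v::finite discr \<Rightarrow> (real \<times> (real^3) \<Rightarrow> real) \<Rightarrow> field \<Rightarrow> real" where
  "eps_rec P D \<phi> z = Hnorm P (\<lambda>q. grad P \<phi> q - lift P D (GGh D (phi_h P D z)) q)"

definition d_err :: "problem \<Rightarrow> 'v::finite discr \<Rightarrow> field \<Rightarrow> real" where
  "d_err P D z = dual_norm D (\<lambda>v. load D (interp D z) v - load_ref P D z v)"

definition kappa :: "problem \<Rightarrow> 'v::finite discr \<Rightarrow> real" where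
  "kappa P D = (SUP v\<in>Vh D - {\<lambda>j i. 0}. Hnorm P (lift P D (GGh D v)) / a_norm D v)"

definition Lam :: "'v::finite discr \<Rightarrow> real" where
  "Lam D = (SUP z\<in>Xh D - {\<lambda>j i. 0}. dual_norm D (\<lambda>w. load D z w - load D (\<lambda>j i. 0) w) / h_norm D z)"

definition eps_g :: "problem \<Rightarrow> 'v::finite discr \<Rightarrow> 'v interaction \<Rightarrow> field \<Rightarrow> real" where
  "eps_g P D E z = Hnorm P (\<lambda>q. energy_grad P E z q - lift P D (discrete_grad P D E (interp D z)) q)"

definition eps_s :: "'v::finite discr \<Rightarrow> (nat \<Rightarrow> 'v \<Rightarrow> real) \<Rightarrow> 'v dfield \<Rightarrow> real" where
  "eps_s D \<phi> z = dual_norm D (\<lambda>v. a_form D \<phi> v - load D z v)"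

text \<open>\<open>corrected D z \<phi>\<close> is the state \<open>z + G\<^sub>h \<phi>\<close> before the final correction \<open>R\<^sub>h\<close>.\<close>

definition corrected :: "'v discr \<Rightarrow> 'v dfield \<Rightarrow> (nat \<Rightarrow> 'v \<Rightarrow> real) \<Rightarrow> 'v dfield" where
  "corrected D z \<phi> = (\<lambda>j i. z j i + GGh D \<phi> j i)"

definition eps_R :: "problem \<Rightarrow> 'v::finite discr \<Rightarrow> (nat \<Rightarrow> 'v \<Rightarrow> real) \<Rightarrow> 'v dfield \<Rightarrow> real" where
  "eps_R P D \<phi> z =
     Hnorm P (lift P D (\<lambda>j i. Rh D (corrected D z \<phi>) j i - corrected D z \<phi> j i))"

definition err :: "problem \<Rightarrow> 'v::finite discr \<Rightarrow> field \<Rightarrow> 'v dfield \<Rightarrow> real" where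
  "err P D z zh = Hnorm P (\<lambda>q. z q - lift P D zh q)"

definition assumption_A :: "problem \<Rightarrow> 'v::finite discr \<Rightarrow> real \<Rightarrow> real \<Rightarrow> real \<Rightarrow> real \<Rightarrow> bool" where
  "assumption_A P D Cshape Cp Clift Cinv \<longleftrightarrow>
     connected (mesh D) \<and> shape_regular D Cshape \<and>
     (\<forall>i. rank (design D i) = 6 \<and> rank (Jmat D i) = 2) \<and>
     regular_corr P D Cp \<and>
     (\<forall>z\<in>Qh D. Hnorm P (lift P D z) \<le> Clift * h_norm D z) \<and>
     (\<forall>z\<in>Xh D. h_norm D z \<le> Cinv * Hnorm P (lift P D z))"


section \<open>Iterations\<close>

datatype scheme = ISTA | FISTA

primrec accel :: "nat \<Rightarrow> real" where
  "accel 0 = 1"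
| "accel (Suc k) = (1 + sqrt (1 + 4 * (accel k)\<^sup>2)) / 2"

definition omega :: "nat \<Rightarrow> real" where
  "omega k = (accel k - 1) / accel (Suc k)"

definition Omega_max :: "scheme \<Rightarrow> nat \<Rightarrow> real" where
  "Omega_max sch K = (case sch of ISTA \<Rightarrow> 0 | FISTA \<Rightarrow> Max ((\<lambda>k. \<bar>omega k\<bar>) ` {..<K}))"

text \<open>The iterations are run for \<open>K\<close> steps; extrapolated points are used up to index \<open>K - 1\<close>.\<close>

definition exact_iteration ::
    "problem \<Rightarrow> 'v interaction \<Rightarrow> scheme \<Rightarrow> nat \<Rightarrow> (nat \<Rightarrow> real) \<Rightarrow>
     (nat \<Rightarrow> field) \<Rightarrow> (nat \<Rightarrow> field) \<Rightarrow> (nat \<Rightarrow> field) \<Rightarrow> bool" where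
  "exact_iteration P E sch K \<eta> z zbar zhalf \<longleftrightarrow>
     z 0 \<in> Hspace P \<and>
     (\<forall>k<K. Heq P (zhalf k) (\<lambda>q. zbar k q - \<eta> k *\<^sub>R energy_grad P E (zbar k) q)) \<and>
     (\<forall>k<K. is_proj_C P (zhalf k) (z (Suc k))) \<and>
     (case sch of
        ISTA \<Rightarrow> \<forall>k<K. Heq P (zbar k) (z k)
      | FISTA \<Rightarrow> \<forall>k. Suc k < K \<longrightarrow>
          Heq P (zbar (Suc k)) (\<lambda>q. z (Suc k) q + omega k *\<^sub>R (z (Suc k) q - z k q)))"

definition discrete_iteration ::
    "problem \<Rightarrow> 'v::finite discr \<Rightarrow> 'v interaction \<Rightarrow> scheme \<Rightarrow> nat \<Rightarrow> (nat \<Rightarrow> real) \<Rightarrow>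
     (nat \<Rightarrow> 'v dfield) \<Rightarrow> (nat \<Rightarrow> 'v dfield) \<Rightarrow> (nat \<Rightarrow> 'v dfield) \<Rightarrow> (nat \<Rightarrow> nat \<Rightarrow> 'v \<Rightarrow> real) \<Rightarrow> bool" where
  "discrete_iteration P D E sch K \<eta> zh zhbar zhhalf phat \<longleftrightarrow>
     zh 0 \<in> Xh D \<and>
     (\<forall>k<K. zhhalf k = (\<lambda>j i. zhbar k j i - \<eta> k *\<^sub>R discrete_grad P D E (zhbar k) j i)) \<and>
     (\<forall>k<K. phat k \<in> Vh D \<and> zh (Suc k) = Rh D (corrected D (zhhalf k) (phat k))) \<and>
     (case sch of
        ISTA \<Rightarrow> \<forall>k<K. zhbar k = zh k
      | FISTA \<Rightarrow> \<forall>k. Suc k < K \<longrightarrow>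
          zhbar (Suc k) = (\<lambda>j i. zh (Suc k) j i + omega k *\<^sub>R (zh (Suc k) j i - zh k j i)))"

definition assumption_B ::
    "problem \<Rightarrow> 'v::finite discr \<Rightarrow> 'v interaction \<Rightarrow> nat \<Rightarrow> real \<Rightarrow>
     (nat \<Rightarrow> field) \<Rightarrow> (nat \<Rightarrow> field) \<Rightarrow> (nat \<Rightarrow> 'v dfield) \<Rightarrow> bool" where
  "assumption_B P D E K Lh zbar zhalf zhbar \<longleftrightarrow>
     (\<forall>k<K. smooth_field P (zbar k) \<and> smooth_field P (zhalf k)) \<and>
     (\<exists>R. convex_region D R \<and> grad_lipschitz P D E R Lh \<and>
        (\<forall>k<K. zhbar k \<in> R \<and> interp D (zbar k) \<in> R)) \<and>
     (\<forall>k<K. \<exists>g. has_energy_grad P E (zbar k) g)"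

end

theory Submission
  imports Defs "HOL-Library.Function_Algebras"
begin

text \<open>One step of the two iterations consists of a gradient step, a projection and, for FISTA, an
extrapolation; the error is followed through each of them in the norm of \<open>H\<close>.

The exact projection is \<open>P\<^sub>C z = z + \<nabla>\<phi>\<close>, with \<open>\<phi>\<close> the solution of a Poisson problem, and
the discrete one is \<open>z\<^sub>h + G\<^sub>h \<phi>'\<close> followed by the correction \<open>R\<^sub>h\<close>, whose effect is the term
\<open>\<epsilon>\<^sub>R\<close>. What remains is the error before the projection and the difference between \<open>\<nabla>\<phi>\<close> and the
lift of \<open>G\<^sub>h \<phi>'\<close>. Inserting the solution \<open>\<phi>\<^sub>h\<close> of the reference problem gives \<open>\<epsilon>\<^sub>r\<^sub>e\<^sub>c\<close>
and \<open>\<kappa>\<close> times the energy norm of \<open>\<phi>\<^sub>h - \<phi>'\<close>. That energy norm is the dual norm of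
\<open>a(\<phi>\<^sub>h - \<phi>', \<cdot>)\<close>, a functional that splits into the inconsistency of the load, the response of the
load to the difference of the interpolated and the discrete state, and the algebraic residual
(\<open>poisson_error\<close>). The second part is at most \<open>\<Lambda>\<close> times a norm on \<open>X\<^sub>h\<close>, and \<open>C\<^sub>i\<^sub>n\<^sub>v\<close> brings it
back to \<open>H\<close>. This is \<open>projection_step\<close>. In \<open>gradient_step\<close> the Lipschitz bound of the discrete
gradient is used between the discrete state and the interpolated exact state. An extrapolation
multiplies the largest error so far by at most \<open>1 + 2\<Omega>\<close> (\<open>extrapolation_error\<close>), and
\<open>error_recursion\<close> unrolls the resulting recursion.

These inequalities rest on three facts.

First, \<open>P\<^sub>C z = z + \<nabla>\<phi>\<close> (\<open>projection_eq\<close>): the Poisson problem tests only with functions of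
mean zero, whereas the constraint tests with all of \<open>H\<^sup>1\<close>. The passage between them uses that
constants change neither the gradient nor the functional \<open>B\<close>. For \<open>B\<close> the traces of \<open>\<psi> - c\<close> and
\<open>\<psi>\<close> are compared through an explicit integral formula for the trace (\<open>time_trace_eq\<close>).

Second, the suprema \<open>\<kappa>\<close>, \<open>\<Lambda>\<close> and the dual norms are finite. The discrete spaces have finite
dimension and \<open>a\<^sub>h\<close> is definite on \<open>V\<^sub>h\<close>, because the mesh is connected (\<open>Vh_form\<close>); on such a space
every seminorm is bounded by the norm and every functional has a Riesz representer. The latter also
gives \<open>\<phi>\<^sub>h\<close>, once the reference load is linear. Its densities \<open>\<rho>\<^sub>0, \<rho>\<^sub>1\<close> are only
square-integrable on the surface, so it has to be shown that they stay integrable after composition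
with \<open>p\<^sub>h\<close>: on each triangle \<open>p\<^sub>h\<close> is a chart, and the area formula applies (\<open>pullback_integrable\<close>).

Third, all fields that occur are square-integrable, so that the triangle inequality of \<open>H\<close> is
available. Lifts are even continuous on \<open>[0,1] \<times> M\<close>, since the tangent projection is
\<open>v - (\<nu> \<bullet> v) \<nu>\<close> with a continuous unit normal \<open>\<nu>\<close> (\<open>tangent_proj_eq\<close>).\<close>

section \<open>Inner products on finite-dimensional spaces\<close>

text \<open>With the pointwise operations the nodal functions form a vector space, so that subspaces, spans and
bilinear maps make sense for the discrete spaces, whose dimension depends on the number of time
layers and hence is not that of a type.\<close>

instantiation "fun" :: (type, real_vector) real_vector
begin

definition scaleR_fun_def: "r *\<^sub>R f = (\<lambda>x. r *\<^sub>R f x)"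

instance
  by standard (simp_all add: scaleR_fun_def fun_eq_iff scaleR_add_left scaleR_add_right)

end

lemma scaleR_fun_apply [simp]: "(r *\<^sub>R f) x = r *\<^sub>R f x"
  by (simp add: scaleR_fun_def)

lemma sum_fun_apply: "(\<Sum>k\<in>S. f k) x = (\<Sum>k\<in>S. f k x)"
  by (induction S rule: infinite_finite_induct) auto

lemma bilinear_sum_left: "bilinear a \<Longrightarrow> a (\<Sum>e\<in>E. c e *\<^sub>R g e) y = (\<Sum>e\<in>E. c e * a (g e) y)"
  using linear_sum[of "\<lambda>x. a x y" "\<lambda>e. c e *\<^sub>R g e" E] linear_cmul[of "\<lambda>x. a x y"]
  by (simp add: bilinear_def)

text \<open>Vectors are added one at a time. The part \<open>w\<close> of \<open>b\<close> orthogonal to the vectors found so far is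
either zero, and then \<open>b\<close> adds nothing to the span, or it can be normalized.\<close>

lemma gram_schmidt:
  fixes a :: "'a::real_vector \<Rightarrow> 'a \<Rightarrow> real"
  assumes "bilinear a" "\<And>u v. a u v = a v u" "finite B" "\<And>v. v \<in> span B \<Longrightarrow> v \<noteq> 0 \<Longrightarrow> 0 < a v v"
  shows "\<exists>E. finite E \<and> span E = span B \<and> (\<forall>e\<in>E. \<forall>f\<in>E. a e f = (if e = f then 1 else 0))"
  using assms(3,4)
proof (induction B rule: finite_induct)
  case empty
  then show ?case by (intro exI[of _ "{}"]) auto
next
  case (insert b B)
  have lin: "linear (\<lambda>x. a x y)" for y
    using assms(1) by (simp add: bilinear_def)
  have lin2: "linear (\<lambda>x. a y x)" for y
    using assms(1) by (simp add: bilinear_def)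
  have "span B \<subseteq> span (insert b B)" by (intro span_mono) auto
  with insert obtain E where E: "finite E" "span E = span B"
    "\<forall>e\<in>E. \<forall>f\<in>E. a e f = (if e = f then 1 else 0)" by blast
  define w where "w = b - (\<Sum>e\<in>E. a b e *\<^sub>R e)"
  have sE: "(\<Sum>e\<in>E. a b e *\<^sub>R e) \<in> span E"
    by (intro span_sum span_scale span_base)
  have span_w: "span (insert w E) = span (insert b B)"
  proof -
    have "span (insert w E) = span (insert b E)"
      unfolding w_def by (rule eq_span_insert_eq) (use sE in \<open>auto simp: span_diff span_neg intro: span_neg\<close>)
    also have "\<dots> = span (insert b B)"
      using E(2) by (simp add: span_insert)
    finally show ?thesis .
  qed
  show ?case
  proof (cases "w = 0")
    case True
    then have "span E = span (insert b B)" using span_w by (simp add: span_insert_0)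
    with E show ?thesis by blast
  next
    case False
    have wS: "w \<in> span (insert b B)" using span_w by (metis insertI1 span_base)
    have pos: "0 < a w w" using insert.prems[OF wS False] .
    have orth: "a w f = 0" if "f \<in> E" for f
    proof -
      have "a w f = a b f - (\<Sum>e\<in>E. a b e * a e f)"
        unfolding w_def using linear_diff[OF lin] bilinear_sum_left[OF assms(1), of "a b" "\<lambda>e. e" E f] by simp
      also have "(\<Sum>e\<in>E. a b e * a e f) = (\<Sum>e\<in>E. if e = f then a b e else 0)"
        using E(3) that by (intro sum.cong) auto
      also have "\<dots> = a b f" using E(1) that by simp
      finally show ?thesis by simp
    qed
    define u where "u = (1 / sqrt (a w w)) *\<^sub>R w"
    have uu: "a u u = 1"
    proof -
      have "a u u = (1 / sqrt (a w w)) * ((1 / sqrt (a w w)) * a w w)"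
        unfolding u_def using linear_cmul[OF lin] linear_cmul[OF lin2] by simp
      then show ?thesis using pos by (simp add: real_div_sqrt)
    qed
    have uo: "a u f = 0" "a f u = 0" if "f \<in> E" for f
      using orth[OF that] linear_cmul[OF lin] assms(2)[of f u] unfolding u_def by simp_all
    have un: "u \<notin> E" using uo uu by force
    have "span (insert u E) = span (insert w E)"
    proof -
      have c: "1 / sqrt (a w w) \<noteq> 0" using pos by auto
      have w: "w = sqrt (a w w) *\<^sub>R u" unfolding u_def using pos by simp
      show ?thesis
      proof (intro antisym span_minimal subspace_span subsetI)
        fix x assume "x \<in> insert u E"
        then show "x \<in> span (insert w E)"
          unfolding u_def by (auto intro: span_base span_scale)
      next
        fix x assume "x \<in> insert w E"
        then show "x \<in> span (insert u E)"
        proof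
          assume "x = w" then show ?thesis by (subst \<open>x = w\<close>, subst w) (auto intro: span_base span_scale)
        qed (auto intro: span_base)
      qed
    qed
    moreover have "\<forall>e\<in>insert u E. \<forall>f\<in>insert u E. a e f = (if e = f then 1 else 0)"
      using E(3) uo uu un by auto
    ultimately show ?thesis using E(1) span_w by (intro exI[of _ "insert u E"]) auto
  qed
qed

text \<open>Definiteness is required on \<open>V\<close> only: the form \<open>a\<^sub>h\<close> vanishes on functions that are constant in
space and time, which \<open>V\<^sub>h\<close> excludes.\<close>

locale inner_form =
  fixes V :: "'a::real_vector set" and a :: "'a \<Rightarrow> 'a \<Rightarrow> real"
  assumes sub: "subspace V"
    and fin: "\<exists>B. finite B \<and> V \<subseteq> span B"
    and bil: "bilinear a"
    and sym: "a u v = a v u"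
    and nonneg: "0 \<le> a v v"
    and pos: "v \<in> V \<Longrightarrow> v \<noteq> 0 \<Longrightarrow> 0 < a v v"
begin

definition form_norm where "form_norm v = sqrt (a v v)"

lemma lin: "linear (\<lambda>x. a x y)" and lin_right: "linear (a x)"
  using bil by (auto simp: bilinear_def)

text \<open>A maximal independent subset of \<open>V\<close> is finite, because \<open>V\<close> lies in the span of a finite set, and
can be orthonormalized.\<close>

lemma orthonormal_basis:
  "\<exists>E. finite E \<and> E \<subseteq> V \<and> (\<forall>v\<in>V. v = (\<Sum>e\<in>E. a v e *\<^sub>R e)) \<and> (\<forall>e\<in>E. a e e = 1)"
proof -
  obtain B where B: "finite B" "V \<subseteq> span B" using fin by blast
  obtain B' where B': "B' \<subseteq> V" "independent B'" "V \<subseteq> span B'"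
    using maximal_independent_subset[of V] by blast
  have "finite B'" using independent_span_bound[OF B(1) B'(2)] B'(1) B(2) by blast
  have V: "span B' = V"
    using B' sub by (simp add: span_minimal subset_antisym)
  obtain E where E: "finite E" "span E = span B'" "\<forall>e\<in>E. \<forall>f\<in>E. a e f = (if e = f then 1 else 0)"
    using gram_schmidt[OF bil sym \<open>finite B'\<close>] pos V by auto
  have "v = (\<Sum>e\<in>E. a v e *\<^sub>R e)" if "v \<in> V" for v
  proof -
    have "v \<in> range (\<lambda>c. \<Sum>e\<in>E. c e *\<^sub>R e)"
      using that V E(1,2) span_finite[of E] by simp
    then obtain c where c: "v = (\<Sum>e\<in>E. c e *\<^sub>R e)" by blast
    have "a v f = c f" if "f \<in> E" for f
    proof -
      have "a v f = (\<Sum>e\<in>E. c e * a e f)"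
        unfolding c by (rule bilinear_sum_left[OF bil])
      also have "\<dots> = (\<Sum>e\<in>E. if e = f then c e else 0)"
        using E(3) that by (intro sum.cong) auto
      finally show ?thesis using E(1) that by simp
    qed
    then show ?thesis by (subst c) (auto intro: sum.cong)
  qed
  moreover have "E \<subseteq> V" using E(2) V span_superset by blast
  ultimately show ?thesis using E(1,3) by (intro exI[of _ E]) auto
qed

lemma cauchy_schwarz: "u \<in> V \<Longrightarrow> v \<in> V \<Longrightarrow> \<bar>a u v\<bar> \<le> form_norm u * form_norm v"
proof -
  assume uv: "u \<in> V" "v \<in> V"
  show ?thesis
  proof (cases "v = 0")
    case True
    then show ?thesis using linear_0[OF lin_right] by (simp add: form_norm_def)
  next
    case False
    then have p: "0 < a v v" using pos uv by blast
    define t where "t = a u v / a v v"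
    have "0 \<le> a (u - t *\<^sub>R v) (u - t *\<^sub>R v)" by (rule nonneg)
    also have "\<dots> = a u u - 2 * t * a u v + t\<^sup>2 * a v v"
      by (simp add: linear_diff[OF lin] linear_diff[OF lin_right] linear_cmul[OF lin]
          linear_cmul[OF lin_right] sym[of v u]) (simp add: algebra_simps power2_eq_square)
    also have "\<dots> = a u u - (a u v)\<^sup>2 / a v v"
      using p by (simp add: t_def field_simps power2_eq_square)
    finally have "(a u v)\<^sup>2 \<le> a u u * a v v" using p by (simp add: field_simps)
    then have "sqrt ((a u v)\<^sup>2) \<le> sqrt (a u u * a v v)" by (rule real_sqrt_le_mono)
    then show ?thesis by (simp add: form_norm_def real_sqrt_mult)
  qed
qed

text \<open>The coefficients of \<open>v\<close> in an orthonormal basis are bounded by the norm of \<open>v\<close>. This is what makes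
suprema of quotients such as \<open>\<kappa>\<close> and \<open>\<Lambda>\<close> finite.\<close>

lemma seminorm_bounded:
  assumes sub_add: "\<And>u v. u \<in> V \<Longrightarrow> v \<in> V \<Longrightarrow> p (u + v) \<le> p u + (p v :: real)"
    and homog: "\<And>c v. v \<in> V \<Longrightarrow> p (c *\<^sub>R v) = \<bar>c\<bar> * p v"
  shows "\<exists>C. \<forall>v\<in>V. p v \<le> C * form_norm v"
proof -
  obtain E where E: "finite E" "E \<subseteq> V" "\<And>v. v \<in> V \<Longrightarrow> v = (\<Sum>e\<in>E. a v e *\<^sub>R e)"
    "\<And>e. e \<in> E \<Longrightarrow> a e e = 1" using orthonormal_basis by meson
  have p0: "p 0 = 0" using homog[of 0 0] sub by (simp add: subspace_0)
  have p_sum: "p (\<Sum>e\<in>F. c e *\<^sub>R e) \<le> (\<Sum>e\<in>F. \<bar>c e\<bar> * p e)" if "F \<subseteq> E" for F c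
    using finite_subset[OF that E(1)] that
  proof (induction F rule: finite_induct)
    case empty
    then show ?case using p0 by simp
  next
    case (insert f F)
    have "(\<Sum>e\<in>F. c e *\<^sub>R e) \<in> V" "c f *\<^sub>R f \<in> V"
      using insert.prems E(2) sub by (auto intro!: subspace_sum subspace_scale)
    then have "p (\<Sum>e\<in>insert f F. c e *\<^sub>R e) \<le> p (c f *\<^sub>R f) + p (\<Sum>e\<in>F. c e *\<^sub>R e)"
      using insert.hyps sub_add by simp
    moreover have "p (c f *\<^sub>R f) = \<bar>c f\<bar> * p f" using homog insert.prems E(2) by blast
    ultimately show ?case using insert by simp
  qed
  have "p v \<le> (\<Sum>e\<in>E. \<bar>p e\<bar>) * form_norm v" if v: "v \<in> V" for v
  proof -
    have "p v \<le> (\<Sum>e\<in>E. \<bar>a v e\<bar> * p e)" using p_sum[of E "a v"] E(3)[OF v] by simp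
    also have "\<dots> \<le> (\<Sum>e\<in>E. form_norm v * \<bar>p e\<bar>)"
    proof (rule sum_mono)
      fix e assume e: "e \<in> E"
      have "\<bar>a v e\<bar> \<le> form_norm v * form_norm e" using cauchy_schwarz v e E(2) by blast
      also have "form_norm e = 1" using E(4)[OF e] by (simp add: form_norm_def)
      finally show "\<bar>a v e\<bar> * p e \<le> form_norm v * \<bar>p e\<bar>"
        by (simp add: mult_mono')
           (smt (verit, best) abs_ge_self abs_ge_zero mult_mono mult_left_mono)
    qed
    finally show ?thesis by (simp add: sum_distrib_left mult.commute)
  qed
  then show ?thesis by blast
qed

text \<open>The representer has the coefficients \<open>l e\<close> in an orthonormal basis. It is the solution of the discrete
Poisson problem with load \<open>l\<close>, and its norm bounds the dual norm of \<open>l\<close>.\<close>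

lemma riesz:
  assumes "linear l"
  shows "\<exists>!u. u \<in> V \<and> (\<forall>v\<in>V. a u v = l v)"
proof -
  obtain E where E: "finite E" "E \<subseteq> V" "\<And>v. v \<in> V \<Longrightarrow> v = (\<Sum>e\<in>E. a v e *\<^sub>R e)"
    "\<And>e. e \<in> E \<Longrightarrow> a e e = 1" using orthonormal_basis by meson
  define u where "u = (\<Sum>e\<in>E. l e *\<^sub>R e)"
  have uV: "u \<in> V" unfolding u_def using E(2) sub by (auto intro!: subspace_sum subspace_scale)
  have u: "a u v = l v" if v: "v \<in> V" for v
  proof -
    have "a u v = (\<Sum>e\<in>E. l e * a e v)" unfolding u_def by (rule bilinear_sum_left[OF bil])
    also have "\<dots> = l (\<Sum>e\<in>E. a v e *\<^sub>R e)"
      by (simp add: linear_sum[OF assms] linear_cmul[OF assms] sym[of v] mult.commute)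
    finally show ?thesis using E(3)[OF v] by simp
  qed
  show ?thesis
  proof (rule ex1I[of _ u])
    show "u \<in> V \<and> (\<forall>v\<in>V. a u v = l v)" using uV u by blast
  next
    fix u' assume u': "u' \<in> V \<and> (\<forall>v\<in>V. a u' v = l v)"
    then have d: "u' - u \<in> V" using uV sub by (blast intro: subspace_diff)
    then have "a (u' - u) (u' - u) = 0"
      using u u' linear_diff[OF lin] by simp
    then show "u' = u" using pos[OF d] by auto
  qed
qed

end

section \<open>Tangent planes, surface gradients and area\<close>

text \<open>Up to the factor \<open>n \<bullet> n\<close>, the vectors \<open>e2 \<times> n\<close>, \<open>n \<times> e1\<close> and \<open>n\<close> are the frame reciprocal
to \<open>e1\<close>, \<open>e2\<close>, \<open>n\<close>.\<close>

lemma triad_expansion: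
  fixes e1 e2 v :: "real^3"
  defines "n \<equiv> cross3 e1 e2"
  shows "(n \<bullet> n) *\<^sub>R v = (v \<bullet> cross3 e2 n) *\<^sub>R e1 + (v \<bullet> cross3 n e1) *\<^sub>R e2 + (v \<bullet> n) *\<^sub>R n"
  unfolding n_def vec_eq_iff forall_3
  by (simp add: inner_vec_def sum_3 cross3_def algebra_simps)

lemma perp_two_imp_parallel:
  fixes e1 e2 w :: "real^3"
  assumes "cross3 e1 e2 \<noteq> 0" "w \<bullet> e1 = 0" "w \<bullet> e2 = 0"
  shows "\<exists>c. w = c *\<^sub>R cross3 e1 e2"
proof -
  define n where "n = cross3 e1 e2"
  have nn: "n \<bullet> n \<noteq> 0" using assms(1) by (simp add: n_def)
  have "(n \<bullet> n) *\<^sub>R w - (w \<bullet> n) *\<^sub>R n = (w \<bullet> cross3 e2 n) *\<^sub>R e1 + (w \<bullet> cross3 n e1) *\<^sub>R e2"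
    using triad_expansion[of e1 e2 w] by (simp add: n_def)
  moreover have "((n \<bullet> n) *\<^sub>R w - (w \<bullet> n) *\<^sub>R n) \<bullet> ((w \<bullet> cross3 e2 n) *\<^sub>R e1 + (w \<bullet> cross3 n e1) *\<^sub>R e2) = 0"
    by (simp add: inner_diff_left inner_add_right assms(2,3) n_def dot_cross_self)
  ultimately have "(n \<bullet> n) *\<^sub>R w = (w \<bullet> n) *\<^sub>R n" by simp
  then have "(1 / (n \<bullet> n)) *\<^sub>R ((n \<bullet> n) *\<^sub>R w) = (1 / (n \<bullet> n)) *\<^sub>R ((w \<bullet> n) *\<^sub>R n)" by simp
  then have "w = ((w \<bullet> n) / (n \<bullet> n)) *\<^sub>R n" using nn by simp
  then show ?thesis unfolding n_def ..
qed

lemma perp_cross_imp_span: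
  fixes e1 e2 v :: "real^3"
  assumes "cross3 e1 e2 \<noteq> 0" "v \<bullet> cross3 e1 e2 = 0"
  shows "\<exists>\<alpha> \<beta>. v = \<alpha> *\<^sub>R e1 + \<beta> *\<^sub>R e2"
proof -
  define n where "n = cross3 e1 e2"
  have nn: "n \<bullet> n \<noteq> 0" using assms(1) by (simp add: n_def)
  have "(n \<bullet> n) *\<^sub>R v = (v \<bullet> cross3 e2 n) *\<^sub>R e1 + (v \<bullet> cross3 n e1) *\<^sub>R e2"
    using triad_expansion[of e1 e2 v] assms(2) by (simp add: n_def)
  then have "(1 / (n \<bullet> n)) *\<^sub>R ((n \<bullet> n) *\<^sub>R v) = (1 / (n \<bullet> n)) *\<^sub>R ((v \<bullet> cross3 e2 n) *\<^sub>R e1 + (v \<bullet> cross3 n e1) *\<^sub>R e2)"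
    by simp
  then have "v = ((v \<bullet> cross3 e2 n) / (n \<bullet> n)) *\<^sub>R e1 + ((v \<bullet> cross3 n e1) / (n \<bullet> n)) *\<^sub>R e2"
    using nn by (simp add: scaleR_add_right)
  then show ?thesis by blast
qed

lemma cross_indep:
  fixes e1 e2 :: "real^3"
  assumes "cross3 e1 e2 \<noteq> 0" "\<alpha> *\<^sub>R e1 + \<beta> *\<^sub>R e2 = 0"
  shows "\<alpha> = 0 \<and> \<beta> = 0"
proof -
  have "cross3 (\<alpha> *\<^sub>R e1 + \<beta> *\<^sub>R e2) e2 = \<alpha> *\<^sub>R cross3 e1 e2"
    "cross3 e1 (\<alpha> *\<^sub>R e1 + \<beta> *\<^sub>R e2) = \<beta> *\<^sub>R cross3 e1 e2"
    by (simp_all add: cross_add_left cross_add_right cross_mult_left cross_mult_right cross_refl)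
  then show ?thesis using assms by (auto simp: cross_zero_left cross_zero_right)
qed

lemma Ck_imp_continuous_on: "Ck k f U \<Longrightarrow> continuous_on U f"
proof (cases k)
  case (Suc k')
  assume "Ck k f U"
  then obtain f' where "\<forall>x\<in>U. (f has_derivative f' x) (at x)" using Suc by auto
  then show ?thesis by (meson continuous_at_imp_continuous_on has_derivative_continuous)
qed auto

lemma Ck_Suc_1:
  assumes "Ck (Suc k) f U"
  obtains f' where "\<And>x. x \<in> U \<Longrightarrow> (f has_derivative f' x) (at x)" "\<And>v. continuous_on U (\<lambda>x. f' x v)"
  using assms Ck_imp_continuous_on by fastforce

text \<open>A chart of class \<open>C\<^sup>3\<close> is also one of class \<open>C\<^sup>1\<close>, the class that the area formula refers to. Its
derivative is made explicit, because its values are the tangent vectors.\<close>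

lemma chart:
  assumes "embedded_C3_surface M" "x \<in> M"
  obtains U X Y f' where "open U" "x \<in> X ` U" "regular_param 1 M U X"
    "openin (top_of_set M) (X ` U)" "homeomorphism U (X ` U) X Y"
    "\<And>u. u \<in> U \<Longrightarrow> (X has_derivative f' u) (at u)"
    "\<And>v. continuous_on U (\<lambda>u. f' u v)"
    "\<And>u. u \<in> U \<Longrightarrow> area_normal X u = cross3 (f' u (axis 1 1)) (f' u (axis 2 1))"
    "\<And>u. u \<in> U \<Longrightarrow> cross3 (f' u (axis 1 1)) (f' u (axis 2 1)) \<noteq> 0"
proof -
  obtain U X Y where UXY: "regular_param 3 M U X" "x \<in> X ` U" "openin (top_of_set M) (X ` U)"
    "homeomorphism U (X ` U) X Y" using assms unfolding embedded_C3_surface_def by blast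
  have "Ck (Suc 2) X U" using UXY(1) by (simp add: regular_param_def numeral_3_eq_3 numeral_2_eq_2)
  then obtain f' where f': "\<And>x. x \<in> U \<Longrightarrow> (X has_derivative f' x) (at x)" "\<And>v. continuous_on U (\<lambda>x. f' x v)"
    by (metis Ck_Suc_1)
  have an: "area_normal X u = cross3 (f' u (axis 1 1)) (f' u (axis 2 1))" if "u \<in> U" for u
    using frechet_derivative_at[OF f'(1)[OF that]] by (simp add: area_normal_def)
  have "Ck 1 X U" using f' by auto
  then have rp: "regular_param 1 M U X" using UXY(1) by (simp add: regular_param_def)
  have oU: "open U" and nz: "\<And>u. u \<in> U \<Longrightarrow> area_normal X u \<noteq> 0"
    using UXY(1) unfolding regular_param_def by blast+
  show ?thesis
    by (rule that[OF oU UXY(2) rp UXY(3,4) f' an]) (use an nz in auto)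
qed

text \<open>On the surface this is the projection onto the tangent space, in a form that is visibly linear in
\<open>v\<close> and continuous in \<open>x\<close>.\<close>

definition tproj :: "(real^3 \<Rightarrow> real^3) \<Rightarrow> real^3 \<Rightarrow> real^3 \<Rightarrow> real^3" where
  "tproj \<nu> x v = v - (\<nu> x \<bullet> v) *\<^sub>R \<nu> x"

lemma tproj_linear: "linear (tproj \<nu> x)"
  by (rule linearI) (simp_all add: tproj_def inner_add_right algebra_simps)

locale oriented_surface =
  fixes M :: "(real^3) set" and \<nu>
  assumes emb: "embedded_C3_surface M" and normal: "unit_normal_field M \<nu>"
begin

lemma norm_normal: "x \<in> M \<Longrightarrow> norm (\<nu> x) = 1" and normal_sq: "x \<in> M \<Longrightarrow> \<nu> x \<bullet> \<nu> x = 1"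
  using normal by (auto simp: unit_normal_field_def dot_square_norm)

text \<open>The tangent vector is the velocity of the chart image of a straight line. Tangent vectors are defined
by curves on the whole real line, so the curve is continued by the constant \<open>X u\<close> where the line has
left the chart.\<close>

lemma derivative_in_tangent_space:
  assumes "regular_param k M U X" "u \<in> U" "(X has_derivative L) (at u)"
  shows "L h \<in> tangent_space M (X u)"
proof -
  have oU: "open U" "X ` U \<subseteq> M" using assms(1) by (auto simp: regular_param_def)
  define \<gamma> where "\<gamma> s = (if u + s *\<^sub>R h \<in> U then X (u + s *\<^sub>R h) else X u)" for s :: real
  have "((\<lambda>s. u + s *\<^sub>R h) has_derivative (\<lambda>s. s *\<^sub>R h)) (at (0::real))"
    by (auto intro!: derivative_eq_intros)
  moreover have "(X has_derivative L) (at (u + 0 *\<^sub>R h))" using assms(3) by simp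
  ultimately have "((\<lambda>s. X (u + s *\<^sub>R h)) has_derivative (\<lambda>s. L (s *\<^sub>R h))) (at (0::real))"
    by (rule has_derivative_compose[where s = UNIV, simplified])
  then have d: "((\<lambda>s. X (u + s *\<^sub>R h)) has_vector_derivative L h) (at (0::real))"
    using linear_cmul[OF has_derivative_linear[OF assms(3)]] by (simp add: has_vector_derivative_def)
  have op: "open ((\<lambda>s::real. u + s *\<^sub>R h) -` U)"
    by (intro continuous_open_vimage oU) (auto intro!: continuous_intros)
  have "(\<gamma> has_vector_derivative L h) (at 0)"
    by (rule has_vector_derivative_transform_within_open[OF d op]) (use assms(2) in \<open>auto simp: \<gamma>_def\<close>)
  moreover have "range \<gamma> \<subseteq> M" using oU(2) assms(2) by (auto simp: \<gamma>_def)
  moreover have "\<gamma> 0 = X u" by (simp add: \<gamma>_def)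
  ultimately show ?thesis unfolding tangent_space_def by blast
qed

text \<open>The normal is orthogonal to the two independent values \<open>f' e\<^sub>1\<close>, \<open>f' e\<^sub>2\<close> of a chart derivative,
hence parallel to their cross product. A vector orthogonal to it is therefore a combination of these
two values, and so a tangent vector.\<close>

lemma tangent_space_eq:
  assumes x: "x \<in> M"
  shows "tangent_space M x = {v. \<nu> x \<bullet> v = 0}"
proof
  show "tangent_space M x \<subseteq> {v. \<nu> x \<bullet> v = 0}" using normal x by (auto simp: unit_normal_field_def)
next
  obtain U X and Y :: "real^3 \<Rightarrow> real^2" and f' where c: "open U" "x \<in> X ` U" "regular_param 1 M U X"
    "\<And>u. u \<in> U \<Longrightarrow> (X has_derivative f' u) (at u)"
    "\<And>u. u \<in> U \<Longrightarrow> cross3 (f' u (axis 1 1)) (f' u (axis 2 1)) \<noteq> 0"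
    using chart[OF emb x] by metis
  obtain u where u: "u \<in> U" "x = X u" using c(2) by blast
  let ?e1 = "f' u (axis 1 1)" and ?e2 = "f' u (axis 2 1)"
  have tan: "f' u h \<in> tangent_space M x" for h
    using derivative_in_tangent_space[OF c(3) u(1) c(4)[OF u(1)]] u(2) by simp
  then have "\<nu> x \<bullet> ?e1 = 0" "\<nu> x \<bullet> ?e2 = 0" using normal x by (auto simp: unit_normal_field_def)
  then obtain k where k: "\<nu> x = k *\<^sub>R cross3 ?e1 ?e2" using perp_two_imp_parallel c(5)[OF u(1)] by blast
  have "k \<noteq> 0" using k norm_normal[OF x] by auto
  show "{v. \<nu> x \<bullet> v = 0} \<subseteq> tangent_space M x"
  proof
    fix v assume "v \<in> {v. \<nu> x \<bullet> v = 0}"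
    then have "v \<bullet> cross3 ?e1 ?e2 = 0" using k \<open>k \<noteq> 0\<close> by (simp add: inner_commute)
    then obtain \<alpha> \<beta> where v: "v = \<alpha> *\<^sub>R ?e1 + \<beta> *\<^sub>R ?e2" using perp_cross_imp_span c(5)[OF u(1)] by blast
    have l: "linear (f' u)" using c(4)[OF u(1)] by (rule has_derivative_linear)
    have "v = f' u (\<alpha> *\<^sub>R axis 1 1 + \<beta> *\<^sub>R axis 2 1)"
      unfolding v by (simp add: linear_add[OF l] linear_cmul[OF l])
    then show "v \<in> tangent_space M x" using tan by metis
  qed
qed

lemma tproj_in: "x \<in> M \<Longrightarrow> tproj \<nu> x v \<in> tangent_space M x"
  by (simp add: tangent_space_eq tproj_def inner_diff_right normal_sq)

lemma tangent_proj_eq: 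
  assumes x: "x \<in> M" shows "tangent_proj M x v = tproj \<nu> x v"
  unfolding tangent_proj_def
proof (rule the_equality)
  show "tproj \<nu> x v \<in> tangent_space M x \<and> (\<forall>u\<in>tangent_space M x. (v - tproj \<nu> x v) \<bullet> u = 0)"
    using tproj_in[OF x] by (simp add: tangent_space_eq[OF x] tproj_def)
next
  fix w assume w: "w \<in> tangent_space M x \<and> (\<forall>u\<in>tangent_space M x. (v - w) \<bullet> u = 0)"
  have d: "w - tproj \<nu> x v \<in> tangent_space M x"
    using w tproj_in[OF x, of v] by (simp add: tangent_space_eq[OF x] inner_diff_right)
  have "(v - w) \<bullet> (w - tproj \<nu> x v) = 0" using w d by blast
  moreover have "(v - tproj \<nu> x v) \<bullet> (w - tproj \<nu> x v) = 0"
    using d by (simp add: tangent_space_eq[OF x] tproj_def)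
  ultimately have "(w - tproj \<nu> x v) \<bullet> (w - tproj \<nu> x v) = 0" by (simp add: inner_diff_left)
  then show "w = tproj \<nu> x v" by simp
qed

text \<open>Chords of the surface are tangential to first order. In a chart, \<open>y - x\<close> differs from the tangent
vector \<open>f' h\<close> by \<open>o(|h|)\<close>, and \<open>|h|\<close> is at most a multiple of \<open>|y - x|\<close> because \<open>f'\<close> is injective.\<close>

lemma identity_tangential_derivative:
  assumes x: "x \<in> M"
  shows "((\<lambda>y. y) has_derivative tproj \<nu> x) (at x within M)"
  unfolding has_derivative_within_alt
proof (intro conjI allI impI)
  show "bounded_linear (tproj \<nu> x)" using tproj_linear linear_conv_bounded_linear by blast
next
  fix e :: real assume e: "0 < e"
  obtain U X Y f' where c: "open U" "x \<in> X ` U" "regular_param 1 M U X"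
    "openin (top_of_set M) (X ` U)" "homeomorphism U (X ` U) X Y"
    "\<And>u. u \<in> U \<Longrightarrow> (X has_derivative f' u) (at u)"
    "\<And>u. u \<in> U \<Longrightarrow> cross3 (f' u (axis 1 1)) (f' u (axis 2 1)) \<noteq> 0"
    using chart[OF emb x] by metis
  obtain u where u: "u \<in> U" "x = X u" using c(2) by blast
  have lf: "linear (f' u)" using c(6)[OF u(1)] by (rule has_derivative_linear)
  have "inj (f' u)"
    unfolding linear_injective_0[OF lf]
  proof (intro allI impI)
    fix h assume h: "f' u h = 0"
    have "h = (h $ 1) *\<^sub>R axis 1 1 + (h $ 2) *\<^sub>R axis 2 1"
      by (simp add: vec_eq_iff forall_2 axis_def)
    then have "f' u h = (h $ 1) *\<^sub>R f' u (axis 1 1) + (h $ 2) *\<^sub>R f' u (axis 2 1)"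
      by (metis linear_add[OF lf] linear_cmul[OF lf])
    with h cross_indep[OF c(7)[OF u(1)]] have "h $ 1 = 0 \<and> h $ 2 = 0" by metis
    then show "h = 0" by (simp add: vec_eq_iff forall_2)
  qed
  then obtain k where k: "k > 0" "\<And>h. k * norm h \<le> norm (f' u h)"
    using linear_inj_bounded_below_pos[OF lf] by metis
  \<comment> \<open>The first bound makes \<open>|h|\<close> comparable to \<open>|y - x|\<close>, the second makes the normal part small.\<close>
  define e' where "e' = min (k / 2) (e * k / 2)"
  have e': "0 < e'" using k e by (simp add: e'_def)
  obtain d1 where d1: "d1 > 0" "\<And>u'. norm (u' - u) < d1 \<Longrightarrow> norm (X u' - X u - f' u (u' - u)) \<le> e' * norm (u' - u)"
    using c(6)[OF u(1)] e' unfolding has_derivative_at_alt by blast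
  have Yx: "Y x = u" using c(5) u by (simp add: homeomorphism_apply1)
  have "continuous_on (X ` U) Y" using c(5) by (simp add: homeomorphism_def)
  then obtain d2 where d2: "d2 > 0" "\<And>y. y \<in> X ` U \<Longrightarrow> dist y x < d2 \<Longrightarrow> dist (Y y) u < d1"
    using c(2) d1(1) Yx unfolding continuous_on_iff by metis
  obtain d3 where d3: "d3 > 0" "\<And>y. y \<in> M \<Longrightarrow> dist y x < d3 \<Longrightarrow> y \<in> X ` U"
    using c(2,4) unfolding openin_euclidean_subtopology_iff by metis
  show "\<exists>d>0. \<forall>y\<in>M. norm (y - x) < d \<longrightarrow> norm (y - x - tproj \<nu> x (y - x)) \<le> e * norm (y - x)"
  proof (intro exI[of _ "min d2 d3"] conjI ballI impI)
    show "0 < min d2 d3" using d2 d3 by simp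
    fix y assume y: "y \<in> M" "norm (y - x) < min d2 d3"
    then have yU: "y \<in> X ` U" using d3 by (simp add: dist_norm)
    define h where "h = Y y - u"
    have hd: "norm h < d1" using d2(2)[OF yU] y by (simp add: dist_norm h_def)
    have Xy: "X (Y y) = y" using c(5) yU by (simp add: homeomorphism_apply2)
    have r: "norm (y - x - f' u h) \<le> e' * norm h"
      using d1(2)[of "Y y"] hd Xy u(2) by (simp add: h_def)
    have "k * norm h \<le> norm (f' u h)" by (rule k)
    also have "\<dots> \<le> norm (y - x) + norm (y - x - f' u h)"
      using norm_triangle_ineq4[of "y - x" "y - x - f' u h"] by simp
    also have "\<dots> \<le> norm (y - x) + k / 2 * norm h"
      using order_trans[OF r mult_right_mono[of e' "k/2" "norm h"]] by (simp add: e'_def)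
    finally have low: "k / 2 * norm h \<le> norm (y - x)" by simp
    have "f' u h \<in> tangent_space M x"
      using derivative_in_tangent_space[OF c(3) u(1) c(6)[OF u(1)]] u(2) by simp
    then have "\<nu> x \<bullet> f' u h = 0" using tangent_space_eq[OF x] by simp
    then have "\<nu> x \<bullet> (y - x) = \<nu> x \<bullet> (y - x - f' u h)" by (simp add: inner_diff_right)
    then have "\<bar>\<nu> x \<bullet> (y - x)\<bar> \<le> norm (y - x - f' u h)"
      using Cauchy_Schwarz_ineq2[of "\<nu> x" "y - x - f' u h"] norm_normal[OF x] by simp
    also have "\<dots> \<le> e' * norm h" by (rule r)
    also have "\<dots> \<le> e * (k / 2 * norm h)"
      using mult_right_mono[of e' "e * k/2" "norm h"] by (simp add: e'_def mult.assoc)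
    also have "\<dots> \<le> e * norm (y - x)" using low e by (intro mult_left_mono) auto
    finally show "norm (y - x - tproj \<nu> x (y - x)) \<le> e * norm (y - x)"
      by (simp add: tproj_def norm_normal[OF x])
  qed
qed

text \<open>Since chords are tangential to first order, the derivative along the surface may be composed with the
tangent projection. It is unique as a tangent vector, because the difference of two candidates is
the velocity of some curve on the surface.\<close>

lemma surf_grad_eq:
  assumes x: "x \<in> M" and f: "(f has_derivative f') (at x within M)"
  shows "surf_grad M f x = tproj \<nu> x (\<chi> d. f' (axis d 1))"
proof -
  define g where "g = (\<chi> d. f' (axis d 1))"
  have lf: "linear f'" using f by (rule has_derivative_linear)
  have f'g: "f' v = g \<bullet> v" for v
  proof -
    have "v = (\<Sum>d\<in>UNIV. v $ d *\<^sub>R axis d 1)" using basis_expansion[of v] by (simp add: scalar_mult_eq_scaleR)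
    then have "f' v = (\<Sum>d\<in>UNIV. v $ d * f' (axis d 1))"
      using linear_sum[OF lf] linear_cmul[OF lf] by (metis (mono_tags, lifting) real_scaleR_def sum.cong)
    then show ?thesis by (simp add: g_def inner_vec_def mult.commute)
  qed
  have "(f has_derivative f') (at ((\<lambda>y. y) x) within (\<lambda>y. y) ` M)" using f by simp
  from has_derivative_in_compose[OF identity_tangential_derivative[OF x] this]
  have "(f has_derivative (\<lambda>v. f' (tproj \<nu> x v))) (at x within M)" by simp
  moreover have "f' (tproj \<nu> x v) = tproj \<nu> x g \<bullet> v" for v
    unfolding f'g tproj_def by (simp add: inner_diff_left inner_diff_right inner_commute)
  ultimately have d: "(f has_derivative (\<lambda>v. tproj \<nu> x g \<bullet> v)) (at x within M)" by simp
  show ?thesis unfolding surf_grad_def g_def[symmetric]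
  proof (rule the_equality)
    show "tproj \<nu> x g \<in> tangent_space M x \<and> (f has_derivative (\<lambda>v. tproj \<nu> x g \<bullet> v)) (at x within M)"
      using d tproj_in[OF x] by blast
  next
    fix w assume w: "w \<in> tangent_space M x \<and> (f has_derivative (\<bullet>) w) (at x within M)"
    define k where "k = w - tproj \<nu> x g"
    have k: "k \<in> tangent_space M x"
      using w tproj_in[OF x, of g] by (simp add: k_def tangent_space_eq[OF x] inner_diff_right)
    then obtain \<gamma> where \<gamma>: "range \<gamma> \<subseteq> M" "\<gamma> 0 = x" "(\<gamma> has_vector_derivative k) (at (0::real))"
      unfolding tangent_space_def by blast
    have fx: "((\<lambda>s. f (\<gamma> s)) has_derivative (\<lambda>s. r \<bullet> (s *\<^sub>R k))) (at 0)"
      if "(f has_derivative (\<bullet>) r) (at x within M)" for r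
    proof -
      have "(f has_derivative (\<bullet>) r) (at (\<gamma> 0) within range \<gamma>)"
        using has_derivative_subset[OF that \<gamma>(1)] \<gamma>(2) by simp
      from has_derivative_in_compose[OF \<gamma>(3)[unfolded has_vector_derivative_def] this] show ?thesis .
    qed
    from has_derivative_unique[OF fx fx, of w "tproj \<nu> x g"] w d
    have "(\<lambda>s. w \<bullet> (s *\<^sub>R k)) = (\<lambda>s. tproj \<nu> x g \<bullet> (s *\<^sub>R k))" by blast
    then have "w \<bullet> (1 *\<^sub>R k) = tproj \<nu> x g \<bullet> (1 *\<^sub>R k)" by meson
    then have "k \<bullet> k = 0" by (simp add: k_def inner_diff_left)
    then show "w = tproj \<nu> x g" by (simp add: k_def)
  qed
qed

lemma continuous_on_tproj:
  assumes "continuous_on S p" "continuous_on S v" "p ` S \<subseteq> M"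
  shows "continuous_on S (\<lambda>s. tproj \<nu> (p s) (v s))"
proof -
  have "continuous_on M \<nu>" using normal by (simp add: unit_normal_field_def)
  then have "continuous_on S (\<lambda>s. \<nu> (p s))" by (rule continuous_on_compose2[OF _ assms(1,3)])
  then show ?thesis unfolding tproj_def by (intro continuous_intros assms)
qed

text \<open>Every point has a neighbourhood in the image of a closed ball of a chart domain, on which the area
element is bounded. Finitely many of them cover the surface.\<close>

lemma area_measure_finite:
  assumes area: "area_measure M \<sigma>" and M: "compact M"
  shows "finite_measure \<sigma>"
proof -
  have sp: "space \<sigma> = M" and sets: "sets \<sigma> = sets (restrict_space borel M)"
    using area by (auto simp: area_measure_def)
  define good where "good x p \<longleftrightarrow> open (fst p) \<and> x \<in> fst p \<and> M \<inter> fst p \<subseteq> snd p \<and>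
      snd p \<in> sets \<sigma> \<and> emeasure \<sigma> (snd p) < \<infinity>" for x p
  have "\<exists>p. good x p" if x: "x \<in> M" for x
  proof -
    obtain U X Y f' where c: "open U" "x \<in> X ` U" "regular_param 1 M U X"
      "openin (top_of_set M) (X ` U)" "homeomorphism U (X ` U) X Y"
      "\<And>u. u \<in> U \<Longrightarrow> (X has_derivative f' u) (at u)"
      "\<And>v. continuous_on U (\<lambda>u. f' u v)"
      "\<And>u. u \<in> U \<Longrightarrow> area_normal X u = cross3 (f' u (axis 1 1)) (f' u (axis 2 1))"
      using chart[OF emb x] by metis
    obtain u where u: "u \<in> U" "x = X u" using c(2) by blast
    obtain r where r: "r > 0" "cball u r \<subseteq> U" using c(1) u(1) open_contains_cball by blast
    have cX: "continuous_on U X" using c(5) by (simp add: homeomorphism_def)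
    have "openin (top_of_set U) (ball u r)" using r c(1) by (simp add: open_openin_trans ball_subset_cball subset_trans[OF ball_subset_cball])
    then have "openin (top_of_set (X ` U)) (X ` ball u r)"
      using homeomorphism_imp_open_map[OF c(5)] by blast
    then have "openin (top_of_set M) (X ` ball u r)" using c(4) openin_trans by blast
    then obtain O' where O': "open O'" "X ` ball u r = M \<inter> O'" by (auto simp: openin_open)
    have "compact (X ` cball u r)" using cX r by (intro compact_continuous_image continuous_on_subset[OF cX]) auto
    moreover have XM: "X ` cball u r \<subseteq> M" using r(2) c(3) unfolding regular_param_def by blast
    ultimately have K: "X ` cball u r \<in> sets \<sigma>"
      unfolding sets sets_restrict_space by (metis Int_absorb1 borel_closed compact_imp_closed image_eqI)
    have "continuous_on (cball u r) (\<lambda>u. norm (cross3 (f' u (axis 1 1)) (f' u (axis 2 1))))"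
      by (intro continuous_on_norm continuous_on_cross continuous_on_subset[OF c(7) r(2)])
    then have "bounded ((\<lambda>u. norm (cross3 (f' u (axis 1 1)) (f' u (axis 2 1)))) ` cball u r)"
      by (intro compact_imp_bounded compact_continuous_image) auto
    then obtain B where B: "\<forall>v\<in>cball u r. norm (cross3 (f' v (axis 1 1)) (f' v (axis 2 1))) \<le> B"
      unfolding bounded_iff by auto
    have "emeasure \<sigma> (X ` cball u r) = (\<integral>\<^sup>+v\<in>cball u r. ennreal (norm (area_normal X v)) \<partial>lborel)"
      using area c(3) r(2) unfolding area_measure_def by auto
    also have "\<dots> \<le> (\<integral>\<^sup>+v. ennreal B * indicator (cball u r) v \<partial>lborel)"
      using B c(8) r(2) by (intro nn_integral_mono) (auto simp: indicator_def ennreal_leI subset_iff)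
    also have "\<dots> = ennreal B * emeasure lborel (cball u r)" by (simp add: nn_integral_cmult_indicator)
    also have "\<dots> < \<infinity>" using emeasure_lborel_cball_finite[of u r] by (simp add: ennreal_mult_less_top)
    finally have "emeasure \<sigma> (X ` cball u r) < \<infinity>" .
    moreover have "M \<inter> O' \<subseteq> X ` cball u r" using O'(2) ball_subset_cball by blast
    moreover have "x \<in> O'" using O'(2) u r by (metis Int_iff centre_in_ball image_eqI)
    ultimately have "good x (O', X ` cball u r)" using K O'(1) unfolding good_def by simp
    then show ?thesis by blast
  qed
  then have "\<forall>x\<in>M. \<exists>p. good x p" by blast
  from bchoice[OF this] obtain p where p: "\<And>x. x \<in> M \<Longrightarrow> good x (p x)" by blast
  define O' K where "O' x = fst (p x)" and "K x = snd (p x)" for x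
  have OK: "\<And>x. x \<in> M \<Longrightarrow> open (O' x)" "\<And>x. x \<in> M \<Longrightarrow> x \<in> O' x"
    "\<And>x. x \<in> M \<Longrightarrow> M \<inter> O' x \<subseteq> K x" "\<And>x. x \<in> M \<Longrightarrow> K x \<in> sets \<sigma>" "\<And>x. x \<in> M \<Longrightarrow> emeasure \<sigma> (K x) < \<infinity>"
    using p by (simp_all add: good_def O'_def K_def)
  obtain C where C: "C \<subseteq> M" "finite C" "M \<subseteq> (\<Union>x\<in>C. O' x)"
    using compactE_image[OF M, of M O'] OK(1,2) by blast
  have KC: "K ` C \<subseteq> sets \<sigma>" using C(1) OK(4) by blast
  have "M \<subseteq> (\<Union>x\<in>C. K x)" using C(1,3) OK(3) by blast
  then have "emeasure \<sigma> M \<le> emeasure \<sigma> (\<Union>x\<in>C. K x)"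
    by (rule emeasure_mono) (rule sets.finite_UN[OF C(2)], use KC in blast)
  also have "\<dots> \<le> (\<Sum>x\<in>C. emeasure \<sigma> (K x))"
    by (rule emeasure_subadditive_finite[OF C(2) KC])
  also have "\<dots> < \<infinity>" using C(1,2) OK(5) by (simp add: less_top[symmetric] subset_iff)
  finally show ?thesis using sp by (intro finite_measureI) auto
qed

end

section \<open>Square-integrable functions\<close>

lemma mult_le_sum_squares:
  assumes "0 \<le> a" "0 \<le> (b::real)" shows "a * b \<le> a\<^sup>2 + b\<^sup>2"
proof -
  have "0 \<le> a * b" using assms by simp
  moreover have "2 * (a * b) \<le> a\<^sup>2 + b\<^sup>2" using sum_squares_bound[of a b] by simp
  ultimately show ?thesis by linarith
qed

lemma L2_integrable_inner:
  assumes "L2 \<mu> f" "L2 \<mu> g"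
  shows "integrable \<mu> (\<lambda>x. f x \<bullet> g x)"
proof (rule Bochner_Integration.integrable_bound)
  show "integrable \<mu> (\<lambda>x. (norm (f x))\<^sup>2 + (norm (g x))\<^sup>2)"
    using assms by (auto simp: L2_def)
  show "(\<lambda>x. f x \<bullet> g x) \<in> borel_measurable \<mu>" using assms by (auto simp: L2_def)
  show "AE x in \<mu>. norm (f x \<bullet> g x) \<le> norm ((norm (f x))\<^sup>2 + (norm (g x))\<^sup>2)"
  proof (rule AE_I2)
    fix x
    have "\<bar>f x \<bullet> g x\<bar> \<le> norm (f x) * norm (g x)" by (rule Cauchy_Schwarz_ineq2)
    also have "\<dots> \<le> (norm (f x))\<^sup>2 + (norm (g x))\<^sup>2"
      by (rule mult_le_sum_squares) simp_all
    finally show "norm (f x \<bullet> g x) \<le> norm ((norm (f x))\<^sup>2 + (norm (g x))\<^sup>2)" by simp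
  qed
qed

lemma norm_add_sq: "(norm (a + b :: 'b::real_inner))\<^sup>2 = (norm a)\<^sup>2 + 2 * (a \<bullet> b) + (norm b)\<^sup>2"
  by (simp add: power2_norm_eq_inner inner_add_left inner_add_right inner_commute)

lemma L2_add:
  assumes "L2 \<mu> f" "L2 \<mu> g"
  shows "L2 \<mu> (\<lambda>x. f x + g x)"
  using assms L2_integrable_inner[OF assms] by (auto simp: L2_def norm_add_sq)

lemma L2_scale: "L2 \<mu> f \<Longrightarrow> L2 \<mu> (\<lambda>x. c *\<^sub>R f x)"
  by (auto simp: L2_def power_mult_distrib)

lemma L2_minus: "L2 \<mu> f \<Longrightarrow> L2 \<mu> (\<lambda>x. - f x)"
  by (auto simp: L2_def)

lemma L2_diff: "L2 \<mu> f \<Longrightarrow> L2 \<mu> g \<Longrightarrow> L2 \<mu> (\<lambda>x. f x - g x)"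
  using L2_add[of \<mu> f "\<lambda>x. - g x"] L2_minus[of \<mu> g] by simp

lemma L2_norm_nonneg [simp]: "0 \<le> L2_norm \<mu> f"
  by (simp add: L2_norm_def)

lemma L2_norm_sq: "(L2_norm \<mu> f)\<^sup>2 = (\<integral>x. (norm (f x))\<^sup>2 \<partial>\<mu>)"
  by (simp add: L2_norm_def)

lemma L2_norm_sq_inner: "(L2_norm \<mu> f)\<^sup>2 = L2_inner \<mu> f f"
  by (simp add: L2_norm_sq L2_inner_def power2_norm_eq_inner)

lemma L2_norm_scale: "L2_norm \<mu> (\<lambda>x. c *\<^sub>R f x) = \<bar>c\<bar> * L2_norm \<mu> f"
  by (simp add: L2_norm_def power_mult_distrib real_sqrt_mult)

lemma L2_norm_diff_commute: "L2_norm \<mu> (\<lambda>x. f x - g x) = L2_norm \<mu> (\<lambda>x. g x - f x)"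
  by (simp add: L2_norm_def norm_minus_commute)

lemma L2_inner_add_left:
  assumes "L2 \<mu> f" "L2 \<mu> g" "L2 \<mu> h"
  shows "L2_inner \<mu> (\<lambda>x. f x + g x) h = L2_inner \<mu> f h + L2_inner \<mu> g h"
  unfolding L2_inner_def by (simp add: inner_add_left L2_integrable_inner assms)

lemma L2_inner_diff_left:
  assumes "L2 \<mu> f" "L2 \<mu> g" "L2 \<mu> h"
  shows "L2_inner \<mu> (\<lambda>x. f x - g x) h = L2_inner \<mu> f h - L2_inner \<mu> g h"
  unfolding L2_inner_def by (simp add: inner_diff_left L2_integrable_inner assms)

lemma L2_inner_commute: "L2_inner \<mu> f g = L2_inner \<mu> g f"
  by (simp add: L2_inner_def inner_commute)

lemma L2_inner_diff_right:
  assumes "L2 \<mu> f" "L2 \<mu> g" "L2 \<mu> h"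
  shows "L2_inner \<mu> h (\<lambda>x. f x - g x) = L2_inner \<mu> h f - L2_inner \<mu> h g"
  using L2_inner_diff_left[OF assms] by (simp add: L2_inner_commute)

text \<open>The quadratic function \<open>s \<mapsto> \<parallel>s f - g\<parallel>\<^sup>2\<close> is nonnegative, hence its discriminant is not positive.\<close>

lemma L2_cauchy_schwarz:
  assumes "L2 \<mu> f" "L2 \<mu> g"
  shows "L2_inner \<mu> f g \<le> L2_norm \<mu> f * L2_norm \<mu> g"
proof -
  define a b c where "a = (L2_norm \<mu> f)\<^sup>2" and "b = (L2_norm \<mu> g)\<^sup>2" and "c = L2_inner \<mu> f g"
  have q: "0 \<le> s\<^sup>2 * a - 2 * s * c + b" for s
  proof -
    have "0 \<le> (\<integral>x. (norm (s *\<^sub>R f x - g x))\<^sup>2 \<partial>\<mu>)" by simp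
    also have "\<dots> = (\<integral>x. s\<^sup>2 * (norm (f x))\<^sup>2 - 2 * s * (f x \<bullet> g x) + (norm (g x))\<^sup>2 \<partial>\<mu>)"
      by (intro Bochner_Integration.integral_cong refl)
         (simp add: power2_norm_eq_inner inner_diff_left inner_diff_right inner_commute,
          simp add: algebra_simps power2_eq_square)
    also have "\<dots> = s\<^sup>2 * a - 2 * s * c + b"
      using assms L2_integrable_inner[OF assms]
      by (simp add: L2_def a_def b_def c_def L2_norm_sq L2_inner_def)
    finally show ?thesis .
  qed
  have "c\<^sup>2 \<le> a * b"
  proof (cases "a = 0")
    case True
    have "c = 0"
    proof (rule ccontr)
      assume "c \<noteq> 0"
      \<comment> \<open>For \<open>a = 0\<close> the quadratic is affine; this argument makes it equal to \<open>-1\<close>.\<close>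
      with q[of "(b + 1) / (2 * c)"] True show False by (simp add: field_simps)
    qed
    then show ?thesis using True by simp
  next
    case False
    then have "a > 0" by (simp add: a_def)
    then show ?thesis using q[of "c / a"] by (simp add: field_simps power2_eq_square)
  qed
  then have "sqrt (c\<^sup>2) \<le> sqrt (a * b)" by (rule real_sqrt_le_mono)
  then show ?thesis by (simp add: a_def b_def c_def real_sqrt_mult)
qed

lemma L2_minkowski:
  assumes "L2 \<mu> f" "L2 \<mu> g"
  shows "L2_norm \<mu> (\<lambda>x. f x + g x) \<le> L2_norm \<mu> f + L2_norm \<mu> g"
proof (rule power2_le_imp_le)
  have "(L2_norm \<mu> (\<lambda>x. f x + g x))\<^sup>2 = (L2_norm \<mu> f)\<^sup>2 + 2 * L2_inner \<mu> f g + (L2_norm \<mu> g)\<^sup>2"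
    using assms L2_integrable_inner[OF assms] by (simp add: L2_norm_sq norm_add_sq L2_def L2_inner_def)
  also have "\<dots> \<le> (L2_norm \<mu> f + L2_norm \<mu> g)\<^sup>2"
    using L2_cauchy_schwarz[OF assms] by (simp add: power2_sum)
  finally show "(L2_norm \<mu> (\<lambda>x. f x + g x))\<^sup>2 \<le> (L2_norm \<mu> f + L2_norm \<mu> g)\<^sup>2" .
qed simp

lemma L2_triangle:
  assumes "L2 \<mu> f" "L2 \<mu> g" "L2 \<mu> h"
  shows "L2_norm \<mu> (\<lambda>x. f x - h x) \<le> L2_norm \<mu> (\<lambda>x. f x - g x) + L2_norm \<mu> (\<lambda>x. g x - h x)"
  using L2_minkowski[OF L2_diff[OF assms(1,2)] L2_diff[OF assms(2,3)]] by simp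

lemma L2_norm_cong_AE:
  assumes "L2 \<mu> f" "L2 \<mu> g" "AE x in \<mu>. f x = g x"
  shows "L2_norm \<mu> f = L2_norm \<mu> g"
  unfolding L2_norm_def
  by (intro arg_cong[where f = sqrt] integral_cong_AE) (use assms in \<open>auto simp: L2_def\<close>)

lemma L2_inner_cong_AE:
  assumes "L2 \<mu> f" "L2 \<mu> g" "L2 \<mu> h" "AE x in \<mu>. f x = g x"
  shows "L2_inner \<mu> h f = L2_inner \<mu> h g"
  unfolding L2_inner_def by (intro integral_cong_AE) (use assms in \<open>auto simp: L2_def\<close>)

lemma L2_norm_zero_imp_AE:
  assumes "L2 \<mu> f" "L2_norm \<mu> f = 0"
  shows "AE x in \<mu>. f x = 0"
proof -
  have "(\<integral>x. (norm (f x))\<^sup>2 \<partial>\<mu>) = 0" using assms(2) by (simp add: L2_norm_def)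
  then have "AE x in \<mu>. (norm (f x))\<^sup>2 = 0"
    using assms(1) by (subst (asm) integral_nonneg_eq_0_iff_AE) (auto simp: L2_def)
  then show ?thesis by simp
qed

context finite_measure
begin

lemma L2_const: "L2 M (\<lambda>x. c)"
  by (simp add: L2_def)

lemma L2_integrable: 
  assumes "L2 M f" shows "integrable M f"
proof (rule Bochner_Integration.integrable_bound)
  show "integrable M (\<lambda>x. 1 + (norm (f x))\<^sup>2)" using assms by (simp add: L2_def)
  show "f \<in> borel_measurable M" using assms by (simp add: L2_def)
  show "AE x in M. norm (f x) \<le> norm (1 + (norm (f x))\<^sup>2)"
  proof (rule AE_I2)
    fix x 
    have "norm (f x) * 1 \<le> (norm (f x))\<^sup>2 + 1\<^sup>2" by (rule mult_le_sum_squares) simp_all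
    then have "norm (f x) \<le> 1 + (norm (f x))\<^sup>2" by simp
    then show "norm (f x) \<le> norm (1 + (norm (f x))\<^sup>2)" by simp
  qed
qed

lemma L2_bounded:
  assumes "f \<in> borel_measurable M" "\<And>x. x \<in> space M \<Longrightarrow> norm (f x) \<le> B"
  shows "L2 M f"
  unfolding L2_def
proof
  show "integrable M (\<lambda>x. (norm (f x))\<^sup>2)"
  proof (rule integrable_const_bound[of _ "B\<^sup>2"])
    show "AE x in M. norm ((norm (f x))\<^sup>2) \<le> B\<^sup>2"
      using assms(2) by (auto intro!: AE_I2 power_mono)
  qed (use assms(1) in auto)
qed (rule assms(1))

end

section \<open>Fields on space-time\<close>

locale continuous_problem =
  fixes P :: problem and \<nu> :: "real^3 \<Rightarrow> real^3"
  assumes setting: "continuous_setting P" and normal': "unit_normal_field (surf P) \<nu>"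

sublocale continuous_problem \<subseteq> oriented_surface "surf P" \<nu>
  using setting normal' by unfold_locales (auto simp: continuous_setting_def closed_oriented_surface_def)

context continuous_problem
begin

abbreviation "\<sigma> \<equiv> area P"

lemma compact_surf: "compact (surf P)" and area: "area_measure (surf P) \<sigma>"
  using setting by (auto simp: continuous_setting_def closed_oriented_surface_def)

lemma space_area: "space \<sigma> = surf P" and sets_area: "sets \<sigma> = sets (restrict_space borel (surf P))"
  using area by (auto simp: area_measure_def)

lemma finite_area: "finite_measure \<sigma>"
  by (rule area_measure_finite[OF area compact_surf])

lemma finite_unit_time: "finite_measure unit_time"
  by (rule finite_measureI) (simp add: emeasure_restrict_space space_restrict_space)

lemma measure_unit_time: "measure unit_time {0<..<1} = 1"
  by (simp add: measure_restrict_space)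

end

context continuous_problem
begin

lemma pair_sf: "pair_sigma_finite unit_time \<sigma>"
  using finite_area finite_unit_time 
  by (simp add: pair_sigma_finite_def finite_measure.axioms(1))

lemma space_Q: "space (Qmeas P) = {0<..<1} \<times> surf P"
  by (simp add: Qmeas_def space_pair_measure space_restrict_space space_area)

lemma space_Q_subset: "space (Qmeas P) \<subseteq> Qclosed P"
  by (auto simp: space_Q Qclosed_def)

lemma finite_Q: "finite_measure (Qmeas P)"
  unfolding Qmeas_def by (rule finite_measure_pair_measure[OF finite_area finite_unit_time])

lemma compact_Qclosed: "compact (Qclosed P)"
  unfolding Qclosed_def by (intro compact_Times compact_surf) simp

lemma measurable_ident_area: "(\<lambda>x. x) \<in> measurable \<sigma> borel"
  by (subst measurable_cong_sets[OF sets_area refl]) (rule measurable_restrict_space1, simp)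

lemma measurable_ident_Q: "(\<lambda>q. q) \<in> measurable (Qmeas P) borel"
proof -
  have "(\<lambda>t. t) \<in> measurable unit_time borel" by (rule measurable_restrict_space1) simp
  then have "(\<lambda>q. fst q) \<in> measurable (Qmeas P) borel"
    unfolding Qmeas_def by (rule measurable_compose[OF measurable_fst])
  moreover have "(\<lambda>q. snd q) \<in> measurable (Qmeas P) borel"
    unfolding Qmeas_def by (rule measurable_compose[OF measurable_snd measurable_ident_area])
  ultimately have "(\<lambda>q. (fst q, snd q)) \<in> measurable (Qmeas P) borel" by (rule borel_measurable_Pair)
  then show ?thesis by simp
qed

lemma continuous_measurable:
  fixes f :: "'a::topological_space \<Rightarrow> 'b::euclidean_space"
  assumes "(\<lambda>q. q) \<in> measurable M borel" "space M \<subseteq> K" "K \<in> sets borel" "continuous_on K f"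
  shows "f \<in> borel_measurable M"
proof -
  have "(\<lambda>q. indicator K q *\<^sub>R f q) \<in> borel_measurable M"
    by (rule measurable_compose[OF assms(1) borel_measurable_continuous_on_indicator[OF assms(3,4)]])
  then show ?thesis
    by (subst measurable_cong[where g = "\<lambda>q. indicator K q *\<^sub>R f q"]) (use assms(2) in auto)
qed

lemma continuous_L2:
  fixes f :: "'a::t2_space \<Rightarrow> 'b::euclidean_space"
  assumes "finite_measure M" "(\<lambda>q. q) \<in> measurable M borel" "space M \<subseteq> K" "compact K" "continuous_on K f"
  shows "L2 M f"
proof -
  have m: "f \<in> borel_measurable M"
    by (rule continuous_measurable[OF assms(2,3) _ assms(5)]) (use assms(4) in \<open>simp add: compact_imp_closed\<close>)
  have "bounded (f ` K)" by (intro compact_imp_bounded compact_continuous_image assms)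
  then obtain B where "\<forall>x\<in>K. norm (f x) \<le> B" unfolding bounded_iff by auto
  then show ?thesis
    by (intro finite_measure.L2_bounded[OF assms(1) m, of B]) (use assms(3) in auto)
qed

text \<open>Lifted states, smooth fields and classical gradients all enter \<open>L\<^sup>2(Q)\<close> by this route: they are
continuous up to the initial and final time.\<close>

lemma continuous_L2_Q: "continuous_on (Qclosed P) f \<Longrightarrow> L2 (Qmeas P) (f :: _ \<Rightarrow> 'b::euclidean_space)"
  by (rule continuous_L2[OF finite_Q measurable_ident_Q space_Q_subset compact_Qclosed])

lemma continuous_L2_area: "continuous_on (surf P) f \<Longrightarrow> L2 \<sigma> (f :: _ \<Rightarrow> 'b::euclidean_space)"
  by (rule continuous_L2[OF finite_area measurable_ident_area _ compact_surf]) (simp add: space_area)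

lemma C1_on_continuous: "C1_on S f \<Longrightarrow> continuous_on S f"
  unfolding C1_on_def by (elim exE conjE) (rule has_derivative_continuous_on, blast)

lemma smooth_field_Hspace: "smooth_field P z \<Longrightarrow> z \<in> Hspace P"
  unfolding smooth_field_def Hspace_def
  using continuous_L2_Q[of z] C1_on_continuous[of "Qclosed P" z] space_Q_subset by (auto intro!: AE_I2)

lemma section_derivatives:
  assumes "\<And>q. q \<in> Qclosed P \<Longrightarrow> (f has_derivative f' q) (at q within Qclosed P)" "(t, x) \<in> Qclosed P"
  shows "((\<lambda>s. f (s, x)) has_vector_derivative f' (t, x) (1, 0)) (at t within {0..1})"
    and "((\<lambda>y. f (t, y)) has_derivative (\<lambda>v. f' (t, x) (0, v))) (at x within surf P)"
proof -
  have tx: "t \<in> {0..1}" "x \<in> surf P" using assms(2) by (auto simp: Qclosed_def)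
  have l: "linear (f' (t, x))" using has_derivative_linear[OF assms(1)[OF assms(2)]] .
  have "((\<lambda>s. f (s, x)) has_derivative (\<lambda>h. f' (t, x) (h, 0))) (at t within {0..1})"
  proof (rule has_derivative_in_compose2[of "Qclosed P" f f', OF assms(1)])
    show "(\<lambda>s. (s, x)) ` {0..1} \<subseteq> Qclosed P" "t \<in> {0..1}" using tx by (auto simp: Qclosed_def)
    show "((\<lambda>s. (s, x)) has_derivative (\<lambda>h. (h, 0))) (at t within {0..1})"
      by (intro has_derivative_Pair has_derivative_ident has_derivative_const)
  qed
  moreover have "(\<lambda>h. f' (t, x) (h, 0)) = (\<lambda>h. h *\<^sub>R f' (t, x) (1, 0))"
    by (rule ext, subst linear_cmul[OF l, symmetric]) simp
  ultimately show "((\<lambda>s. f (s, x)) has_vector_derivative f' (t, x) (1, 0)) (at t within {0..1})"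
    unfolding has_vector_derivative_def by (simp only:)
  show "((\<lambda>y. f (t, y)) has_derivative (\<lambda>v. f' (t, x) (0, v))) (at x within surf P)"
  proof (rule has_derivative_in_compose2[of "Qclosed P" f f', OF assms(1)])
    show "(\<lambda>y. (t, y)) ` surf P \<subseteq> Qclosed P" "x \<in> surf P" using tx by (auto simp: Qclosed_def)
    show "((\<lambda>y. (t, y)) has_derivative (\<lambda>v. (0, v))) (at x within surf P)"
      by (intro has_derivative_Pair has_derivative_ident has_derivative_const)
  qed
qed

lemma classical_grad_eq:
  assumes "\<And>q. q \<in> Qclosed P \<Longrightarrow> (\<psi> has_derivative f' q) (at q within Qclosed P)" "q \<in> Qclosed P"
  shows "classical_grad P \<psi> q = (f' q (1, 0), tproj \<nu> (snd q) (\<chi> d. f' q (0, axis d 1)))"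
proof -
  obtain t x where q: "q = (t, x)" by (cases q)
  have tx: "t \<in> {0..1}" "x \<in> surf P" using assms(2) by (auto simp: Qclosed_def q)
  note d = section_derivatives[OF assms(1) assms(2)[unfolded q]]
  show ?thesis
    using vector_derivative_within_cbox[of 0 1 t "\<lambda>s. \<psi> (s, x)"] d(1) tx surf_grad_eq[OF tx(2) d(2)]
    by (simp add: classical_grad_def q)
qed

lemma continuous_derivative_components:
  assumes "\<And>v. continuous_on S (\<lambda>q. f' q v)"
  shows "continuous_on S (\<lambda>q. \<chi> d. f' q (0, axis d 1))"
  by (rule continuous_on_vec_lambda) (rule assms)

text \<open>Both parts of the classical gradient are obtained continuously from the derivative on
\<open>[0,1] \<times> M\<close>.\<close>

lemma classical_grad_continuous:
  assumes "C1_on (Qclosed P) \<psi>"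
  shows "continuous_on (Qclosed P) (classical_grad P \<psi>)"
proof -
  obtain f' where f': "\<forall>q\<in>Qclosed P. (\<psi> has_derivative f' q) (at q within Qclosed P)"
    "\<forall>v. continuous_on (Qclosed P) (\<lambda>q. f' q v)" using assms unfolding C1_on_def by blast
  have "continuous_on (Qclosed P) (\<lambda>q. (f' q (1, 0), tproj \<nu> (snd q) (\<chi> d. f' q (0, axis d 1))))"
    using f'(2) by (intro continuous_on_Pair continuous_on_tproj continuous_derivative_components continuous_on_snd continuous_on_id)
       (auto simp: Qclosed_def)
  then show ?thesis
    by (rule continuous_on_eq) (rule classical_grad_eq[symmetric], use f'(1) in blast)
qed

text \<open>The derivatives are given by description operators applied to predicates that coincide for \<open>\<psi>\<close> and
\<open>\<psi> - c\<close>. The equality thus holds even at points without a derivative.\<close>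

lemma classical_grad_shift: "classical_grad P (\<lambda>q. \<psi> q - c) = classical_grad P \<psi>"
proof -
  have hd: "((\<lambda>y. f y - k) has_derivative D) F \<longleftrightarrow> (f has_derivative D) F"
    for f :: "'x::real_normed_vector \<Rightarrow> real" and k D F
  proof
    assume "((\<lambda>y. f y - k) has_derivative D) F"
    from has_derivative_add_const[OF this, of k] show "(f has_derivative D) F" by simp
  next
    assume "(f has_derivative D) F"
    from has_derivative_add_const[OF this, of "- k"] show "((\<lambda>y. f y - k) has_derivative D) F" by simp
  qed
  show ?thesis
    by (simp add: classical_grad_def surf_grad_def vector_derivative_def has_vector_derivative_def hd)
qed

text \<open>The fundamental theorem of calculus for the product of \<open>u\<close> and the weight \<open>w\<close>, which is \<open>t\<close> for \<open>s = 1\<close> and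
\<open>t - 1\<close> for \<open>s = 0\<close>: it has slope one, and its boundary terms reduce to \<open>u(s)\<close>. Thus an end value
is an average over time of quantities that \<open>H\<^sup>1\<close> controls.\<close>

lemma endpoint_average:
  fixes s :: real
  assumes C1: "C1_on (Qclosed P) u" and x: "x \<in> surf P" and s: "s = 0 \<or> s = 1"
  defines "w \<equiv> \<lambda>t. s * t + (1 - s) * (t - 1)"
  shows "u (s, x) = (\<integral>t. u (t, x) + w t * fst (classical_grad P u (t, x)) \<partial>unit_time)"
proof -
  obtain f' where f': "\<And>q. q\<in>Qclosed P \<Longrightarrow> (u has_derivative f' q) (at q within Qclosed P)"
    "\<And>v. continuous_on (Qclosed P) (\<lambda>q. f' q v)" using C1 unfolding C1_on_def by blast
  have Q: "(t, x) \<in> Qclosed P" if "0 \<le> t" "t \<le> 1" for t using that x by (simp add: Qclosed_def)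
  have cg: "fst (classical_grad P u (t, x)) = f' (t, x) (1, 0)" if "0 \<le> t" "t \<le> 1" for t
    using classical_grad_eq[OF f'(1) Q[OF that]] by simp
  let ?g = "\<lambda>t. u (t, x) + w t * f' (t, x) (1, 0)"
  have cont: "continuous_on {0..1} (\<lambda>t. f' (t, x) (1, 0))" "continuous_on {0..1} (\<lambda>t. u (t, x))"
    by (rule continuous_on_compose2[OF f'(2), of _ "\<lambda>t. (t, x)"], use Q in \<open>auto intro!: continuous_intros\<close>)
       (rule continuous_on_compose2[OF C1_on_continuous[OF C1], of _ "\<lambda>t. (t, x)"], use Q in \<open>auto intro!: continuous_intros\<close>)
  have "(\<integral>t. indicator {0..1} t *\<^sub>R ?g t \<partial>lborel) = w 1 * u (1, x) - w 0 * u (0, x)"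
  proof (rule integral_FTC_Icc)
    show "((\<lambda>t. w t * u (t, x)) has_vector_derivative ?g t) (at t within {0..1})" if "0 \<le> t" "t \<le> 1" for t
    proof -
      have "(w has_vector_derivative 1) (at t within {0..1})"
        unfolding w_def using s by (auto intro!: derivative_eq_intros)
      from has_vector_derivative_mult[OF this section_derivatives(1)[OF f'(1) Q[OF that]]]
      show ?thesis by (simp add: add.commute)
    qed
    show "continuous_on {0..1} ?g" unfolding w_def by (intro continuous_intros cont)
  qed simp
  also have "\<dots> = u (s, x)" using s by (auto simp: w_def)
  finally have 1: "(\<integral>t. indicator {0..1} t *\<^sub>R ?g t \<partial>lborel) = u (s, x)" .
  have "(\<integral>t. u (t, x) + w t * fst (classical_grad P u (t, x)) \<partial>unit_time) = (\<integral>t. ?g t \<partial>unit_time)"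
    by (intro Bochner_Integration.integral_cong refl) (simp add: space_restrict_space cg)
  also have "\<dots> = (\<integral>t. indicator {0<..<1} t *\<^sub>R ?g t \<partial>lborel)"
    by (rule integral_restrict_space) simp
  also have "\<dots> = (\<integral>t. indicator {0..1} t *\<^sub>R ?g t \<partial>lborel)"
  proof (rule integral_cong_AE)
    have "(\<lambda>t. indicator {0..1} t *\<^sub>R ?g t) \<in> borel_measurable borel"
      unfolding w_def by (intro borel_measurable_continuous_on_indicator continuous_intros cont) auto
    then show "(\<lambda>t. indicator {0..1} t *\<^sub>R ?g t) \<in> borel_measurable lborel" by simp
    have "(\<lambda>t. indicator {0<..<1} t *\<^sub>R ?g t) \<in> borel_measurable borel"
      unfolding w_def by (intro borel_measurable_continuous_on_indicator continuous_intros continuous_on_subset[OF cont(1)] continuous_on_subset[OF cont(2)]) auto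
    then show "(\<lambda>t. indicator {0<..<1} t *\<^sub>R ?g t) \<in> borel_measurable lborel" by simp
    show "AE t in lborel. indicator {0<..<1} t *\<^sub>R ?g t = indicator {0..1} t *\<^sub>R ?g t"
      using AE_lborel_singleton[of "0::real"] AE_lborel_singleton[of "1::real"]
      by eventually_elim (auto simp: indicator_def)
  qed
  finally show ?thesis using 1 by simp
qed

text \<open>Unit time has total mass one, so the square of a time average is at most the time average of the
square. Fubini's theorem does the rest.\<close>

lemma time_average:
  fixes h :: "real \<times> (real^3) \<Rightarrow> real"
  assumes h: "L2 (Qmeas P) h"
  shows "AE x in \<sigma>. integrable unit_time (\<lambda>t. h (t, x))"
    and "L2 \<sigma> (\<lambda>x. \<integral>t. h (t, x) \<partial>unit_time)"
    and "L2_norm \<sigma> (\<lambda>x. \<integral>t. h (t, x) \<partial>unit_time) \<le> L2_norm (Qmeas P) h"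
proof -
  interpret pair_sigma_finite unit_time \<sigma> by (rule pair_sf)
  interpret T: finite_measure unit_time by (rule finite_unit_time)
  let ?H = "\<lambda>x. \<integral>t. h (t, x) \<partial>unit_time"
  have i1: "integrable (unit_time \<Otimes>\<^sub>M \<sigma>) (case_prod (\<lambda>t x. h (t, x)))"
    using finite_measure.L2_integrable[OF finite_Q h] by (simp add: Qmeas_def)
  have i2: "integrable (unit_time \<Otimes>\<^sub>M \<sigma>) (case_prod (\<lambda>t x. (h (t, x))\<^sup>2))"
    using h by (simp add: L2_def Qmeas_def case_prod_beta')
  show ae1: "AE x in \<sigma>. integrable unit_time (\<lambda>t. h (t, x))" by (rule AE_integrable_snd[OF i1])
  have Hm: "?H \<in> borel_measurable \<sigma>" using integrable_snd[OF i1] by auto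
  have le: "AE x in \<sigma>. (?H x)\<^sup>2 \<le> (\<integral>t. (h (t, x))\<^sup>2 \<partial>unit_time)"
    using ae1 AE_integrable_snd[OF i2]
  proof eventually_elim
    case (elim x)
    have "0 \<le> (\<integral>t. (h (t, x) - ?H x)\<^sup>2 \<partial>unit_time)" by simp
    also have "\<dots> = (\<integral>t. (h (t, x))\<^sup>2 - 2 * ?H x * h (t, x) + (?H x)\<^sup>2 \<partial>unit_time)"
      by (simp add: power2_diff algebra_simps)
    also have "\<dots> = (\<integral>t. (h (t, x))\<^sup>2 \<partial>unit_time) - 2 * ?H x * ?H x + (?H x)\<^sup>2"
      using elim measure_unit_time by (simp add: space_restrict_space)
    finally show ?case by (simp add: power2_eq_square)
  qed
  have i3: "integrable \<sigma> (\<lambda>x. \<integral>t. (h (t, x))\<^sup>2 \<partial>unit_time)" by (rule integrable_snd[OF i2])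
  have iH: "integrable \<sigma> (\<lambda>x. (?H x)\<^sup>2)"
    by (rule Bochner_Integration.integrable_bound[OF i3]) (use Hm le in auto)
  show "L2 \<sigma> ?H" using Hm iH by (simp add: L2_def)
  have "(\<integral>x. (?H x)\<^sup>2 \<partial>\<sigma>) \<le> (\<integral>x. (\<integral>t. (h (t, x))\<^sup>2 \<partial>unit_time) \<partial>\<sigma>)"
    by (rule integral_mono_AE[OF iH i3 le])
  also have "\<dots> = (\<integral>q. (h q)\<^sup>2 \<partial>Qmeas P)"
    using integral_snd[OF i2] by (simp add: Qmeas_def case_prod_beta')
  finally show "L2_norm \<sigma> ?H \<le> L2_norm (Qmeas P) h"
    by (simp add: L2_norm_def)
qed

end

lemma L2_dominated:
  assumes "f \<in> borel_measurable \<mu>" "L2 \<mu> g" "\<And>x. x \<in> space \<mu> \<Longrightarrow> norm (f x) \<le> norm (g x)"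
  shows "L2 \<mu> f" "L2_norm \<mu> f \<le> L2_norm \<mu> g"
proof -
  have sq: "(norm (f x))\<^sup>2 \<le> (norm (g x))\<^sup>2" if "x \<in> space \<mu>" for x
    using assms(3)[OF that] by (intro power_mono) auto
  have ig: "integrable \<mu> (\<lambda>x. (norm (g x))\<^sup>2)" using assms(2) by (simp add: L2_def)
  have i: "integrable \<mu> (\<lambda>x. (norm (f x))\<^sup>2)"
    by (rule Bochner_Integration.integrable_bound[OF ig]) (use assms(1) sq in \<open>auto intro!: AE_I2\<close>)
  then show "L2 \<mu> f" using assms(1) by (simp add: L2_def)
  show "L2_norm \<mu> f \<le> L2_norm \<mu> g"
    unfolding L2_norm_def by (intro real_sqrt_le_mono integral_mono i ig sq)
qed

section \<open>Traces and the projection onto the constraint set\<close>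

context continuous_problem
begin

definition end_weight :: "real \<Rightarrow> real \<Rightarrow> real" where
  "end_weight s t = s * t + (1 - s) * (t - 1)"

text \<open>This is the formula of \<open>endpoint_average\<close> with a weak gradient \<open>g\<close> of \<open>\<psi>\<close>. It is the
limit of the end values of every sequence approximating \<open>\<psi>\<close> and \<open>g\<close>.\<close>

definition trace_of :: "real \<Rightarrow> (real \<times> (real^3) \<Rightarrow> real) \<Rightarrow> field \<Rightarrow> real^3 \<Rightarrow> real" where
  "trace_of s \<psi> g x = (\<integral>t. \<psi> (t, x) + end_weight s t * fst (g (t, x)) \<partial>unit_time)"

lemma weighted_component:
  assumes "L2 (Qmeas P) g" and s: "s = 0 \<or> s = (1::real)"
  shows "L2 (Qmeas P) (\<lambda>q. end_weight s (fst q) * fst (g q :: real \<times> (real^3)))"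
    and "L2_norm (Qmeas P) (\<lambda>q. end_weight s (fst q) * fst (g q)) \<le> L2_norm (Qmeas P) g"
proof -
  have g: "g \<in> borel_measurable (Qmeas P)" using assms(1) by (simp add: L2_def)
  have g1: "(\<lambda>q. fst (g q)) \<in> borel_measurable (Qmeas P)"
    by (rule measurable_compose[OF g borel_measurable_continuous_onI]) (intro continuous_intros)
  have w: "(\<lambda>q. end_weight s (fst q)) \<in> borel_measurable (Qmeas P)"
    by (rule measurable_compose[OF measurable_ident_Q borel_measurable_continuous_onI])
       (unfold end_weight_def, intro continuous_intros)
  have m: "(\<lambda>q. end_weight s (fst q) * fst (g q)) \<in> borel_measurable (Qmeas P)"
    using w g1 by (rule borel_measurable_times)
  have b: "norm (end_weight s (fst q) * fst (g q)) \<le> norm (g q)" if "q \<in> space (Qmeas P)" for q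
  proof -
    have "\<bar>end_weight s (fst q)\<bar> \<le> 1" using that s by (auto simp: space_Q end_weight_def)
    then have "\<bar>end_weight s (fst q)\<bar> * \<bar>fst (g q)\<bar> \<le> 1 * \<bar>fst (g q)\<bar>" by (intro mult_right_mono) auto
    also have "\<dots> \<le> norm (g q)" using norm_fst_le[of "fst (g q)" "snd (g q)"] by simp
    finally show ?thesis by (simp add: abs_mult)
  qed
  show "L2 (Qmeas P) (\<lambda>q. end_weight s (fst q) * fst (g q))"
    "L2_norm (Qmeas P) (\<lambda>q. end_weight s (fst q) * fst (g q)) \<le> L2_norm (Qmeas P) g"
    using L2_dominated[OF m assms(1) b] by blast+
qed

lemma trace_density_L2:
  assumes "L2 (Qmeas P) \<psi>" "L2 (Qmeas P) g" "s = 0 \<or> s = (1::real)"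
  shows "L2 (Qmeas P) (\<lambda>q. \<psi> q + end_weight s (fst q) * fst (g q :: real \<times> (real^3)))"
  by (rule L2_add[OF assms(1) weighted_component(1)[OF assms(2,3)]])

lemma trace_of_L2:
  assumes "L2 (Qmeas P) \<psi>" "L2 (Qmeas P) g" "s = 0 \<or> s = 1"
  shows "L2 \<sigma> (trace_of s \<psi> g)"
  using time_average(2)[OF trace_density_L2[OF assms]] unfolding trace_of_def by simp

text \<open>The difference \<open>\<psi>\<^sub>n(s) - trace\<close> is the time average of a function \<open>h\<^sub>n\<close> built from \<open>\<psi>\<^sub>n - \<psi>\<close> and the
difference of the gradients, which tends to zero in \<open>L\<^sup>2(Q)\<close>.\<close>

lemma endpoint_tendsto_trace:
  assumes \<psi>: "L2 (Qmeas P) \<psi>" and g: "L2 (Qmeas P) g" and s: "s = 0 \<or> s = 1"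
    and approx: "H1_approx P \<psi> g \<psi>n"
  shows "(\<lambda>n. L2_norm \<sigma> (\<lambda>x. \<psi>n n (s, x) - trace_of s \<psi> g x)) \<longlonglongrightarrow> 0"
    and "\<And>n. L2 \<sigma> (\<lambda>x. \<psi>n n (s, x))"
proof -
  have C1: "C1_on (Qclosed P) (\<psi>n n)" for n using approx by (simp add: H1_approx_def)
  have sQ: "(\<lambda>x. (s, x)) ` surf P \<subseteq> Qclosed P" using s by (auto simp: Qclosed_def)
  have end_L2: "L2 \<sigma> (\<lambda>x. \<psi>n n (s, x))" for n
    by (rule continuous_L2_area, rule continuous_on_compose2[OF C1_on_continuous[OF C1] _ sQ])
       (intro continuous_intros)
  show "\<And>n. L2 \<sigma> (\<lambda>x. \<psi>n n (s, x))" by (rule end_L2)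
  define d where "d n q = classical_grad P (\<psi>n n) q - g q" for n q
  define h where "h n q = (\<psi>n n q - \<psi> q) + end_weight s (fst q) * fst (d n q)" for n q
  have \<psi>n: "L2 (Qmeas P) (\<psi>n n)" for n by (rule continuous_L2_Q[OF C1_on_continuous[OF C1]])
  have cg: "L2 (Qmeas P) (classical_grad P (\<psi>n n))" for n
    by (rule continuous_L2_Q[OF classical_grad_continuous[OF C1]])
  have dL: "L2 (Qmeas P) (d n)" for n unfolding d_def by (rule L2_diff[OF cg g])
  have hL: "L2 (Qmeas P) (h n)" for n
    unfolding h_def by (intro L2_add L2_diff \<psi> \<psi>n weighted_component(1) dL s)
  have hn: "L2_norm (Qmeas P) (h n) \<le> L2_norm (Qmeas P) (\<lambda>q. \<psi>n n q - \<psi> q) + L2_norm (Qmeas P) (d n)" for n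
    using L2_minkowski[OF L2_diff[OF \<psi>n \<psi>] weighted_component(1)[OF dL s], of n n]
      weighted_component(2)[OF dL s, of n] unfolding h_def by linarith
  have bound: "L2_norm \<sigma> (\<lambda>x. \<psi>n n (s, x) - trace_of s \<psi> g x) \<le> L2_norm (Qmeas P) (h n)" for n
  proof -
    have "AE x in \<sigma>. \<psi>n n (s, x) - trace_of s \<psi> g x = (\<integral>t. h n (t, x) \<partial>unit_time)"
      using time_average(1)[OF trace_density_L2[OF \<psi>n cg s, of n n]]
        time_average(1)[OF trace_density_L2[OF \<psi> g s]] AE_space
    proof eventually_elim
      case (elim x)
      then have x: "x \<in> surf P" by (simp add: space_area)
      have "\<psi>n n (s, x) - trace_of s \<psi> g x
          = (\<integral>t. \<psi>n n (t, x) + end_weight s t * fst (classical_grad P (\<psi>n n) (t, x)) \<partial>unit_time)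
          - (\<integral>t. \<psi> (t, x) + end_weight s t * fst (g (t, x)) \<partial>unit_time)"
        using endpoint_average[OF C1 x s] by (simp add: trace_of_def end_weight_def)
      also have "\<dots> = (\<integral>t. (\<psi>n n (t, x) + end_weight s t * fst (classical_grad P (\<psi>n n) (t, x)))
          - (\<psi> (t, x) + end_weight s t * fst (g (t, x))) \<partial>unit_time)"
        using elim by (intro Bochner_Integration.integral_diff[symmetric]) simp_all
      also have "\<dots> = (\<integral>t. h n (t, x) \<partial>unit_time)"
        by (intro Bochner_Integration.integral_cong refl) (simp add: h_def d_def algebra_simps)
      finally show ?case .
    qed
    then have "L2_norm \<sigma> (\<lambda>x. \<psi>n n (s, x) - trace_of s \<psi> g x) = L2_norm \<sigma> (\<lambda>x. \<integral>t. h n (t, x) \<partial>unit_time)"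
      by (intro L2_norm_cong_AE L2_diff end_L2 trace_of_L2[OF \<psi> g s] time_average(2)[OF hL])
    then show ?thesis using time_average(3)[OF hL, of n] by simp
  qed
  have "(\<lambda>n. L2_norm (Qmeas P) (\<lambda>q. \<psi>n n q - \<psi> q) + L2_norm (Qmeas P) (d n)) \<longlonglongrightarrow> 0 + 0"
    using approx unfolding H1_approx_def d_def by (intro tendsto_add) auto
  then have lim: "(\<lambda>n. L2_norm (Qmeas P) (\<lambda>q. \<psi>n n q - \<psi> q) + L2_norm (Qmeas P) (d n)) \<longlonglongrightarrow> 0" by simp
  show "(\<lambda>n. L2_norm \<sigma> (\<lambda>x. \<psi>n n (s, x) - trace_of s \<psi> g x)) \<longlonglongrightarrow> 0"
    by (rule tendsto_sandwich[OF _ _ tendsto_const lim])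
       (auto intro!: always_eventually order_trans[OF bound hn])
qed

lemma is_grad_grad: "\<psi> \<in> H1 P \<Longrightarrow> is_grad P \<psi> (grad P \<psi>)"
  using someI_ex[of "is_grad P \<psi>"] by (simp add: H1_def grad_def)

lemma grad_Hspace: "\<psi> \<in> H1 P \<Longrightarrow> grad P \<psi> \<in> Hspace P"
  using is_grad_grad by (simp add: is_grad_def)

lemma Hspace_L2: "z \<in> Hspace P \<Longrightarrow> L2 (Qmeas P) z"
  by (simp add: Hspace_def)

text \<open>The explicit trace qualifies in the choice that defines \<open>time_trace\<close>, so the chosen function does as
well. The end values of its approximating sequence also converge to the explicit trace, so both
agree almost everywhere.\<close>

lemma time_trace_eq:
  assumes \<psi>: "\<psi> \<in> H1 P" and s: "s = 0 \<or> s = 1"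
  shows "L2 \<sigma> (time_trace P s \<psi>)"
    and "AE x in \<sigma>. time_trace P s \<psi> x = trace_of s \<psi> (grad P \<psi>) x"
proof -
  let ?T = "\<lambda>a. L2 \<sigma> a \<and> (\<exists>\<psi>n. H1_approx P \<psi> (grad P \<psi>) \<psi>n \<and>
        (\<lambda>n. L2_norm \<sigma> (\<lambda>x. \<psi>n n (s, x) - a x)) \<longlonglongrightarrow> 0)"
  let ?a = "trace_of s \<psi> (grad P \<psi>)"
  have \<psi>L: "L2 (Qmeas P) \<psi>" using \<psi> by (simp add: H1_def)
  have gL: "L2 (Qmeas P) (grad P \<psi>)" by (rule Hspace_L2[OF grad_Hspace[OF \<psi>]])
  have aL: "L2 \<sigma> ?a" by (rule trace_of_L2[OF \<psi>L gL s])
  obtain \<psi>n where "H1_approx P \<psi> (grad P \<psi>) \<psi>n" using is_grad_grad[OF \<psi>] by (auto simp: is_grad_def)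
  then have "?T ?a" using endpoint_tendsto_trace(1)[OF \<psi>L gL s] aL by blast
  then have T: "?T (time_trace P s \<psi>)" unfolding time_trace_def by (rule someI[of ?T])
  then show bL: "L2 \<sigma> (time_trace P s \<psi>)" by blast
  let ?b = "time_trace P s \<psi>"
  obtain \<psi>m where m: "H1_approx P \<psi> (grad P \<psi>) \<psi>m" "(\<lambda>n. L2_norm \<sigma> (\<lambda>x. \<psi>m n (s, x) - ?b x)) \<longlonglongrightarrow> 0"
    using T by blast
  note e = endpoint_tendsto_trace[OF \<psi>L gL s m(1)]
  have "L2_norm \<sigma> (\<lambda>x. ?b x - ?a x) \<le> L2_norm \<sigma> (\<lambda>x. \<psi>m n (s, x) - ?b x) + L2_norm \<sigma> (\<lambda>x. \<psi>m n (s, x) - ?a x)" for n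
    using L2_triangle[OF bL e(2) aL, of n] L2_norm_diff_commute[of \<sigma> ?b "\<lambda>x. \<psi>m n (s, x)"] by simp
  moreover have "(\<lambda>n. L2_norm \<sigma> (\<lambda>x. \<psi>m n (s, x) - ?b x) + L2_norm \<sigma> (\<lambda>x. \<psi>m n (s, x) - ?a x)) \<longlonglongrightarrow> 0 + 0"
    by (rule tendsto_add[OF m(2) e(1)])
  ultimately have "L2_norm \<sigma> (\<lambda>x. ?b x - ?a x) \<le> 0"
    by (intro LIMSEQ_le_const[of _ "0 + 0 :: real", simplified]) auto
  then have "L2_norm \<sigma> (\<lambda>x. ?b x - ?a x) = 0" using L2_norm_nonneg[of \<sigma> "\<lambda>x. ?b x - ?a x"] by linarith
  from L2_norm_zero_imp_AE[OF L2_diff[OF bL aL] this] show "AE x in \<sigma>. ?b x = ?a x" by simp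
qed

lemma C1_on_shift:
  assumes "C1_on S f" shows "C1_on S (\<lambda>q. f q + c)"
proof -
  obtain f' where "\<forall>x\<in>S. (f has_derivative f' x) (at x within S)" "\<forall>v. continuous_on S (\<lambda>x. f' x v)"
    using assms unfolding C1_on_def by blast
  then show ?thesis unfolding C1_on_def by (intro exI[of _ f'] conjI ballI has_derivative_add_const) auto
qed

lemma H1_approx_shift:
  assumes "H1_approx P (\<lambda>q. \<psi> q - c) g \<psi>n"
  shows "H1_approx P \<psi> g (\<lambda>n q. \<psi>n n q + c)"
proof -
  have "classical_grad P (\<lambda>q. \<psi>n n q + c) = classical_grad P (\<psi>n n)" for n
    using classical_grad_shift[of "\<psi>n n" "- c"] by simp
  moreover have "(\<lambda>q. \<psi>n n q + c - \<psi> q) = (\<lambda>q. \<psi>n n q - (\<psi> q - c))" for n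
    by (simp add: fun_eq_iff)
  ultimately show ?thesis using assms C1_on_shift[of "Qclosed P" _ c] by (simp add: H1_approx_def)
qed

text \<open>Shifting the approximating functions by \<open>c\<close> translates one predicate into the other. As \<open>grad\<close> is a
choice from this predicate, the very same representative is chosen for \<open>\<psi>\<close> and \<open>\<psi> - c\<close>.\<close>

lemma is_grad_shift: "is_grad P (\<lambda>q. \<psi> q - c) = is_grad P \<psi>"
proof (rule ext, rule iffI)
  fix g assume "is_grad P (\<lambda>q. \<psi> q - c) g"
  then show "is_grad P \<psi> g" using H1_approx_shift[of \<psi> c g] by (auto simp: is_grad_def)
next
  fix g assume "is_grad P \<psi> g"
  then show "is_grad P (\<lambda>q. \<psi> q - c) g"
    using H1_approx_shift[of "\<lambda>q. \<psi> q - c" "- c" g] by (auto simp: is_grad_def)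
qed

lemma grad_shift: "grad P (\<lambda>q. \<psi> q - c) = grad P \<psi>"
  by (simp add: grad_def is_grad_shift)

lemma H1_shift: "\<psi> \<in> H1 P \<Longrightarrow> (\<lambda>q. \<psi> q - c) \<in> H1 P"
  using L2_diff[OF _ finite_measure.L2_const[OF finite_Q]] by (auto simp: H1_def is_grad_shift)

text \<open>Traces of \<open>\<psi> - c\<close> and \<open>\<psi>\<close> differ by the constant \<open>c\<close>, which pairs with a density of mass one
to \<open>c\<close>.\<close>

lemma density_pairing_shift:
  assumes \<rho>: "density P \<rho>" and \<psi>: "\<psi> \<in> H1 P" and s: "s = 0 \<or> s = 1"
  shows "L2_inner \<sigma> \<rho> (time_trace P s (\<lambda>q. \<psi> q - c)) = L2_inner \<sigma> \<rho> (time_trace P s \<psi>) - c"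
proof -
  have \<rho>L: "L2 \<sigma> \<rho>" and \<rho>1: "(\<integral>x. \<rho> x \<partial>\<sigma>) = 1" using \<rho> by (auto simp: density_def)
  have \<psi>L: "L2 (Qmeas P) \<psi>" using \<psi> by (simp add: H1_def)
  have gL: "L2 (Qmeas P) (grad P \<psi>)" by (rule Hspace_L2[OF grad_Hspace[OF \<psi>]])
  note t = time_trace_eq[OF \<psi> s] and tc = time_trace_eq[OF H1_shift[OF \<psi>] s, of c]
  have cL: "L2 \<sigma> (\<lambda>x. c)" by (rule finite_measure.L2_const[OF finite_area])
  have "AE x in \<sigma>. trace_of s (\<lambda>q. \<psi> q - c) (grad P \<psi>) x = trace_of s \<psi> (grad P \<psi>) x - c"
    using time_average(1)[OF trace_density_L2[OF \<psi>L gL s]]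
  proof eventually_elim
    case (elim x)
    have "trace_of s (\<lambda>q. \<psi> q - c) (grad P \<psi>) x
        = (\<integral>t. (\<psi> (t, x) + end_weight s t * fst (grad P \<psi> (t, x))) - c \<partial>unit_time)"
      by (simp add: trace_of_def algebra_simps)
    also have "\<dots> = (\<integral>t. \<psi> (t, x) + end_weight s t * fst (grad P \<psi> (t, x)) \<partial>unit_time) - (\<integral>t. c \<partial>unit_time)"
      using elim finite_measure.integrable_const[OF finite_unit_time, of c] 
      by (intro Bochner_Integration.integral_diff) simp_all
    also have "(\<integral>t. c \<partial>unit_time) = c" using measure_unit_time by (simp add: space_restrict_space)
    finally show ?case by (simp add: trace_of_def)
  qed
  then have "AE x in \<sigma>. time_trace P s (\<lambda>q. \<psi> q - c) x = time_trace P s \<psi> x - c"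
    using t(2) tc(2)[unfolded grad_shift] by eventually_elim simp
  then have "L2_inner \<sigma> \<rho> (time_trace P s (\<lambda>q. \<psi> q - c)) = L2_inner \<sigma> \<rho> (\<lambda>x. time_trace P s \<psi> x - c)"
    by (intro L2_inner_cong_AE[OF tc(1) L2_diff[OF t(1) cL] \<rho>L])
  also have "\<dots> = L2_inner \<sigma> \<rho> (time_trace P s \<psi>) - c"
    using L2_inner_diff_right[OF t(1) cL \<rho>L] \<rho>1 by (simp add: L2_inner_def)
  finally show ?thesis .
qed

lemma Bfun_shift: "\<psi> \<in> H1 P \<Longrightarrow> Bfun P (\<lambda>q. \<psi> q - c) = Bfun P \<psi>"
  using density_pairing_shift[of "rho1 P" \<psi> 1 c] density_pairing_shift[of "rho0 P" \<psi> 0 c] setting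
  by (simp add: Bfun_def continuous_setting_def)

text \<open>A surface of area zero could not carry a density of integral one.\<close>

lemma measure_Q_pos: "0 < measure (Qmeas P) (space (Qmeas P))"
proof -
  interpret S: finite_measure \<sigma> by (rule finite_area)
  interpret T: finite_measure unit_time by (rule finite_unit_time)
  have T1: "{0<..<1} \<in> sets unit_time"
    using sets.top[of unit_time] by (simp add: space_restrict_space)
  have S1: "surf P \<in> sets \<sigma>" using sets.top[of \<sigma>] by (simp add: space_area)
  have "measure \<sigma> (surf P) \<noteq> 0"
  proof
    assume "measure \<sigma> (surf P) = 0"
    then have "emeasure \<sigma> (space \<sigma>) = 0" by (simp add: S.emeasure_eq_measure space_area)
    then have "AE x in \<sigma>. rho0 P x = 0"
      by (intro AE_I[of _ _ "space \<sigma>"]) auto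
    then have "(\<integral>x. rho0 P x \<partial>\<sigma>) = 0" by (rule integral_eq_zero_AE)
    then show False using setting by (simp add: continuous_setting_def density_def)
  qed
  then have "emeasure \<sigma> (surf P) \<noteq> 0" by (simp add: S.emeasure_eq_measure)
  moreover have "emeasure unit_time {0<..<1} = 1" using measure_unit_time by (simp add: T.emeasure_eq_measure)
  moreover have "emeasure (Qmeas P) ({0<..<1} \<times> surf P) = emeasure unit_time {0<..<1} * emeasure \<sigma> (surf P)"
    unfolding Qmeas_def 
    by (rule S.emeasure_pair_measure_Times[OF T1 S1])
  ultimately have "emeasure (Qmeas P) (space (Qmeas P)) \<noteq> 0" by (simp add: space_Q)
  then show ?thesis using finite_measure.emeasure_eq_measure[OF finite_Q] by (simp add: zero_less_measure_iff)
qed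

lemma Hspace_add: 
  assumes "z \<in> Hspace P" "w \<in> Hspace P" shows "(\<lambda>q. z q + w q) \<in> Hspace P"
proof -
  have "AE q in Qmeas P. snd (z q + w q) \<in> tangent_space (surf P) (snd q)"
    using assms(1)[unfolded Hspace_def, simplified, THEN conjunct2]
      assms(2)[unfolded Hspace_def, simplified, THEN conjunct2] AE_space
  proof eventually_elim
    case (elim q)
    then have "snd q \<in> surf P" by (simp add: space_Q mem_Times_iff)
    with elim show ?case by (simp add: tangent_space_eq inner_add_right)
  qed
  then show ?thesis using assms L2_add[OF assms[THEN Hspace_L2]] by (simp add: Hspace_def)
qed

text \<open>The Poisson problem may be tested with \<open>\<psi>\<close> minus its mean; this changes neither the gradient
nor \<open>B\<close>.\<close>

lemma corrected_in_Cset: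
  assumes z: "z \<in> Hspace P" and \<phi>: "poisson_solution P z \<phi>"
  shows "(\<lambda>q. z q + grad P \<phi> q) \<in> Cset P"
proof -
  have \<phi>H: "\<phi> \<in> H1 P" using \<phi> by (simp add: poisson_solution_def Vspace_def)
  note gH = grad_Hspace[OF \<phi>H]
  have "Hinner P (\<lambda>q. z q + grad P \<phi> q) (grad P \<psi>) = Bfun P \<psi>" if \<psi>: "\<psi> \<in> H1 P" for \<psi>
  proof -
    define c where "c = (\<integral>q. \<psi> q \<partial>Qmeas P) / measure (Qmeas P) (space (Qmeas P))"
    have "integrable (Qmeas P) \<psi>"
      by (rule finite_measure.L2_integrable[OF finite_Q]) (use \<psi> in \<open>simp add: H1_def\<close>)
    then have "(\<integral>q. \<psi> q - c \<partial>Qmeas P) = (\<integral>q. \<psi> q \<partial>Qmeas P) - (\<integral>q. c \<partial>Qmeas P)"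
      using finite_measure.integrable_const[OF finite_Q, of c]
      by (intro Bochner_Integration.integral_diff) simp_all
    also have "\<dots> = 0" using measure_Q_pos by (simp add: c_def)
    finally have V: "(\<lambda>q. \<psi> q - c) \<in> Vspace P" using H1_shift[OF \<psi>] by (simp add: Vspace_def)
    then have "Hinner P (grad P \<phi>) (grad P \<psi>) = Bfun P \<psi> - Hinner P z (grad P \<psi>)"
      using \<phi> Bfun_shift[OF \<psi>, of c] by (auto simp: poisson_solution_def grad_shift dest!: bspec)
    then show ?thesis
      using L2_inner_add_left[OF z[THEN Hspace_L2] gH[THEN Hspace_L2] grad_Hspace[OF \<psi>, THEN Hspace_L2]] by simp
  qed
  then show ?thesis using Hspace_add[OF z gH] by (simp add: Cset_def)
qed

text \<open>The difference \<open>c - w\<close> of the two elements of \<open>C\<close> is orthogonal to all gradients, in particular to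
\<open>\<nabla>\<phi>\<close>, and by the projection property to \<open>z - w\<close>. Since \<open>c - w = (z - w) + \<nabla>\<phi>\<close>, it is orthogonal
to itself.\<close>

lemma projection_eq:
  assumes z: "z \<in> Hspace P" and \<phi>: "poisson_solution P z \<phi>" and w: "is_proj_C P z w"
  shows "Heq P w (\<lambda>q. z q + grad P \<phi> q)"
proof -
  define c where "c = (\<lambda>q. z q + grad P \<phi> q)"
  have c: "c \<in> Cset P" unfolding c_def by (rule corrected_in_Cset[OF z \<phi>])
  have \<phi>H: "\<phi> \<in> H1 P" using \<phi> by (simp add: poisson_solution_def Vspace_def)
  have wC: "w \<in> Cset P" using w by (simp add: is_proj_C_def)
  have L: "L2 (Qmeas P) w" "L2 (Qmeas P) c" "L2 (Qmeas P) (grad P \<phi>)" "L2 (Qmeas P) z"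
    using wC c grad_Hspace[OF \<phi>H] z by (auto simp: Cset_def Hspace_L2)
  have dL: "L2 (Qmeas P) (\<lambda>q. c q - w q)" by (rule L2_diff[OF L(2,1)])
  have "Hinner P (grad P \<phi>) (\<lambda>q. c q - w q) = 0"
    using wC c \<phi>H L2_inner_diff_left[OF L(2,1,3)] L2_inner_commute by (simp add: Cset_def L2_inner_commute)
  moreover have "Hinner P (\<lambda>q. z q - w q) (\<lambda>q. c q - w q) = 0" using w c by (simp add: is_proj_C_def)
  ultimately have "Hinner P (\<lambda>q. (z q - w q) + grad P \<phi> q) (\<lambda>q. c q - w q) = 0"
    using L2_inner_add_left[OF L2_diff[OF L(4,1)] L(3) dL] by simp
  moreover have "(\<lambda>q. (z q - w q) + grad P \<phi> q) = (\<lambda>q. c q - w q)" by (simp add: c_def fun_eq_iff)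
  ultimately have "(L2_norm (Qmeas P) (\<lambda>q. c q - w q))\<^sup>2 = 0" by (simp add: L2_norm_sq_inner)
  then have "AE q in Qmeas P. c q - w q = 0" by (intro L2_norm_zero_imp_AE[OF dL]) simp
  then show ?thesis unfolding Heq_def c_def by eventually_elim simp
qed

end

section \<open>Triangles and barycentric coordinates\<close>

definition ref_tri :: "(real^2) set" where
  "ref_tri = {u. 0 \<le> u $ 1 \<and> 0 \<le> u $ 2 \<and> u $ 1 + u $ 2 \<le> 1}"

definition ref_interior :: "(real^2) set" where
  "ref_interior = {u. 0 < u $ 1 \<and> 0 < u $ 2 \<and> u $ 1 + u $ 2 < 1}"

lemma ref_interior_subset: "ref_interior \<subseteq> ref_tri"
  by (auto simp: ref_interior_def ref_tri_def)

lemma compact_ref_tri: "compact ref_tri"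
proof -
  have "closed ref_tri"
    unfolding ref_tri_def by (intro closed_Collect_conj closed_Collect_le continuous_intros)
  moreover have "bounded ref_tri"
  proof (rule boundedI)
    fix u assume u: "u \<in> ref_tri"
    have "norm u \<le> (\<Sum>i\<in>UNIV. \<bar>u $ i\<bar>)" by (rule norm_le_l1_cart)
    also have "\<dots> \<le> 1" using u by (simp add: sum_2 ref_tri_def)
    finally show "norm u \<le> 1" .
  qed
  ultimately show ?thesis by (simp add: compact_eq_bounded_closed)
qed

lemma ref_tri_sets: "ref_tri \<in> sets borel"
  by (rule borel_compact[OF compact_ref_tri])

lemma open_ref_interior: "open ref_interior"
  unfolding ref_interior_def by (intro open_Collect_conj open_Collect_less continuous_intros)

lemma ref_interior_nonempty: "ref_interior \<noteq> {}"
proof -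
  have "vector [1/3, 1/3] \<in> ref_interior" by (simp add: ref_interior_def)
  then show ?thesis by blast
qed

lemma ref_integrable_continuous:
  fixes f :: "real^2 \<Rightarrow> real"
  assumes "continuous_on ref_tri f" shows "set_integrable lborel ref_tri f"
  using borel_integrable_compact[OF compact_ref_tri assms] by (simp add: set_integrable_def)

lemma ref_integral_pos:
  fixes f :: "real^2 \<Rightarrow> real"
  assumes c: "continuous_on ref_tri f" and nn: "\<And>u. u \<in> ref_tri \<Longrightarrow> 0 \<le> f u"
    and p: "\<And>u. u \<in> ref_interior \<Longrightarrow> 0 < f u"
  shows "0 < (LINT u:ref_tri|lborel. f u)"
proof -
  let ?g = "\<lambda>u. indicator ref_tri u *\<^sub>R f u"
  have i: "integrable lborel ?g" using ref_integrable_continuous[OF c] by (simp add: set_integrable_def)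
  have g0: "0 \<le> ?g u" for u using nn by (auto simp: indicator_def)
  have "integral\<^sup>L lborel ?g \<noteq> 0"
  proof
    assume "integral\<^sup>L lborel ?g = 0"
    then have "AE u in lborel. ?g u = 0" using i g0 by (subst (asm) integral_nonneg_eq_0_iff_AE) auto
    then have "AE u in lborel. u \<notin> ref_interior"
    proof eventually_elim
      case (elim u)
      then show ?case using p[of u] ref_interior_subset by (auto simp: indicator_def split: if_splits)
    qed
    then have "emeasure lborel ref_interior = 0"
      using open_ref_interior by (subst (asm) AE_iff_measurable[of ref_interior]) auto
    then have "ref_interior \<in> null_sets lborel" using open_ref_interior by (auto simp: null_sets_def)
    then have "negligible ref_interior" using null_sets_completionI by (simp add: negligible_iff_null_sets)
    then show False using open_not_negligible[OF open_ref_interior ref_interior_nonempty] by simp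
  qed
  moreover have "0 \<le> integral\<^sup>L lborel ?g" by (rule Bochner_Integration.integral_nonneg) (rule g0)
  ultimately show ?thesis by (simp add: set_lebesgue_integral_def)
qed

lemma mesh_integral_ref:
  "mesh_integral D f = (\<Sum>T\<in>tris D. 2 * tri_area D T * (LINT u:ref_tri|lborel. f (tri_map D T u)))"
  by (simp add: mesh_integral_def ref_tri_def)

text \<open>Where this fails, an integral over a triangle takes the default value zero and \<open>mesh_integral\<close> need
not be additive.\<close>

definition mesh_integrable :: "'v discr \<Rightarrow> (real^3 \<Rightarrow> real) \<Rightarrow> bool" where
  "mesh_integrable D f \<longleftrightarrow> (\<forall>T\<in>tris D. set_integrable lborel ref_tri (\<lambda>u. f (tri_map D T u)))"

lemma mesh_integral_add:
  "mesh_integrable D f \<Longrightarrow> mesh_integrable D g \<Longrightarrow>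
    mesh_integral D (\<lambda>x. f x + g x) = mesh_integral D f + mesh_integral D g"
  unfolding mesh_integral_ref mesh_integrable_def
  by (simp add: sum.distrib[symmetric] distrib_left)

lemma mesh_integral_cmult: "mesh_integral D (\<lambda>x. c * f x) = c * mesh_integral D f"
  unfolding mesh_integral_ref by (simp add: sum_distrib_left algebra_simps)

lemma mesh_integrable_add: "mesh_integrable D f \<Longrightarrow> mesh_integrable D g \<Longrightarrow> mesh_integrable D (\<lambda>x. f x + g x)"
  by (auto simp: mesh_integrable_def)

lemma tri_map_ref: "u \<in> ref_tri \<Longrightarrow> tri_map D T u \<in> tri_hull D T"
proof (cases T)
  case (fields a b c)
  assume u: "u \<in> ref_tri"
  have "tri_map D T u = (1 - u $ 1 - u $ 2) *\<^sub>R vtx D a + u $ 1 *\<^sub>R vtx D b + u $ 2 *\<^sub>R vtx D c"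
    by (simp add: fields algebra_simps)
  then show ?thesis using u unfolding tri_hull_def fields by (simp add: convex_hull_3 ref_tri_def) 
    (intro exI[of _ "1 - u $ 1 - u $ 2"] exI[of _ "u $ 1"] exI[of _ "u $ 2"], auto)
qed

lemma tri_hull_eq: "tri_hull D T = tri_map D T ` ref_tri"
proof
  show "tri_map D T ` ref_tri \<subseteq> tri_hull D T" using tri_map_ref by blast
  show "tri_hull D T \<subseteq> tri_map D T ` ref_tri"
  proof (cases T)
    case (fields a b c)
    show ?thesis
    proof
      fix x assume "x \<in> tri_hull D T"
      then obtain \<alpha> \<beta> \<gamma> where w: "0 \<le> \<alpha>" "0 \<le> \<beta>" "0 \<le> \<gamma>" "\<alpha> + \<beta> + \<gamma> = 1"
        "x = \<alpha> *\<^sub>R vtx D a + \<beta> *\<^sub>R vtx D b + \<gamma> *\<^sub>R vtx D c"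
        unfolding tri_hull_def fields by (auto simp: convex_hull_3)
      have a: "\<alpha> = 1 - \<beta> - \<gamma>" using w(4) by simp
      have "x = (1 - \<beta> - \<gamma>) *\<^sub>R vtx D a + \<beta> *\<^sub>R vtx D b + \<gamma> *\<^sub>R vtx D c"
        using w(5) unfolding a .
      then have "x = tri_map D T (vector [\<beta>, \<gamma>])" by (simp add: fields algebra_simps)
      moreover have "vector [\<beta>, \<gamma>] \<in> ref_tri" using w by (simp add: ref_tri_def)
      ultimately show "x \<in> tri_map D T ` ref_tri" by blast
    qed
  qed
qed

lemma tri_map_in_mesh: "T \<in> tris D \<Longrightarrow> u \<in> ref_tri \<Longrightarrow> tri_map D T u \<in> mesh D"
  unfolding mesh_def by (rule UN_I, assumption, rule tri_map_ref)

lemma mesh_integral_cong: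
  assumes "\<And>x. x \<in> mesh D \<Longrightarrow> f x = g x" shows "mesh_integral D f = mesh_integral D g"
  unfolding mesh_integral_ref
proof (rule sum.cong[OF refl])
  fix T assume T: "T \<in> tris D"
  have "(LINT u:ref_tri|lborel. f (tri_map D T u)) = (LINT u:ref_tri|lborel. g (tri_map D T u))"
    using ref_tri_sets tri_map_in_mesh[OF T] assms by (intro set_lebesgue_integral_cong) auto
  then show "2 * tri_area D T * (LINT u:ref_tri|lborel. f (tri_map D T u)) = 2 * tri_area D T * (LINT u:ref_tri|lborel. g (tri_map D T u))"
    by simp
qed

lemma continuous_tri_map: "continuous_on S (tri_map D T)"
proof (cases T)
  case (fields a b c)
  have "continuous_on S (\<lambda>u::real^2. vtx D a + (u $ 1) *\<^sub>R (vtx D b - vtx D a) + (u $ 2) *\<^sub>R (vtx D c - vtx D a))"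
    by (intro continuous_intros)
  then show ?thesis unfolding fields by (rule continuous_on_eq) simp
qed

lemma mesh_integrable_continuous:
  assumes "continuous_on (mesh D) f" shows "mesh_integrable D f"
  unfolding mesh_integrable_def
proof
  fix T assume T: "T \<in> tris D"
  have "continuous_on ref_tri (\<lambda>u. f (tri_map D T u))"
    by (rule continuous_on_compose2[OF assms continuous_tri_map]) (use tri_map_in_mesh[OF T] in auto)
  then show "set_integrable lborel ref_tri (\<lambda>u. f (tri_map D T u))" by (rule ref_integrable_continuous)
qed

locale triangulated =
  fixes D :: "'v::finite discr"
  assumes tri: "triangulation D"
begin

lemma tri_cross: "(a, b, c) \<in> tris D \<Longrightarrow> cross3 (vtx D b - vtx D a) (vtx D c - vtx D a) \<noteq> 0"
  using tri unfolding triangulation_def by fastforce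

lemma tri_distinct: "(a, b, c) \<in> tris D \<Longrightarrow> a \<noteq> b \<and> b \<noteq> c \<and> a \<noteq> c \<and> b \<noteq> a \<and> c \<noteq> b \<and> c \<noteq> a"
  using tri_cross[of a b c] by (auto simp: cross_refl cross_zero_left cross_zero_right)

lemma tri_area_pos: "T \<in> tris D \<Longrightarrow> 0 < tri_area D T"
  using tri by (simp add: triangulation_def)

lemma tris_nonempty: "tris D \<noteq> {}"
  using tri by (auto simp: triangulation_def)

text \<open>Barycentric coordinates in the triangle \<open>T\<close> are taken as functions on the set of all vertices, which
allows to compare coordinates in different triangles.\<close>

definition weights_in :: "'v \<times> 'v \<times> 'v \<Rightarrow> real^3 \<Rightarrow> ('v \<Rightarrow> real) \<Rightarrow> bool" where
  "weights_in T x w \<longleftrightarrow> (\<forall>i. 0 \<le> w i) \<and> (\<forall>i. i \<notin> tri_verts T \<longrightarrow> w i = 0) \<and>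
     sum w UNIV = 1 \<and> (\<Sum>i\<in>UNIV. w i *\<^sub>R vtx D i) = x"

lemma sum_verts:
  assumes "(a, b, c) \<in> tris D" "\<And>i. i \<notin> {a, b, c} \<Longrightarrow> f i = 0"
  shows "sum f UNIV = f a + f b + (f c :: 'b::comm_monoid_add)"
proof -
  have "sum f UNIV = sum f {a, b, c}" using assms(2) by (intro sum.mono_neutral_right) auto
  also have "\<dots> = f a + f b + f c" using tri_distinct[OF assms(1)] by (simp add: add.assoc)
  finally show ?thesis .
qed

lemma weights_unique_same:
  assumes T: "T \<in> tris D" and w: "weights_in T x w" and v: "weights_in T x v"
  shows "w = v"
proof (cases T)
  case (fields a b c)
  note T' = T[unfolded fields]
  define d where "d i = w i - v i" for i
  have d0: "d i = 0" if "i \<notin> {a, b, c}" for i using w v that by (auto simp: weights_in_def fields d_def)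
  have "sum d UNIV = 0" using w v by (simp add: weights_in_def d_def sum_subtractf)
  then have 1: "d a + d b + d c = 0" using sum_verts[OF T', of d] d0 by simp
  have "(\<Sum>i\<in>UNIV. d i *\<^sub>R vtx D i) = 0"
    using w v by (simp add: weights_in_def d_def scaleR_diff_left sum_subtractf)
  then have 2: "d a *\<^sub>R vtx D a + d b *\<^sub>R vtx D b + d c *\<^sub>R vtx D c = 0"
    using sum_verts[OF T', of "\<lambda>i. d i *\<^sub>R vtx D i"] d0 by simp
  have da: "d a = - d b - d c" using 1 by simp
  have "d b *\<^sub>R (vtx D b - vtx D a) + d c *\<^sub>R (vtx D c - vtx D a) = 0"
    using 2 unfolding da by (simp add: algebra_simps)
  then have "d b = 0 \<and> d c = 0" by (rule cross_indep[OF tri_cross[OF T']])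
  then have "d i = 0" for i using d0[of i] da by auto
  then show ?thesis by (simp add: d_def fun_eq_iff)
qed

lemma hull_weights:
  assumes "x \<in> convex hull (vtx D ` C)"
  shows "\<exists>w. (\<forall>i. 0 \<le> w i) \<and> (\<forall>i. i \<notin> C \<longrightarrow> w i = 0) \<and> sum w UNIV = 1 \<and> (\<Sum>i\<in>UNIV. w i *\<^sub>R vtx D i) = x"
proof -
  have inj: "inj_on (vtx D) C" using tri by (auto simp: triangulation_def intro: inj_on_subset)
  obtain u where u: "\<forall>y\<in>vtx D ` C. 0 \<le> u y" "sum u (vtx D ` C) = 1" "(\<Sum>y\<in>vtx D ` C. u y *\<^sub>R y) = x"
    using assms by (auto simp: convex_hull_finite)
  define w where "w i = (if i \<in> C then u (vtx D i) else 0)" for i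
  have "sum w UNIV = sum w C" by (rule sum.mono_neutral_right) (auto simp: w_def)
  also have "\<dots> = sum u (vtx D ` C)" using inj by (simp add: sum.reindex w_def)
  finally have 1: "sum w UNIV = 1" using u by simp
  have "(\<Sum>i\<in>UNIV. w i *\<^sub>R vtx D i) = (\<Sum>i\<in>C. w i *\<^sub>R vtx D i)"
    by (rule sum.mono_neutral_right) (auto simp: w_def)
  also have "\<dots> = (\<Sum>y\<in>vtx D ` C. u y *\<^sub>R y)" using inj by (simp add: sum.reindex w_def)
  finally have 2: "(\<Sum>i\<in>UNIV. w i *\<^sub>R vtx D i) = x" using u by simp
  show ?thesis by (rule exI[of _ w]) (use 1 2 u in \<open>auto simp: w_def\<close>)
qed

lemma weights_hull: "weights_in T x w \<Longrightarrow> x \<in> tri_hull D T"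
proof (cases T)
  case (fields a b c)
  assume w: "weights_in T x w"
  have inj: "inj_on (vtx D) (tri_verts T)" using tri by (auto simp: triangulation_def intro: inj_on_subset)
  have "sum w (tri_verts T) = 1" 
    using w sum.mono_neutral_right[of UNIV "tri_verts T" w] by (auto simp: weights_in_def)
  moreover have "(\<Sum>i\<in>tri_verts T. w i *\<^sub>R vtx D i) = x"
    using w sum.mono_neutral_right[of UNIV "tri_verts T" "\<lambda>i. w i *\<^sub>R vtx D i"] by (auto simp: weights_in_def)
  moreover have "0 \<le> w i" for i using w by (simp add: weights_in_def)
  ultimately have "x \<in> convex hull (vtx D ` tri_verts T)"
    using convex_sum[OF _ convex_convex_hull[of "vtx D ` tri_verts T"], of "tri_verts T" w "vtx D"]
    by (auto intro: hull_inc)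
  then show ?thesis by (simp add: tri_hull_def)
qed

text \<open>A point common to two triangles lies in the hull of their common vertices. The weights of such a
representation are barycentric coordinates in both triangles.\<close>

lemma weights_unique:
  assumes T: "T \<in> tris D" and S: "S \<in> tris D" and w: "weights_in T x w" and v: "weights_in S x v"
  shows "w = v"
proof -
  have "x \<in> tri_hull D T \<inter> tri_hull D S" using w v weights_hull by blast
  then have "x \<in> convex hull (vtx D ` (tri_verts T \<inter> tri_verts S))"
    using tri T S unfolding triangulation_def by blast
  from hull_weights[OF this] obtain p where "weights_in T x p" "weights_in S x p"
    unfolding weights_in_def by blast
  then show ?thesis using weights_unique_same T S w v by metis
qed

text \<open>The description in the definition of \<open>hat\<close> is unique because barycentric coordinates are the same
in every triangle containing \<open>x\<close>.\<close>

lemma hat_eq: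
  assumes T: "T \<in> tris D" and w: "weights_in T x w"
  shows "hat D i x = w i"
  unfolding hat_def
proof (rule the_equality)
  obtain a b c where abc: "T = (a, b, c)" by (cases T)
  have w0: "w i = 0" if "i \<notin> {a, b, c}" for i using w that by (auto simp: weights_in_def abc)
  have "w a + w b + w c = 1" using w sum_verts[OF T[unfolded abc], of w] w0 by (simp add: weights_in_def)
  moreover have "x = w a *\<^sub>R vtx D a + w b *\<^sub>R vtx D b + w c *\<^sub>R vtx D c"
    using w sum_verts[OF T[unfolded abc], of "\<lambda>i. w i *\<^sub>R vtx D i"] w0 by (simp add: weights_in_def)
  moreover have "w i = (if i = a then w a else if i = b then w b else if i = c then w c else 0)"
    using w0[of i] by auto
  moreover have "0 \<le> w a" "0 \<le> w b" "0 \<le> w c" using w by (auto simp: weights_in_def)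
  ultimately show "\<exists>a b c \<alpha> \<beta> \<gamma>. (a, b, c) \<in> tris D \<and> 0 \<le> \<alpha> \<and> 0 \<le> \<beta> \<and> 0 \<le> \<gamma> \<and> \<alpha> + \<beta> + \<gamma> = 1 \<and>
     x = \<alpha> *\<^sub>R vtx D a + \<beta> *\<^sub>R vtx D b + \<gamma> *\<^sub>R vtx D c \<and>
     w i = (if i = a then \<alpha> else if i = b then \<beta> else if i = c then \<gamma> else 0)"
    using T[unfolded abc] by blast
next
  fix y assume "\<exists>a b c \<alpha> \<beta> \<gamma>. (a, b, c) \<in> tris D \<and> 0 \<le> \<alpha> \<and> 0 \<le> \<beta> \<and> 0 \<le> \<gamma> \<and> \<alpha> + \<beta> + \<gamma> = 1 \<and>
     x = \<alpha> *\<^sub>R vtx D a + \<beta> *\<^sub>R vtx D b + \<gamma> *\<^sub>R vtx D c \<and>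
     y = (if i = a then \<alpha> else if i = b then \<beta> else if i = c then \<gamma> else 0)"
  then obtain a b c \<alpha> \<beta> \<gamma> where h: "(a, b, c) \<in> tris D" "0 \<le> \<alpha>" "0 \<le> \<beta>" "0 \<le> \<gamma>" "\<alpha> + \<beta> + \<gamma> = 1"
     "x = \<alpha> *\<^sub>R vtx D a + \<beta> *\<^sub>R vtx D b + \<gamma> *\<^sub>R vtx D c"
     "y = (if i = a then \<alpha> else if i = b then \<beta> else if i = c then \<gamma> else 0)" by blast
  define v where "v i = (if i = a then \<alpha> else if i = b then \<beta> else if i = c then \<gamma> else 0)" for i
  have "weights_in (a, b, c) x v"
    unfolding weights_in_def
    using sum_verts[OF h(1), of v] sum_verts[OF h(1), of "\<lambda>i. v i *\<^sub>R vtx D i"] tri_distinct[OF h(1)] h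
    by (simp add: v_def)
  then have "w = v" using weights_unique[OF T h(1) w] by blast
  then show "y = w i" using h(7) by (simp add: v_def)
qed

fun bary :: "'v \<times> 'v \<times> 'v \<Rightarrow> real^2 \<Rightarrow> 'v \<Rightarrow> real" where
  "bary (a, b, c) u i = (if i = a then 1 - u $ 1 - u $ 2 else if i = b then u $ 1 else if i = c then u $ 2 else 0)"

lemma weights_bary:
  assumes T: "T \<in> tris D" and u: "u \<in> ref_tri"
  shows "weights_in T (tri_map D T u) (bary T u)"
proof (cases T)
  case (fields a b c)
  show ?thesis
    unfolding weights_in_def fields
    using sum_verts[OF T[unfolded fields], of "bary (a, b, c) u"]
      sum_verts[OF T[unfolded fields], of "\<lambda>i. bary (a, b, c) u i *\<^sub>R vtx D i"]
      tri_distinct[OF T[unfolded fields]] u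
    by (simp add: ref_tri_def algebra_simps)
qed

lemma hat_tri_map: "T \<in> tris D \<Longrightarrow> u \<in> ref_tri \<Longrightarrow> hat D i (tri_map D T u) = bary T u i"
  by (rule hat_eq[OF _ weights_bary])

lemma continuous_bary: "continuous_on S (\<lambda>u. bary T u i)"
proof (cases T)
  case (fields a b c)
  show ?thesis
    unfolding fields bary.simps
    by (cases "i = a"; cases "i = b"; cases "i = c") (auto intro!: continuous_intros)
qed

lemma bary_sum: "T \<in> tris D \<Longrightarrow> u \<in> ref_tri \<Longrightarrow> (\<Sum>i\<in>UNIV. bary T u i) = 1"
  using weights_bary by (simp add: weights_in_def)

lemma hat_sum: "x \<in> mesh D \<Longrightarrow> (\<Sum>i\<in>UNIV. hat D i x) = 1"
  using bary_sum hat_tri_map by (auto simp: mesh_def tri_hull_eq)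

text \<open>The basis reciprocal to \<open>e1\<close>, \<open>e2\<close> in their plane. It yields the affine coordinates on a triangle and
the elementwise gradient.\<close>

definition dual1 :: "real^3 \<Rightarrow> real^3 \<Rightarrow> real^3" where
  "dual1 e1 e2 = (1 / (cross3 e1 e2 \<bullet> cross3 e1 e2)) *\<^sub>R cross3 e2 (cross3 e1 e2)"

definition dual2 :: "real^3 \<Rightarrow> real^3 \<Rightarrow> real^3" where
  "dual2 e1 e2 = (1 / (cross3 e1 e2 \<bullet> cross3 e1 e2)) *\<^sub>R cross3 (cross3 e1 e2) e1"

lemma dual_basis:
  assumes "cross3 e1 e2 \<noteq> 0"
  shows "dual1 e1 e2 \<bullet> e1 = 1" "dual1 e1 e2 \<bullet> e2 = 0" "dual2 e1 e2 \<bullet> e1 = 0" "dual2 e1 e2 \<bullet> e2 = 1"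
    "dual1 e1 e2 \<in> span {e1, e2}" "dual2 e1 e2 \<in> span {e1, e2}"
proof -
  let ?n = "cross3 e1 e2"
  have nn: "?n \<bullet> ?n \<noteq> 0" using assms by simp
  have t: "cross3 e2 ?n \<bullet> e1 = ?n \<bullet> ?n" "cross3 ?n e1 \<bullet> e2 = ?n \<bullet> ?n"
    by (simp_all add: cross_triple inner_commute[of _ e1] inner_commute[of _ e2])
       (simp_all add: cross3_def inner_vec_def sum_3 algebra_simps)
  show "dual1 e1 e2 \<bullet> e1 = 1" "dual2 e1 e2 \<bullet> e2 = 1" using t nn by (simp_all add: dual1_def dual2_def)
  show "dual1 e1 e2 \<bullet> e2 = 0" "dual2 e1 e2 \<bullet> e1 = 0" by (simp_all add: dual1_def dual2_def dot_cross_self)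
  have sp: "v \<in> span {e1, e2}" if v: "v \<bullet> ?n = 0" for v
  proof -
    obtain \<alpha> \<beta> where "v = \<alpha> *\<^sub>R e1 + \<beta> *\<^sub>R e2" using perp_cross_imp_span[OF assms v] by blast
    then show ?thesis by (simp add: span_add span_scale span_base)
  qed
  show "dual1 e1 e2 \<in> span {e1, e2}" "dual2 e1 e2 \<in> span {e1, e2}"
    by (rule sp, simp add: dual1_def dual2_def dot_cross_self)+
qed

text \<open>On a closed triangle the barycentric coordinates are affine functions of \<open>x\<close>, computed with the
reciprocal basis of two edges.\<close>

lemma continuous_hat: "continuous_on (mesh D) (hat D i)"
  unfolding mesh_def
proof (rule continuous_on_closed_Union)
  fix T assume T: "T \<in> tris D"
  show "closed (tri_hull D T)"
    unfolding tri_hull_eq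
    by (intro compact_imp_closed compact_continuous_image continuous_tri_map compact_ref_tri)
  obtain a b c where abc: "T = (a, b, c)" by (cases T)
  let ?e1 = "vtx D b - vtx D a" and ?e2 = "vtx D c - vtx D a"
  define r :: "real^3 \<Rightarrow> real^2"
    where "r x = (\<chi> k. (if k = 1 then dual1 ?e1 ?e2 else dual2 ?e1 ?e2) \<bullet> (x - vtx D a))" for x
  note db = dual_basis[OF tri_cross[OF T[unfolded abc]]]
  have r: "r (tri_map D T u) = u" for u
    using db by (simp add: r_def abc vec_eq_iff forall_2 inner_add_right)
  have "continuous_on (tri_hull D T) r"
    unfolding r_def by (intro continuous_intros)
  then have "continuous_on (tri_hull D T) (\<lambda>x. bary T (r x) i)"
    by (rule continuous_on_compose2[OF continuous_bary[of UNIV]]) auto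
  then show "continuous_on (tri_hull D T) (hat D i)"
    by (rule continuous_on_eq) (use hat_tri_map[OF T] r in \<open>auto simp: tri_hull_eq\<close>)
qed simp

lemma continuous_pl:
  fixes w :: "'v \<Rightarrow> 'b::real_normed_vector" shows "continuous_on (mesh D) (pl D w)"
  unfolding pl_def by (intro continuous_on_sum continuous_on_scaleR continuous_hat continuous_on_const)

end

section \<open>Mass, stiffness and the discrete Poisson form\<close>

lemma mesh_integral_nonneg:
  assumes "\<And>T. T \<in> tris D \<Longrightarrow> 0 \<le> tri_area D T" "\<And>x. 0 \<le> f x"
  shows "0 \<le> mesh_integral D f"
  unfolding mesh_integral_ref set_lebesgue_integral_def using assms
  by (intro sum_nonneg mult_nonneg_nonneg Bochner_Integration.integral_nonneg) auto

lemma pl_add: "pl D (u + v) x = pl D u x + pl D v x"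
  and pl_scale: "pl D (c *\<^sub>R u) x = c *\<^sub>R pl D u x"
  by (simp_all add: pl_def scaleR_add_right sum.distrib scaleR_sum_right mult.commute)

text \<open>Naming the difference quotient lets bilinearity of the mass form be applied to it.\<close>

definition time_diff :: "'v discr \<Rightarrow> (nat \<Rightarrow> 'v \<Rightarrow> real) \<Rightarrow> nat \<Rightarrow> 'v \<Rightarrow> real" where
  "time_diff D u j = (\<lambda>i. (u j i - u (j - 1) i) / tau D)"

lemma time_diff_add: "time_diff D (u + v) j = time_diff D u j + time_diff D v j"
  and time_diff_scale: "time_diff D (c *\<^sub>R u) j = c *\<^sub>R time_diff D u j"
  by (simp_all add: time_diff_def fun_eq_iff add_divide_distrib[symmetric] algebra_simps)

lemma a_form_time_diff: "a_form D u v =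
     (\<Sum>j=1..Nt D. tau D * mass D (time_diff D u j) (time_diff D v j))
   + (\<Sum>j\<le>Nt D. wt D j * stiff D (u j) (v j))"
  by (simp add: a_form_def time_diff_def)

lemma mass_commute: "mass D u v = mass D v u"
  by (simp add: mass_def mult.commute)

lemma stiff_commute: "stiff D u v = stiff D v u"
  by (simp add: stiff_def inner_commute)

lemma a_form_commute: "a_form D u v = a_form D v u"
  unfolding a_form_time_diff
  by (simp add: mass_commute[of D "time_diff D u _"] stiff_commute[of D "u _"])

context triangulated
begin

lemma mesh_integrable_pl_mult:
  "continuous_on (mesh D) f \<Longrightarrow> mesh_integrable D (\<lambda>x. f x * pl D v x)"
  by (intro mesh_integrable_continuous continuous_on_mult continuous_pl)

lemma mass_add_left: "mass D (u + u') v = mass D u v + mass D u' v"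
  unfolding mass_def
  using mesh_integral_add[OF mesh_integrable_pl_mult[OF continuous_pl] mesh_integrable_pl_mult[OF continuous_pl], of u v u' v]
  by (simp add: pl_add distrib_right)

lemma mass_scale_left: "mass D (c *\<^sub>R u) v = c * mass D u v"
  unfolding mass_def using mesh_integral_cmult[of D c "\<lambda>x. pl D u x * pl D v x"]
  by (simp add: pl_scale mult.assoc)

lemma mass_add_right: "mass D u (v + v') = mass D u v + mass D u v'"
  and mass_scale_right: "mass D u (c *\<^sub>R v) = c * mass D u v"
  using mass_add_left mass_scale_left mass_commute by metis+

lemma mass_nonneg: "0 \<le> mass D u u"
  unfolding mass_def by (rule mesh_integral_nonneg) (use tri_area_pos in \<open>auto intro: less_imp_le\<close>)

lemma mesh_area_pos: "0 < mesh_integral D (\<lambda>x. 1)"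
  unfolding mesh_integral_ref
proof (rule sum_pos)
  fix T assume "T \<in> tris D"
  then show "0 < 2 * tri_area D T * (LINT u:ref_tri|lborel. 1)"
    using tri_area_pos ref_integral_pos[of "\<lambda>u. 1"] by simp
qed (use tris_nonempty in auto)

lemma pl_const: "x \<in> mesh D \<Longrightarrow> pl D (\<lambda>i. c) x = (c :: real)"
  using hat_sum[of x] by (simp add: pl_def sum_distrib_right[symmetric])

lemma mesh_integral_pl_const: "mesh_integral D (pl D (\<lambda>i. c)) = c * mesh_integral D (\<lambda>x. 1)"
proof -
  have "mesh_integral D (pl D (\<lambda>i. c)) = mesh_integral D (\<lambda>x. c * 1)"
    by (rule mesh_integral_cong) (simp add: pl_const)
  then show ?thesis by (simp only: mesh_integral_cmult)
qed

lemma mass_const: "mass D (\<lambda>i. c) (\<lambda>i. c) = c\<^sup>2 * mesh_integral D (\<lambda>x. 1)"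
proof -
  have "mass D (\<lambda>i. c) (\<lambda>i. c) = mesh_integral D (\<lambda>x. c\<^sup>2 * 1)"
    unfolding mass_def by (rule mesh_integral_cong) (simp add: pl_const power2_eq_square)
  then show ?thesis by (simp only: mesh_integral_cmult)
qed

lemma nodal_area_pos: "0 < nodal_area D i"
  unfolding nodal_area_def mesh_integral_ref
proof -
  have eq: "(LINT u:ref_tri|lborel. hat D i (tri_map D T u)) = (LINT u:ref_tri|lborel. bary T u i)"
    if "T \<in> tris D" for T
    using ref_tri_sets hat_tri_map[OF that] by (intro set_lebesgue_integral_cong) auto
  have nn: "0 \<le> bary T u i" if "T \<in> tris D" "u \<in> ref_tri" for T u
    using weights_bary[OF that] by (simp add: weights_in_def)
  obtain a b c where T0: "(a, b, c) \<in> tris D" "i \<in> {a, b, c}"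
  proof -
    have "i \<in> (\<Union>T\<in>tris D. tri_verts T)" using tri by (simp add: triangulation_def)
    then show ?thesis using that by fastforce
  qed
  have p: "0 < (LINT u:ref_tri|lborel. bary (a, b, c) u i)"
    by (rule ref_integral_pos[OF continuous_bary nn[OF T0(1)]])
       (use T0(2) in \<open>auto simp: ref_interior_def\<close>)
  show "0 < (\<Sum>T\<in>tris D. 2 * tri_area D T * (LINT u:ref_tri|lborel. hat D i (tri_map D T u)))"
  proof (rule sum_pos2[OF _ T0(1)])
    show "0 < 2 * tri_area D (a, b, c) * (LINT u:ref_tri|lborel. hat D i (tri_map D (a, b, c) u))"
      using tri_area_pos[OF T0(1)] p unfolding eq[OF T0(1)] by simp
    fix T assume T: "T \<in> tris D"
    have "0 \<le> (LINT u:ref_tri|lborel. bary T u i)"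
      unfolding set_lebesgue_integral_def
      by (rule Bochner_Integration.integral_nonneg) (use nn[OF T] in \<open>auto simp: indicator_def\<close>)
    then show "0 \<le> 2 * tri_area D T * (LINT u:ref_tri|lborel. hat D i (tri_map D T u))"
      using tri_area_pos[OF T] unfolding eq[OF T] by simp
  qed simp
qed

lemma span2_unique:
  assumes "w \<in> span {e1, e2 :: real^3}" "w' \<in> span {e1, e2}" "w \<bullet> e1 = w' \<bullet> e1" "w \<bullet> e2 = w' \<bullet> e2"
  shows "w = w'"
proof -
  have "w - w' \<in> span {e1, e2}" using assms by (intro span_diff)
  moreover have "orthogonal (w - w') y" if "y \<in> {e1, e2}" for y
    using that assms by (auto simp: orthogonal_def inner_diff_left)
  ultimately have "orthogonal (w - w') (w - w')" using orthogonal_to_span by blast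
  then show ?thesis by (simp add: orthogonal_def)
qed

lemma tri_grad_eqI:
  assumes "w \<in> tri_span D (a, b, c)" "w \<bullet> (vtx D b - vtx D a) = u b - u a" "w \<bullet> (vtx D c - vtx D a) = u c - u a"
  shows "tri_grad D u (a, b, c) = w"
  unfolding tri_grad.simps
  by (rule the_equality) (use assms span2_unique in auto)

lemma tri_grad_props:
  assumes T: "(a, b, c) \<in> tris D"
  shows "tri_grad D u (a, b, c) \<in> tri_span D (a, b, c)"
    "tri_grad D u (a, b, c) \<bullet> (vtx D b - vtx D a) = u b - u a"
    "tri_grad D u (a, b, c) \<bullet> (vtx D c - vtx D a) = u c - u a"
proof -
  let ?e1 = "vtx D b - vtx D a" and ?e2 = "vtx D c - vtx D a"
  note db = dual_basis[OF tri_cross[OF T]]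
  define w where "w = (u b - u a) *\<^sub>R dual1 ?e1 ?e2 + (u c - u a) *\<^sub>R dual2 ?e1 ?e2"
  have w: "w \<in> tri_span D (a, b, c)" "w \<bullet> ?e1 = u b - u a" "w \<bullet> ?e2 = u c - u a"
    using db by (auto simp: w_def inner_add_left intro!: span_add span_scale)
  have "tri_grad D u (a, b, c) = w" by (rule tri_grad_eqI[OF w])
  with w show "tri_grad D u (a, b, c) \<in> tri_span D (a, b, c)"
    "tri_grad D u (a, b, c) \<bullet> (vtx D b - vtx D a) = u b - u a"
    "tri_grad D u (a, b, c) \<bullet> (vtx D c - vtx D a) = u c - u a" by simp_all
qed

lemma tri_grad_linear:
  assumes "T \<in> tris D"
  shows "tri_grad D (u + v) T = tri_grad D u T + tri_grad D v T"
    and "tri_grad D (k *\<^sub>R u) T = k *\<^sub>R tri_grad D u T"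
proof -
  obtain a b c where T: "T = (a, b, c)" by (cases T)
  note p = tri_grad_props[OF assms[unfolded T]]
  show "tri_grad D (u + v) T = tri_grad D u T + tri_grad D v T" unfolding T
    by (rule tri_grad_eqI) (use p in \<open>auto simp: inner_add_left intro!: span_add\<close>)
  show "tri_grad D (k *\<^sub>R u) T = k *\<^sub>R tri_grad D u T" unfolding T
    by (rule tri_grad_eqI) (use p in \<open>auto simp: right_diff_distrib intro!: span_scale\<close>)
qed

lemma stiff_add_left: "stiff D (u + u') v = stiff D u v + stiff D u' v"
  and stiff_scale_left: "stiff D (k *\<^sub>R u) v = k * stiff D u v"
  by (simp_all add: stiff_def tri_grad_linear inner_add_left sum.distrib[symmetric] distrib_left
      sum_distrib_left mult.left_commute cong: sum.cong)

lemma stiff_nonneg: "0 \<le> stiff D u u"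
  unfolding stiff_def using tri_area_pos by (intro sum_nonneg mult_nonneg_nonneg) (auto intro: less_imp_le)

lemma stiff_zero_imp_locally_const:
  assumes "stiff D u u = 0" "T \<in> tris D" "k \<in> tri_verts T" "l \<in> tri_verts T"
  shows "u k = u l"
proof -
  have "tri_area D T * (tri_grad D u T \<bullet> tri_grad D u T) = 0"
    using assms(1,2) tri_area_pos unfolding stiff_def
    by (subst (asm) sum_nonneg_eq_0_iff) (auto intro: less_imp_le)
  then have g: "tri_grad D u T = 0" using tri_area_pos[OF assms(2)] by simp
  obtain a b c where T: "T = (a, b, c)" by (cases T)
  have "u b = u a" "u c = u a" using tri_grad_props(2,3)[OF assms(2)[unfolded T], of u] g T by simp_all
  then have "u m = u a" if "m \<in> tri_verts T" for m using that unfolding T by auto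
  from this[OF assms(3)] this[OF assms(4)] show ?thesis by simp
qed

text \<open>The triangles on which \<open>u\<close> takes the value \<open>u k\<close> and those on which it does not cover disjoint closed
sets, because triangles that meet have a common vertex. A connected mesh leaves room for the first
kind only.\<close>

lemma locally_const_imp_const:
  assumes con: "connected (mesh D)"
    and loc: "\<And>T k l. T \<in> tris D \<Longrightarrow> k \<in> tri_verts T \<Longrightarrow> l \<in> tri_verts T \<Longrightarrow> u k = u l"
  shows "u k = u l"
proof (rule ccontr)
  assume ne: "u k \<noteq> u l"
  define A where "A = {T\<in>tris D. \<forall>m\<in>tri_verts T. u m = u k}"
  define B where "B = {T\<in>tris D. \<forall>m\<in>tri_verts T. u m \<noteq> u k}"
  have cov: "tris D = A \<union> B"
  proof (intro equalityI subsetI)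
    fix T assume T: "T \<in> tris D"
    show "T \<in> A \<union> B"
    proof (cases "\<exists>m\<in>tri_verts T. u m = u k")
      case True
      then obtain m where m: "m \<in> tri_verts T" "u m = u k" by blast
      have "u m' = u k" if "m' \<in> tri_verts T" for m' using loc[OF T that m(1)] m(2) by simp
      then show ?thesis using T unfolding A_def by blast
    next
      case False
      then show ?thesis using T unfolding B_def by blast
    qed
  qed (auto simp: A_def B_def)
  have "closed (tri_hull D T)" for T
    unfolding tri_hull_eq
    by (rule compact_imp_closed, rule compact_continuous_image[OF continuous_tri_map compact_ref_tri])
  then have cl: "closed (\<Union>T\<in>S. tri_hull D T)" for S by (intro closed_UN) auto
  have hull_ne: "tri_hull D T \<noteq> {}" for T by (cases T) (auto simp: tri_hull_def)
  have tri_at: "\<exists>T\<in>tris D. m \<in> tri_verts T" for m using tri by (auto simp: triangulation_def)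
  have disj: "(\<Union>T\<in>A. tri_hull D T) \<inter> (\<Union>T\<in>B. tri_hull D T) = {}"
  proof (rule ccontr)
    assume "\<not> ?thesis"
    then obtain x T S where x: "T \<in> A" "S \<in> B" "x \<in> tri_hull D T \<inter> tri_hull D S" by blast
    then have "x \<in> convex hull (vtx D ` (tri_verts T \<inter> tri_verts S))"
      using tri unfolding triangulation_def A_def B_def by blast
    then have "tri_verts T \<inter> tri_verts S \<noteq> {}" by auto
    then show False using x(1,2) unfolding A_def B_def by blast
  qed
  obtain T where T: "T \<in> tris D" "k \<in> tri_verts T" using tri_at by blast
  then have TA: "T \<in> A" unfolding A_def using loc[OF T(1) _ T(2)] by blast
  obtain S where S: "S \<in> tris D" "l \<in> tri_verts S" using tri_at by blast
  have "u m \<noteq> u k" if "m \<in> tri_verts S" for m using loc[OF S(1) that S(2)] ne by simp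
  then have SB: "S \<in> B" unfolding B_def using S(1) by blast
  let ?A = "\<Union>T\<in>A. tri_hull D T" and ?B = "\<Union>T\<in>B. tri_hull D T"
  have "tri_hull D T \<subseteq> ?A \<inter> mesh D" unfolding mesh_def using UN_upper[OF TA] UN_upper[OF T(1)] by (rule Int_greatest)
  then have "?A \<inter> mesh D \<noteq> {}" using hull_ne[of T] by (metis subset_empty)
  moreover have "tri_hull D S \<subseteq> ?B \<inter> mesh D" unfolding mesh_def using UN_upper[OF SB] UN_upper[OF S(1)] by (rule Int_greatest)
  then have "?B \<inter> mesh D \<noteq> {}" using hull_ne[of S] by (metis subset_empty)
  moreover have "mesh D \<subseteq> ?A \<union> ?B" unfolding mesh_def cov by blast
  moreover have "?A \<inter> ?B \<inter> mesh D = {}" unfolding disj by simp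
  ultimately have "\<exists>A B. closed A \<and> closed B \<and> mesh D \<subseteq> A \<union> B \<and> A \<inter> B \<inter> mesh D = {} \<and> A \<inter> mesh D \<noteq> {} \<and> B \<inter> mesh D \<noteq> {}"
    by (intro exI[of _ ?A] exI[of _ ?B] conjI cl)
  then show False using con unfolding connected_closed by (rule notE[rotated])
qed

lemma a_form_add_left: "a_form D (u + u') v = a_form D u v + a_form D u' v"
  unfolding a_form_time_diff
  by (simp add: time_diff_add mass_add_left stiff_add_left distrib_left sum.distrib)

lemma a_form_scale_left: "a_form D (c *\<^sub>R u) v = c * a_form D u v"
  unfolding a_form_time_diff
  by (simp add: time_diff_scale mass_scale_left stiff_scale_left distrib_left sum_distrib_left mult.left_commute)

lemma bilinear_a_form: "bilinear (a_form D)"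
proof -
  have l: "linear (\<lambda>u. a_form D u v)" for v
    by (rule linearI) (simp_all add: a_form_add_left a_form_scale_left)
  moreover have "linear (\<lambda>v. a_form D u v)" for u
    using l[of u] by (simp add: a_form_commute[of D u])
  ultimately show ?thesis by (simp add: bilinear_def)
qed

end

text \<open>The unit nodal values, one for each time layer, vertex and basis vector, span the space.\<close>

lemma Qh_finite_span:
  "\<exists>B. finite B \<and> (Qh D :: (nat \<Rightarrow> 'v::finite \<Rightarrow> 'b::euclidean_space) set) \<subseteq> span B"
proof -
  define e :: "nat \<times> 'v \<times> 'b \<Rightarrow> nat \<Rightarrow> 'v \<Rightarrow> 'b"
    where "e p l k = (if l = fst p \<and> k = fst (snd p) then snd (snd p) else 0)" for p l k
  let ?I = "{..Nt D} \<times> (UNIV :: 'v set) \<times> (Basis :: 'b set)"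
  have "u \<in> span (e ` ?I)" if u: "u \<in> Qh D" for u
  proof -
    have "u = (\<Sum>p\<in>?I. (u (fst p) (fst (snd p)) \<bullet> snd (snd p)) *\<^sub>R e p)"
    proof (intro ext)
      fix l k
      have "(\<Sum>p\<in>?I. (u (fst p) (fst (snd p)) \<bullet> snd (snd p)) *\<^sub>R e p) l k
        = (\<Sum>p\<in>?I. (u (fst p) (fst (snd p)) \<bullet> snd (snd p)) *\<^sub>R e p l k)"
        by (simp add: sum_fun_apply)
      also have "\<dots> = (\<Sum>j\<le>Nt D. \<Sum>i\<in>UNIV. \<Sum>b\<in>Basis. (u j i \<bullet> b) *\<^sub>R e (j, i, b) l k)"
        by (simp add: sum.cartesian_product case_prod_beta')
      also have "\<dots> = (\<Sum>j\<le>Nt D. \<Sum>i\<in>UNIV. if j = l then (if i = k then u j i else 0) else 0)"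
        by (intro sum.cong refl) (auto simp: e_def euclidean_representation)
      also have "\<dots> = (\<Sum>j\<le>Nt D. if j = l then u j k else 0)"
        by (intro sum.cong refl) auto
      also have "\<dots> = u l k" using u by (auto simp: Qh_def not_le)
      finally show "u l k = (\<Sum>p\<in>?I. (u (fst p) (fst (snd p)) \<bullet> snd (snd p)) *\<^sub>R e p) l k" by simp
    qed
    also have "\<dots> \<in> span (e ` ?I)" by (intro span_sum span_scale span_base) auto
    finally show ?thesis .
  qed
  then show ?thesis by (intro exI[of _ "e ` ?I"]) auto
qed

locale discretization = triangulated D for D :: "'v::finite discr" +
  assumes Nt2: "2 \<le> Nt D" and connected_mesh: "connected (mesh D)"
begin

lemma tau_pos: "0 < tau D" using Nt2 by (simp add: tau_def)

lemma wt_pos: "0 < wt D j" using tau_pos by (simp add: wt_def)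

lemma subspace_Vh: "subspace (Vh D)"
proof (rule subspaceI)
  have pl0: "pl D (0 :: 'v \<Rightarrow> real) = (\<lambda>x. 0)" by (simp add: pl_def fun_eq_iff)
  have i0: "mesh_integral D (\<lambda>x. 0) = 0" using mesh_integral_cmult[of D 0 "\<lambda>x. 0"] by simp
  show "0 \<in> Vh D" by (simp add: Vh_def Qh_def pl0 i0)
  fix u v :: "nat \<Rightarrow> 'v \<Rightarrow> real" assume uv: "u \<in> Vh D" "v \<in> Vh D"
  have "mesh_integral D (pl D ((u + v) j)) = mesh_integral D (pl D (u j)) + mesh_integral D (pl D (v j))" for j
    using mesh_integral_add[OF mesh_integrable_continuous[OF continuous_pl] mesh_integrable_continuous[OF continuous_pl], of "u j" "v j"]
    by (simp add: pl_add[abs_def])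
  then show "u + v \<in> Vh D" using uv by (simp add: Vh_def Qh_def distrib_left sum.distrib)
  fix c :: real
  have "mesh_integral D (pl D ((c *\<^sub>R u) j)) = c * mesh_integral D (pl D (u j))" for j
    using mesh_integral_cmult[of D c "pl D (u j)"] by (simp add: pl_scale[abs_def])
  then show "c *\<^sub>R u \<in> Vh D" using uv by (simp add: Vh_def Qh_def mult.left_commute sum_distrib_left[symmetric])
qed

lemma a_form_nonneg: "0 \<le> a_form D u u"
  unfolding a_form_time_diff using mass_nonneg stiff_nonneg tau_pos wt_pos
  by (intro add_nonneg_nonneg sum_nonneg mult_nonneg_nonneg) (auto intro: less_imp_le)

text \<open>Without stiffness every time layer is constant in space. The differences of successive layers are
then constants of mass zero, so that all layers are equal, and the mean value condition leaves zero
as the only possible constant.\<close>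

lemma a_form_zero_imp:
  assumes v: "v \<in> Vh D" and z: "a_form D v v = 0"
  shows "v = 0"
proof -
  have m: "0 \<le> tau D * mass D (time_diff D v j) (time_diff D v j)" for j
    using mass_nonneg tau_pos by (simp add: less_imp_le)
  have s: "0 \<le> wt D j * stiff D (v j) (v j)" for j using stiff_nonneg wt_pos by (simp add: less_imp_le)
  have "(\<Sum>j=1..Nt D. tau D * mass D (time_diff D v j) (time_diff D v j)) = 0
      \<and> (\<Sum>j\<le>Nt D. wt D j * stiff D (v j) (v j)) = 0"
    using z unfolding a_form_time_diff
    by (subst (asm) add_nonneg_eq_0_iff) (auto intro!: sum_nonneg m s)
  then have "\<forall>j\<in>{1..Nt D}. tau D * mass D (time_diff D v j) (time_diff D v j) = 0"
    and "\<forall>j\<in>{..Nt D}. wt D j * stiff D (v j) (v j) = 0"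
    using m s by (simp_all add: sum_nonneg_eq_0_iff)
  note zero = this
  have mz: "mass D (time_diff D v j) (time_diff D v j) = 0" if "1 \<le> j" "j \<le> Nt D" for j
    using bspec[OF zero(1), of j] that tau_pos by simp
  have sz: "stiff D (v j) (v j) = 0" if "j \<le> Nt D" for j
    using bspec[OF zero(2), of j] that wt_pos[of j] by simp
  define c where "c j = v j undefined" for j
  have vc: "v j = (\<lambda>i. c j)" if "j \<le> Nt D" for j
    unfolding c_def
    by (rule ext, rule locally_const_imp_const[OF connected_mesh])
       (rule stiff_zero_imp_locally_const[OF sz[OF that]])
  have step: "c j = c (j - 1)" if j: "1 \<le> j" "j \<le> Nt D" for j
  proof -
    have "time_diff D v j = (\<lambda>i. (c j - c (j - 1)) / tau D)"
      using vc[of j] vc[of "j - 1"] j by (simp add: time_diff_def)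
    then have "((c j - c (j - 1)) / tau D)\<^sup>2 * mesh_integral D (\<lambda>x. 1) = 0"
      using mz[OF j] mass_const by metis
    then show ?thesis using mesh_area_pos tau_pos by simp
  qed
  have c0: "c j = c 0" if "j \<le> Nt D" for j
    using that
  proof (induction j)
    case (Suc j)
    then show ?case using step[of "Suc j"] by simp
  qed simp
  have "0 = (\<Sum>j\<le>Nt D. wt D j * mesh_integral D (pl D (v j)))" using v by (simp add: Vh_def)
  also have "\<dots> = (\<Sum>j\<le>Nt D. wt D j * (c 0 * mesh_integral D (\<lambda>x. 1)))"
  proof (intro sum.cong refl)
    fix j assume "j \<in> {..Nt D}"
    then have "v j = (\<lambda>i. c 0)" using vc[of j] c0[of j] by simp
    then show "wt D j * mesh_integral D (pl D (v j)) = wt D j * (c 0 * mesh_integral D (\<lambda>x. 1))"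
      by (simp only: mesh_integral_pl_const)
  qed
  also have "\<dots> = (\<Sum>j\<le>Nt D. wt D j) * (c 0 * mesh_integral D (\<lambda>x. 1))" by (simp add: sum_distrib_right)
  finally have "(\<Sum>j\<le>Nt D. wt D j) * (c 0 * mesh_integral D (\<lambda>x. 1)) = 0" by simp
  moreover have "0 < (\<Sum>j\<le>Nt D. wt D j)" using wt_pos by (intro sum_pos) auto
  ultimately have "c 0 = 0" using mesh_area_pos by simp
  have "v j i = 0" for j i
    using vc[of j] c0[of j] \<open>c 0 = 0\<close> v by (cases "j \<le> Nt D") (auto simp: Vh_def Qh_def)
  then show ?thesis by (simp add: fun_eq_iff)
qed

lemma Vh_form: "inner_form (Vh D) (a_form D)"
proof
  show "subspace (Vh D)" by (rule subspace_Vh)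
  show "\<exists>B. finite B \<and> Vh D \<subseteq> span B" 
    using Qh_finite_span[of D, where 'b = real] by (auto simp: Vh_def)
  show "bilinear (a_form D)" by (rule bilinear_a_form)
  show "a_form D u v = a_form D v u" for u v by (rule a_form_commute)
  show "0 \<le> a_form D v v" for v by (rule a_form_nonneg)
  show "0 < a_form D v v" if "v \<in> Vh D" "v \<noteq> 0" for v
    using a_form_nonneg[of v] a_form_zero_imp that by (metis less_eq_real_def)
qed

lemma subspace_Xh: "subspace (Xh D)"
  by (rule subspaceI) (auto simp: Xh_def Qh_def inner_add_left)

lemma bilinear_h_inner: "bilinear (h_inner D)"
  unfolding bilinear_def
  by (intro conjI allI linearI)
     (simp_all add: h_inner_def inner_add_left inner_add_right distrib_left sum.distrib sum_distrib_left mult.left_commute)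

lemma h_inner_nonneg: "0 \<le> h_inner D z z"
  unfolding h_inner_def using wt_pos nodal_area_pos
  by (intro sum_nonneg mult_nonneg_nonneg) (auto intro: less_imp_le)

lemma h_inner_zero_imp: 
  assumes "z \<in> Qh D" "h_inner D z z = 0" shows "z = 0"
proof -
  have t: "0 \<le> wt D j * nodal_area D i * (z j i \<bullet> z j i)" for i j
    using wt_pos nodal_area_pos by (simp add: less_imp_le)
  have "\<forall>j\<in>{..Nt D}. (\<Sum>i\<in>UNIV. wt D j * nodal_area D i * (z j i \<bullet> z j i)) = 0"
    using assms(2) unfolding h_inner_def by (subst (asm) sum_nonneg_eq_0_iff) (auto intro!: sum_nonneg t)
  then have "wt D j * nodal_area D i * (z j i \<bullet> z j i) = 0" if "j \<le> Nt D" for j i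
    using that t by (auto simp: sum_nonneg_eq_0_iff)
  then have "z j i = 0" if "j \<le> Nt D" for j i
    using that wt_pos[of j] nodal_area_pos[of i] by (metis inner_eq_zero_iff less_irrefl mult_eq_0_iff)
  then have "z j i = 0" for j i using assms(1) by (cases "j \<le> Nt D") (auto simp: Qh_def)
  then show ?thesis by (simp add: fun_eq_iff)
qed

lemma Xh_form: "inner_form (Xh D) (h_inner D)"
proof
  show "subspace (Xh D)" by (rule subspace_Xh)
  show "\<exists>B. finite B \<and> Xh D \<subseteq> span B" 
    using Qh_finite_span[of D, where 'b = "real \<times> (real^3)"] by (auto simp: Xh_def)
  show "bilinear (h_inner D)" by (rule bilinear_h_inner)
  show "h_inner D u v = h_inner D v u" for u v by (simp add: h_inner_def inner_commute)
  show "0 \<le> h_inner D v v" for v by (rule h_inner_nonneg)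
  show "0 < h_inner D v v" if "v \<in> Xh D" "v \<noteq> 0" for v
    using h_inner_nonneg[of v] h_inner_zero_imp[of v] that by (auto simp: Xh_def less_le)
qed

end

section \<open>Linearity of the recovered derivatives and of the load\<close>

definition patch_values :: "'v::finite discr \<Rightarrow> 'v \<Rightarrow> ('v \<Rightarrow> real) \<Rightarrow> real^'v" where
  "patch_values D i y = (\<chi> k. if k \<in> patch D i then y k else 0)"

lemma patch_values_linear:
  "patch_values D i (u + v) = patch_values D i u + patch_values D i v"
  "patch_values D i (c *\<^sub>R u) = c *\<^sub>R patch_values D i u"
  by (simp_all add: patch_values_def vec_eq_iff)

text \<open>Rows of the design matrix outside the patch vanish, so data that are zero there turn the sum over
the patch into a Euclidean norm.\<close>

lemma ls_error_norm: "ls_error D i y c = (norm (design D i *v c - patch_values D i y))\<^sup>2"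
proof -
  have "(norm (design D i *v c - patch_values D i y))\<^sup>2 = (\<Sum>k\<in>UNIV. ((design D i *v c) $ k - patch_values D i y $ k)\<^sup>2)"
    by (simp add: norm_vec_def L2_set_def sum_nonneg)
  also have "\<dots> = (\<Sum>k\<in>UNIV. if k \<in> patch D i then (c \<bullet> monomials (planar D i (vtx D k)) - y k)\<^sup>2 else 0)"
    by (intro sum.cong refl)
       (simp add: design_def patch_values_def matrix_vector_mult_def inner_vec_def mult.commute)
  also have "\<dots> = ls_error D i y c"
    by (simp add: ls_error_def sum.If_cases)
  finally show ?thesis by simp
qed

lemma differentiable_monomial_combination:
  "(\<lambda>\<xi>. c \<bullet> monomials \<xi>) differentiable (at \<xi>0)"
proof -
  have nth: "(\<lambda>\<xi>::real^2. \<xi> $ k) differentiable (at \<xi>0)" for k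
    by (rule bounded_linear_imp_differentiable[OF bounded_linear_vec_nth])
  have "(\<lambda>\<xi>. monomials \<xi> $ k) differentiable (at \<xi>0)" for k
    unfolding monomials_def vector_def
    by (simp add: fun_upd_def if_distrib[of "\<lambda>f. f _"] cong: if_cong,
        cases "k = 1"; cases "k = 2"; cases "k = 3"; cases "k = 4"; cases "k = 5"; cases "k = 6")
       (simp_all add: differentiable_mult differentiable_power nth)
  then show ?thesis unfolding inner_vec_def by (intro differentiable_sum) (auto intro!: differentiable_mult)
qed

lemma matrix_adjoint: "(A *v x) \<bullet> y = x \<bullet> (transpose A *v (y :: real^'n))"
proof -
  have "x \<bullet> (transpose A *v y) = (y v* A) \<bullet> x" by (simp only: transpose_matrix_vector inner_commute)
  also have "\<dots> = y \<bullet> (A *v x)" by (rule dot_lmul_matrix)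
  finally show ?thesis by (simp only: inner_commute)
qed

locale recovery = discretization D for D :: "'v::finite discr" +
  assumes rank6: "\<And>i. rank (design D i) = 6" and data: "recovery_data D"
begin

definition lsq :: "'v \<Rightarrow> real^'v \<Rightarrow> real^6" where
  "lsq i y = matrix_inv (transpose (design D i) ** design D i) *v (transpose (design D i) *v y)"

lemma lsq_linear: "lsq i (y + y') = lsq i y + lsq i y'" "lsq i (c *\<^sub>R y) = c *\<^sub>R lsq i y"
  by (simp_all add: lsq_def matrix_vector_right_distrib matrix_vector_mult_scaleR)

lemma design_inj: "design D i *v c = 0 \<Longrightarrow> c = 0"
proof -
  assume a: "design D i *v c = 0"
  have "rank (design D i) = CARD(6)" using rank6 by simp
  then have "inj ((*v) (design D i))" by (simp only: full_rank_injective)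
  then show "c = 0" using a by (metis injD matrix_vector_mult_0_right)
qed

lemma lsq_normal: "transpose (design D i) *v (design D i *v lsq i y - y) = 0"
proof -
  let ?A = "design D i" let ?N = "transpose ?A ** ?A"
  have "inj ((*v) ?N)"
    unfolding linear_injective_0[OF matrix_vector_mul_linear]
  proof (intro allI impI)
    fix c assume "?N *v c = 0"
    then have "transpose ?A *v (?A *v c) = 0" by (simp add: matrix_vector_mul_assoc)
    then have "(?A *v c) \<bullet> (?A *v c) = 0" by (simp only: matrix_adjoint inner_zero_right)
    then show "c = 0" using design_inj by simp
  qed
  then have "invertible ?N" by (metis invertible_left_inverse matrix_left_invertible_injective)
  then have "?N ** matrix_inv ?N = mat 1"
    unfolding invertible_def matrix_inv_def by (rule someI_ex[THEN conjunct1])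
  then have "?N *v lsq i y = transpose ?A *v y"
    by (simp add: lsq_def matrix_vector_mul_assoc)
  then show ?thesis by (simp add: matrix_vector_mult_diff_distrib matrix_vector_mul_assoc)
qed

text \<open>By the normal equations the residual at \<open>lsq\<close> is orthogonal to the range of the design matrix, so
Pythagoras' theorem applies; injectivity of the matrix makes the minimizer unique.\<close>

lemma lsq_minimizer: "(THE c. \<forall>c'. ls_error D i y c \<le> ls_error D i y c') = lsq i (patch_values D i y)"
proof -
  let ?A = "design D i" let ?y = "patch_values D i y" let ?c = "lsq i ?y"
  have pyth: "ls_error D i y c = (norm (?A *v (c - ?c)))\<^sup>2 + ls_error D i y ?c" for c
  proof -
    have o: "(?A *v (c - ?c)) \<bullet> (?A *v ?c - ?y) = 0"
      by (simp only: matrix_adjoint lsq_normal inner_zero_right)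
    have "?A *v c - ?y = ?A *v (c - ?c) + (?A *v ?c - ?y)" by (simp add: matrix_vector_mult_diff_distrib)
    then have "ls_error D i y c = (norm (?A *v (c - ?c) + (?A *v ?c - ?y)))\<^sup>2" by (simp only: ls_error_norm)
    also have "\<dots> = (norm (?A *v (c - ?c)))\<^sup>2 + ls_error D i y ?c" unfolding norm_add_sq o ls_error_norm by simp
    finally show ?thesis .
  qed
  show ?thesis
  proof (rule the_equality)
    show "\<forall>c'. ls_error D i y ?c \<le> ls_error D i y c'"
    proof
      fix c'
      show "ls_error D i y ?c \<le> ls_error D i y c'"
        using pyth[of c'] zero_le_power2[of "norm (?A *v (c' - ?c))"] by linarith
    qed
    fix c assume "\<forall>c'. ls_error D i y c \<le> ls_error D i y c'"
    then have "ls_error D i y c \<le> ls_error D i y ?c" by blast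
    then have "(norm (?A *v (c - ?c)))\<^sup>2 \<le> 0" using pyth[of c] by linarith
    then have "?A *v (c - ?c) = 0" by simp
    then show "c = ?c" using design_inj[of i "c - ?c"] by simp
  qed
qed

lemma quad_fit_eq: "quad_fit D i y = (\<lambda>\<xi>. lsq i (patch_values D i y) \<bullet> monomials \<xi>)"
  unfolding quad_fit_def lsq_minimizer ..

lemma quad_fit_derivative_linear:
  "frechet_derivative (quad_fit D i (u + v)) (at 0) h
     = frechet_derivative (quad_fit D i u) (at 0) h + frechet_derivative (quad_fit D i v) (at 0) h"
  "frechet_derivative (quad_fit D i (c *\<^sub>R u)) (at 0) h = c * frechet_derivative (quad_fit D i u) (at 0) h"
proof -
  have d: "(quad_fit D i w has_derivative frechet_derivative (quad_fit D i w) (at 0)) (at 0)" for w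
    using differentiable_monomial_combination unfolding quad_fit_eq by (simp add: frechet_derivative_works)
  have "quad_fit D i (u + v) = (\<lambda>\<xi>. quad_fit D i u \<xi> + quad_fit D i v \<xi>)"
    by (simp add: quad_fit_eq patch_values_linear lsq_linear inner_add_left)
  then show "frechet_derivative (quad_fit D i (u + v)) (at 0) h
     = frechet_derivative (quad_fit D i u) (at 0) h + frechet_derivative (quad_fit D i v) (at 0) h"
    by (simp only: frechet_derivative_at[OF has_derivative_add[OF d[of u] d[of v]], symmetric])
  have "quad_fit D i (c *\<^sub>R u) = (\<lambda>\<xi>. c * quad_fit D i u \<xi>)"
    by (simp add: quad_fit_eq patch_values_linear lsq_linear)
  then show "frechet_derivative (quad_fit D i (c *\<^sub>R u)) (at 0) h = c * frechet_derivative (quad_fit D i u) (at 0) h"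
    by (simp only: frechet_derivative_at[OF has_derivative_mult_right[OF d[of u], of c], symmetric])
qed

lemma Gh_linear: "Gh D (u + v) i = Gh D u i + Gh D v i" "Gh D (c *\<^sub>R u) i = c *\<^sub>R Gh D u i"
proof -
  have "(\<chi> a. frechet_derivative (quad_fit D i (u + v)) (at 0) (axis a 1))
    = (\<chi> a. frechet_derivative (quad_fit D i u) (at 0) (axis a 1)) + (\<chi> a. frechet_derivative (quad_fit D i v) (at 0) (axis a 1))"
    by (simp add: vec_eq_iff quad_fit_derivative_linear)
  then show "Gh D (u + v) i = Gh D u i + Gh D v i"
    unfolding Gh_def by (simp only: matrix_vector_right_distrib)
  have "(\<chi> a. frechet_derivative (quad_fit D i (c *\<^sub>R u)) (at 0) (axis a 1))
    = c *\<^sub>R (\<chi> a. frechet_derivative (quad_fit D i u) (at 0) (axis a 1))"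
    by (simp add: vec_eq_iff quad_fit_derivative_linear)
  then show "Gh D (c *\<^sub>R u) i = c *\<^sub>R Gh D u i"
    unfolding Gh_def by (simp only: matrix_vector_mult_scaleR)
qed

lemma Gtau_linear: "Gtau D (u + v) j i = Gtau D u j i + Gtau D v j i" "Gtau D (c *\<^sub>R u) j i = c * Gtau D u j i"
  using tau_pos by (simp_all add: Gtau_def field_simps)

lemma GGh_add: "GGh D (u + v) = GGh D u + GGh D v"
  and GGh_scale: "GGh D (c *\<^sub>R u) = c *\<^sub>R GGh D u"
  by (simp_all add: GGh_def fun_eq_iff Gh_linear Gtau_linear)

lemma Gh_div_linear: "Gh_div D (\<lambda>k. m k + m' k) i = Gh_div D m i + Gh_div D m' i"
  "Gh_div D (\<lambda>k. c *\<^sub>R m k) i = c * Gh_div D m i"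
proof -
  have 1: "(\<lambda>k. (m k + m' k) $ d) = (\<lambda>k. m k $ d) + (\<lambda>k. m' k $ d)" for d by (simp add: fun_eq_iff)
  have 2: "(\<lambda>k. (c *\<^sub>R m k) $ d) = c *\<^sub>R (\<lambda>k. m k $ d)" for d by (simp add: fun_eq_iff)
  show "Gh_div D (\<lambda>k. m k + m' k) i = Gh_div D m i + Gh_div D m' i"
    unfolding Gh_div_def 1 Gh_linear by (simp add: sum.distrib)
  show "Gh_div D (\<lambda>k. c *\<^sub>R m k) i = c * Gh_div D m i"
    unfolding Gh_div_def 2 Gh_linear by (simp add: sum_distrib_left)
qed

text \<open>The nodal density of the load without the prescribed endpoint densities, hence linear in \<open>z\<close>.\<close>

definition load_density :: "'v dfield \<Rightarrow> nat \<Rightarrow> 'v \<Rightarrow> real" where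
  "load_density z j = (\<lambda>i. Gtau D (\<lambda>l k. fst (z l k)) j i + Gh_div D (\<lambda>k. snd (z j k)) i +
     (if j = 0 then 2 * fst (z 0 i) / tau D else if j = Nt D then - 2 * fst (z (Nt D) i) / tau D else 0))"

definition load_lin :: "'v dfield \<Rightarrow> (nat \<Rightarrow> 'v \<Rightarrow> real) \<Rightarrow> real" where
  "load_lin z w = (\<Sum>j\<le>Nt D. wt D j * mass D (load_density z j) (w j))"

lemma load_density_linear:
  "load_density (z + z') j = load_density z j + load_density z' j"
  "load_density (c *\<^sub>R z) j = c *\<^sub>R load_density z j"
proof -
  have 1: "(\<lambda>l k. fst ((z + z') l k)) = (\<lambda>l k. fst (z l k)) + (\<lambda>l k. fst (z' l k))" by (simp add: fun_eq_iff)
  have 2: "(\<lambda>l k. fst ((c *\<^sub>R z) l k)) = c *\<^sub>R (\<lambda>l k. fst (z l k))" by (simp add: fun_eq_iff)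
  show "load_density (z + z') j = load_density z j + load_density z' j"
    unfolding load_density_def 1 using tau_pos
    by (simp add: fun_eq_iff Gtau_linear Gh_div_linear field_simps)
  show "load_density (c *\<^sub>R z) j = c *\<^sub>R load_density z j"
    unfolding load_density_def 2 using tau_pos
    by (simp add: fun_eq_iff Gtau_linear Gh_div_linear field_simps)
qed

lemma load_lin_add_left: "load_lin (z + z') w = load_lin z w + load_lin z' w"
  and load_lin_scale_left: "load_lin (c *\<^sub>R z) w = c * load_lin z w"
  by (simp_all add: load_lin_def load_density_linear mass_add_left mass_scale_left distrib_left
      sum.distrib sum_distrib_left mult.left_commute)

lemma linear_load_lin: "linear (load_lin z)"
  by (rule linearI) (simp_all add: load_lin_def mass_add_right mass_scale_right distrib_left
      sum.distrib sum_distrib_left mult.left_commute)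

lemma linear_load: "linear (load D z)"
  by (rule linearI) (simp_all add: load_def mass_add_right mass_scale_right distrib_left
      sum.distrib sum_distrib_left mult.left_commute)

text \<open>The load is affine in the state: the endpoint densities enter through \<open>b_load\<close> only.\<close>

lemma load_eq: "load D z w = load D (\<lambda>j i. 0) w + load_lin z w"
proof -
  define r where "r z j = (\<lambda>i. Gtau D (\<lambda>l k. fst (z l k)) j i + Gh_div D (\<lambda>k. snd (z j k)) i + b_load D z j i)" for z :: "'v dfield" and j
  have g0: "Gh_div D (\<lambda>k. 0) i = 0" for i using Gh_div_linear(2)[of 0 "\<lambda>k. 0" i] by simp
  have t0: "Gtau D (\<lambda>l k. 0) j i = 0" for i j by (simp add: Gtau_def)
  have ld: "load D z w = (\<Sum>j\<le>Nt D. wt D j * mass D (r z j) (w j))" for z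
    by (simp only: load_def r_def)
  have "r z j = r (\<lambda>j i. 0) j + load_density z j" for j
    using Nt2 tau_pos by (simp add: r_def load_density_def b_load_def fun_eq_iff g0 t0 field_simps)
  then have "load D z w = (\<Sum>j\<le>Nt D. wt D j * mass D (r (\<lambda>j i. 0) j + load_density z j) (w j))"
    by (simp only: ld)
  then show ?thesis
    unfolding ld[of "\<lambda>j i. 0"] load_lin_def by (simp add: mass_add_left distrib_left sum.distrib)
qed

end

section \<open>The lift to the surface\<close>

locale paired = continuous_problem P \<nu> + recovery D
  for P :: problem and \<nu> and D :: "'v::finite discr" +
  fixes Cp :: real
  assumes regular: "regular_corr P D Cp"
begin

lemma corr_bij: "bij_betw (corr D) (mesh D) (surf P)" and corr_cont: "continuous_on (mesh D) (corr D)"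
  using regular by (auto simp: regular_corr_def)

lemma corr_in: "x \<in> mesh D \<Longrightarrow> corr D x \<in> surf P"
  using corr_bij by (auto simp: bij_betw_def)

lemma compact_mesh: "compact (mesh D)"
  unfolding mesh_def tri_hull_eq
  by (intro compact_UN compact_continuous_image continuous_tri_map compact_ref_tri) simp

definition corr_inv :: "real^3 \<Rightarrow> real^3" where "corr_inv = inv_into (mesh D) (corr D)"

lemma corr_inv_in: "x \<in> surf P \<Longrightarrow> corr_inv x \<in> mesh D"
  using corr_bij by (auto simp: corr_inv_def bij_betw_def inv_into_into)

lemma corr_inv_cont: "continuous_on (surf P) corr_inv"
proof -
  have "continuous_on (corr D ` mesh D) corr_inv"
    by (rule continuous_on_inv[OF corr_cont compact_mesh])
       (use corr_bij in \<open>simp add: corr_inv_def bij_betw_def\<close>)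
  then show ?thesis using corr_bij by (simp add: bij_betw_def)
qed

lemma lift_eq:
  "q \<in> Qclosed P \<Longrightarrow> lift P D z q = (fst (Qh_eval D z (fst q) (corr_inv (snd q))),
     tproj \<nu> (snd q) (snd (Qh_eval D z (fst q) (corr_inv (snd q)))))"
  by (cases q) (simp add: lift_def Let_def corr_inv_def Qclosed_def tangent_proj_eq)

lemma Qh_eval_add: "Qh_eval D (u + v) t x = Qh_eval D u t x + Qh_eval D v t x"
  and Qh_eval_scale: "Qh_eval D (c *\<^sub>R u) t x = c *\<^sub>R Qh_eval D u t x"
  by (simp_all add: Qh_eval_def pl_add pl_scale scaleR_add_right sum.distrib scaleR_sum_right mult.commute)

lemma lift_add: "q \<in> Qclosed P \<Longrightarrow> lift P D (u + v) q = lift P D u q + lift P D v q"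
  and lift_scale: "q \<in> Qclosed P \<Longrightarrow> lift P D (c *\<^sub>R u) q = c *\<^sub>R lift P D u q"
  by (simp_all add: lift_eq Qh_eval_add Qh_eval_scale linear_add[OF tproj_linear] linear_cmul[OF tproj_linear])

lemma lift_diff: 
  assumes "q \<in> Qclosed P" shows "lift P D (\<lambda>j i. u j i - v j i) q = lift P D u q - lift P D v q"
proof -
  have e: "(\<lambda>j i. u j i - v j i) = u + (-1) *\<^sub>R v" by (simp add: fun_eq_iff)
  show ?thesis unfolding e lift_add[OF assms] lift_scale[OF assms] by simp
qed

text \<open>The inverse of \<open>p\<^sub>h\<close> is continuous, since \<open>p\<^sub>h\<close> is a continuous bijection of a compact set.\<close>

lemma lift_continuous: "continuous_on (Qclosed P) (lift P D z)"
proof -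
  have ci: "continuous_on (Qclosed P) (\<lambda>q. corr_inv (snd q))"
    by (rule continuous_on_compose2[OF corr_inv_cont]) (auto simp: Qclosed_def intro!: continuous_intros)
  have "continuous_on (Qclosed P) (\<lambda>q. pl D (z j) (corr_inv (snd q)))" for j
    by (rule continuous_on_compose2[OF continuous_pl ci]) (auto simp: Qclosed_def corr_inv_in)
  moreover have "continuous_on (Qclosed P) (\<lambda>q. time_hat D j (fst q))" for j
    unfolding time_hat_def using tau_pos by (intro continuous_intros) auto
  ultimately have e: "continuous_on (Qclosed P) (\<lambda>q. Qh_eval D z (fst q) (corr_inv (snd q)))"
    unfolding Qh_eval_def by (intro continuous_on_sum continuous_on_scaleR)
  have "continuous_on (Qclosed P) (\<lambda>q. (fst (Qh_eval D z (fst q) (corr_inv (snd q))),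
     tproj \<nu> (snd q) (snd (Qh_eval D z (fst q) (corr_inv (snd q))))))"
    by (intro continuous_on_Pair continuous_on_tproj continuous_on_fst continuous_on_snd e continuous_on_id)
       (auto simp: Qclosed_def)
  then show ?thesis by (rule continuous_on_eq) (simp add: lift_eq)
qed

lemma lift_L2: "L2 (Qmeas P) (lift P D z)"
  by (rule continuous_L2_Q[OF lift_continuous])

lemma Hnorm_cong: "(\<And>q. q \<in> Qclosed P \<Longrightarrow> f q = g q) \<Longrightarrow> Hnorm P f = Hnorm P g"
  unfolding L2_norm_def using space_Q_subset
  by (intro arg_cong[where f = sqrt] Bochner_Integration.integral_cong refl) auto

lemma Hnorm_lift_diff: "Hnorm P (\<lambda>q. lift P D u q - lift P D v q) = Hnorm P (lift P D (\<lambda>j i. u j i - v j i))"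
  by (rule Hnorm_cong) (simp add: lift_diff)

lemma Hnorm_lift_add: "Hnorm P (lift P D (u + v)) \<le> Hnorm P (lift P D u) + Hnorm P (lift P D v)"
proof -
  have "Hnorm P (lift P D (u + v)) = Hnorm P (\<lambda>q. lift P D u q + lift P D v q)"
    by (rule Hnorm_cong) (rule lift_add)
  then show ?thesis using L2_minkowski[OF lift_L2 lift_L2, of u v] by simp
qed

lemma Hnorm_lift_scale: "Hnorm P (lift P D (c *\<^sub>R u)) = \<bar>c\<bar> * Hnorm P (lift P D u)"
  unfolding L2_norm_scale[symmetric] by (rule Hnorm_cong) (rule lift_scale)

section \<open>Pull-back to the reference triangle\<close>

definition chart_map :: "'v \<times> 'v \<times> 'v \<Rightarrow> real^2 \<Rightarrow> real^3" where
  "chart_map T u = corr D (tri_map D T u)"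

lemma chart_map_in: "T \<in> tris D \<Longrightarrow> u \<in> ref_tri \<Longrightarrow> chart_map T u \<in> surf P"
  unfolding chart_map_def by (intro corr_in tri_map_in_mesh)

lemma chart_map_cont: "T \<in> tris D \<Longrightarrow> continuous_on ref_tri (chart_map T)"
  unfolding chart_map_def
  by (rule continuous_on_compose2[OF corr_cont continuous_tri_map]) (auto intro: tri_map_in_mesh)

lemma tri_map_inj:
  assumes T: "T \<in> tris D" shows "inj_on (tri_map D T) S"
proof (rule inj_onI)
  obtain a b c where abc: "T = (a, b, c)" by (cases T)
  fix u v assume "tri_map D T u = tri_map D T v"
  then have "(u $ 1 - v $ 1) *\<^sub>R (vtx D b - vtx D a) + (u $ 2 - v $ 2) *\<^sub>R (vtx D c - vtx D a) = 0"
    by (simp add: abc scaleR_diff_left algebra_simps)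
  from cross_indep[OF tri_cross[OF T[unfolded abc]] this] show "u = v" by (simp add: vec_eq_iff forall_2)
qed

text \<open>On the open reference triangle \<open>p\<^sub>h\<close> composed with the affine map is a \<open>C\<^sup>1\<close> chart of the surface, and
so the area formula applies to it. Its area element extends continuously to the closed triangle
without a zero, because \<open>p\<^sub>h\<close> is regular there; \<open>m\<close> is the minimum.\<close>

lemma chart_map_regular:
  assumes T: "T \<in> tris D"
  shows "\<exists>m>0. regular_param 1 (surf P) ref_interior (chart_map T) \<and>
     (\<forall>u\<in>ref_interior. m \<le> norm (area_normal (chart_map T) u)) \<and>
     (\<lambda>u. indicator ref_interior u * norm (area_normal (chart_map T) u)) \<in> borel_measurable borel"
proof -
  obtain a b c where abc: "T = (a, b, c)" by (cases T)
  let ?e1 = "vtx D b - vtx D a" and ?e2 = "vtx D c - vtx D a"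
  let ?X = "chart_map T"
  from regular T obtain p' where p':
    "\<forall>x\<in>tri_hull D T. (corr D has_derivative p' x) (at x within tri_hull D T)"
    "\<forall>v. continuous_on (tri_hull D T) (\<lambda>x. p' x v)"
    "\<forall>x\<in>tri_hull D T. \<forall>v\<in>tri_span D T. norm (p' x v) \<le> Cp * norm v \<and> norm v \<le> Cp * norm (p' x v)"
    unfolding regular_corr_def by blast
  let ?l = "\<lambda>h::real^2. (h $ 1) *\<^sub>R ?e1 + (h $ 2) *\<^sub>R ?e2"
  let ?f' = "\<lambda>u h. p' (tri_map D T u) (?l h)"
  have tm: "tri_map D T ` ref_tri = tri_hull D T" by (simp add: tri_hull_eq)
  have hull: "tri_map D T u \<in> tri_hull D T" if "u \<in> ref_tri" for u by (rule tri_map_ref[OF that])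
  have dt: "(tri_map D T has_derivative ?l) (at u within S)" for u S
  proof -
    have nth: "((\<lambda>u::real^2. u $ k) has_derivative (\<lambda>h. h $ k)) (at u within S)" for k
      by (rule bounded_linear_imp_has_derivative[OF bounded_linear_vec_nth])
    have "((\<lambda>u. (u $ 1) *\<^sub>R ?e1 + (u $ 2) *\<^sub>R ?e2) has_derivative ?l) (at u within S)"
      by (intro has_derivative_add has_derivative_scaleR_left nth)
    from has_derivative_add_const[OF this, of "vtx D a"]
    have "((\<lambda>u. (u $ 1) *\<^sub>R ?e1 + (u $ 2) *\<^sub>R ?e2 + vtx D a) has_derivative ?l) (at u within S)" .
    moreover have "tri_map D T = (\<lambda>u. (u $ 1) *\<^sub>R ?e1 + (u $ 2) *\<^sub>R ?e2 + vtx D a)"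
      by (simp add: fun_eq_iff abc add.commute add.left_commute)
    ultimately show ?thesis by simp
  qed
  have der: "(?X has_derivative ?f' u) (at u)" if u: "u \<in> ref_interior" for u
  proof -
    have ur: "u \<in> ref_tri" using u ref_interior_subset by blast
    have "(corr D has_derivative p' (tri_map D T u)) (at (tri_map D T u) within tri_map D T ` ref_tri)"
      using p'(1) hull[OF ur] unfolding tm by blast
    from has_derivative_in_compose[OF dt this]
    have "(?X has_derivative ?f' u) (at u within ref_tri)" by (simp add: chart_map_def[abs_def])
    then have "(?X has_derivative ?f' u) (at u within ref_interior)"
      by (rule has_derivative_subset[OF _ ref_interior_subset])
    then show ?thesis by (simp only: at_within_open[OF u open_ref_interior])
  qed
  have lin: "linear (p' x)" if "x \<in> tri_hull D T" for x
    by (rule has_derivative_linear[OF bspec[OF p'(1) that]])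
  have n0: "cross3 (p' x ?e1) (p' x ?e2) \<noteq> 0" if x: "x \<in> tri_hull D T" for x
  proof
    assume "cross3 (p' x ?e1) (p' x ?e2) = 0"
    then have "collinear {0, p' x ?e1, p' x ?e2}" by (simp add: cross_eq_0)
    then have "\<exists>\<alpha> \<beta>. (\<alpha> \<noteq> 0 \<or> \<beta> \<noteq> 0) \<and> \<alpha> *\<^sub>R p' x ?e1 + \<beta> *\<^sub>R p' x ?e2 = 0"
      unfolding collinear_lemma
    proof (elim disjE exE)
      assume "p' x ?e1 = 0" then show ?thesis by (intro exI[of _ 1] exI[of _ 0]) simp
    next
      assume "p' x ?e2 = 0" then show ?thesis by (intro exI[of _ 0] exI[of _ 1]) simp
    next
      fix k assume "p' x ?e2 = k *\<^sub>R p' x ?e1"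
      then show ?thesis by (intro exI[of _ "- k"] exI[of _ 1]) simp
    qed
    then obtain \<alpha> \<beta> where ab: "\<alpha> \<noteq> 0 \<or> \<beta> \<noteq> 0" "\<alpha> *\<^sub>R p' x ?e1 + \<beta> *\<^sub>R p' x ?e2 = 0" by blast
    let ?v = "\<alpha> *\<^sub>R ?e1 + \<beta> *\<^sub>R ?e2"
    have "?v \<in> tri_span D T" unfolding abc tri_span.simps by (intro span_add span_scale span_base) auto
    then have "norm ?v \<le> Cp * norm (p' x ?v)" using bspec[OF bspec[OF p'(3) x]] by blast
    moreover have "p' x ?v = 0" using ab(2) by (simp only: linear_add[OF lin[OF x]] linear_cmul[OF lin[OF x]])
    ultimately have "?v = 0" by simp
    then show False using cross_indep[OF tri_cross[OF T[unfolded abc]]] ab(1) by blast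
  qed
  let ?n = "\<lambda>u. norm (cross3 (p' (tri_map D T u) ?e1) (p' (tri_map D T u) ?e2))"
  have cp: "continuous_on ref_tri (\<lambda>u. p' (tri_map D T u) v)" for v
    by (rule continuous_on_compose2[OF _ continuous_tri_map]) (use p'(2) hull in auto)
  have cn: "continuous_on ref_tri ?n" by (intro continuous_on_norm continuous_on_cross cp)
  have "ref_tri \<noteq> {}" using ref_interior_nonempty ref_interior_subset by blast
  then obtain u0 where u0: "u0 \<in> ref_tri" "\<forall>u\<in>ref_tri. ?n u0 \<le> ?n u"
    using continuous_attains_inf[OF compact_ref_tri _ cn] by blast
  have pos: "0 < ?n u0" using n0[OF hull[OF u0(1)]] by simp
  have an: "area_normal ?X u = cross3 (p' (tri_map D T u) ?e1) (p' (tri_map D T u) ?e2)" if "u \<in> ref_interior" for u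
    by (simp add: area_normal_def frechet_derivative_at[OF der[OF that], symmetric] axis_def)
  have "regular_param 1 (surf P) ref_interior ?X"
    unfolding regular_param_def
  proof (intro conjI ballI)
    show "Ck 1 ?X ref_interior"
      unfolding One_nat_def Ck.simps
    proof (intro exI[of _ ?f'] conjI ballI allI)
      show "(?X has_derivative ?f' u) (at u)" if "u \<in> ref_interior" for u by (rule der[OF that])
      show "continuous_on ref_interior (\<lambda>u. ?f' u h)" for h
        by (rule continuous_on_subset[OF cp ref_interior_subset])
    qed
    have "inj_on (corr D) (tri_map D T ` ref_tri)"
      using corr_bij tri_map_in_mesh[OF T] by (auto simp: bij_betw_def intro: inj_on_subset)
    then have "inj_on (corr D \<circ> tri_map D T) ref_tri" by (rule comp_inj_on[OF tri_map_inj[OF T]])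
    then show "inj_on ?X ref_interior"
      using ref_interior_subset by (auto simp: chart_map_def[abs_def] comp_def intro: inj_on_subset)
    show "?X ` ref_interior \<subseteq> surf P" using chart_map_in[OF T] ref_interior_subset by blast
    show "area_normal ?X u \<noteq> 0" if "u \<in> ref_interior" for u
      using an[OF that] n0[OF hull] that ref_interior_subset by auto
  qed (rule open_ref_interior)
  moreover have "\<forall>u\<in>ref_interior. ?n u0 \<le> norm (area_normal ?X u)"
    using u0(2) an ref_interior_subset by auto
  moreover have "(\<lambda>u. indicator ref_interior u * norm (area_normal ?X u)) \<in> borel_measurable borel"
  proof -
    have "(\<lambda>u. indicator ref_interior u *\<^sub>R ?n u) \<in> borel_measurable borel"
      by (intro borel_measurable_continuous_on_indicator continuous_on_subset[OF cn ref_interior_subset])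
         (use open_ref_interior in auto)
    moreover have "(\<lambda>u. indicator ref_interior u * norm (area_normal ?X u)) = (\<lambda>u. indicator ref_interior u *\<^sub>R ?n u)"
      using an by (auto simp: fun_eq_iff indicator_def)
    ultimately show ?thesis by simp
  qed
  ultimately show ?thesis using pos by blast
qed

lemma ref_boundary_null: "AE u in lborel. u \<in> ref_tri \<longrightarrow> u \<in> ref_interior"
proof -
  \<comment> \<open>The boundary lies on three lines, which are null sets.\<close>
  have hyper: "AE u in lborel. u \<notin> {u::real^2. w \<bullet> u = \<beta>}" if "w \<noteq> 0" for w \<beta>
  proof -
    have "negligible {u::real^2. w \<bullet> u = \<beta>}" by (rule negligible_hyperplane) (use that in simp)
    moreover have "{u::real^2. w \<bullet> u = \<beta>} \<in> sets borel" by (intro borel_closed closed_hyperplane)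
    ultimately have "{u::real^2. w \<bullet> u = \<beta>} \<in> null_sets lborel"
      by (simp add: negligible_iff_null_sets null_sets_completion_iff)
    then show ?thesis by (rule AE_not_in)
  qed
  have "AE u in lborel. (u::real^2) \<notin> {u. axis 1 1 \<bullet> u = 0}" "AE u in lborel. (u::real^2) \<notin> {u. axis 2 1 \<bullet> u = 0}"
    "AE u in lborel. (u::real^2) \<notin> {u. (axis 1 1 + axis 2 1) \<bullet> u = 1}"
    by (rule hyper, simp add: vec_eq_iff axis_def forall_2)+
  then show ?thesis
    by eventually_elim (auto simp: ref_tri_def ref_interior_def inner_axis' inner_add_left)
qed

text \<open>By the area formula the chart carries the measure with density \<open>g\<close>, the area element, to a measure
below \<open>\<sigma>\<close>. Since \<open>g\<close> is at least \<open>m > 0\<close>, the integral of \<open>|f \<circ> X|\<close> is at most \<open>1/m\<close> times that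
of \<open>|f|\<close>. The endpoint densities of the continuous problem, which are known only up to null sets and
need not be bounded, become integrable on the mesh in this way.\<close>

lemma pullback_integrable:
  fixes f :: "real^3 \<Rightarrow> real"
  assumes T: "T \<in> tris D" and f: "integrable \<sigma> f"
  shows "set_integrable lborel ref_tri (\<lambda>u. f (chart_map T u))"
proof -
  let ?X = "chart_map T"
  obtain m where m: "m > 0" "regular_param 1 (surf P) ref_interior ?X"
     "\<forall>u\<in>ref_interior. m \<le> norm (area_normal ?X u)"
     "(\<lambda>u. indicator ref_interior u * norm (area_normal ?X u)) \<in> borel_measurable borel"
    using chart_map_regular[OF T] by blast
  define g where "g u = indicator ref_interior u * norm (area_normal ?X u)" for u
  define L where "L = restrict_space lborel ref_tri"
  have setsL: "sets L = sets (restrict_space borel ref_tri)" unfolding L_def by (rule sets_restrict_space_cong) simp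
  have spL: "space L = ref_tri" by (simp add: L_def space_restrict_space)
  have fm: "f \<in> borel_measurable \<sigma>" using f by auto
  have XM: "?X \<in> measurable L \<sigma>"
  proof -
    have "?X \<in> measurable (restrict_space borel ref_tri) borel"
      by (rule borel_measurable_continuous_on_restrict[OF chart_map_cont[OF T]])
    then have "?X \<in> measurable (restrict_space borel ref_tri) (restrict_space borel (surf P))"
      by (rule measurable_restrict_space2[rotated]) (use chart_map_in[OF T] in \<open>auto simp: space_restrict_space\<close>)
    then show ?thesis by (subst measurable_cong_sets[OF setsL sets_area])
  qed
  have gL: "g \<in> borel_measurable L"
    unfolding L_def by (rule measurable_restrict_space1) (use m(4) in \<open>simp add: g_def[abs_def]\<close>)
  define \<mu> where "\<mu> = Nonnegative_Lebesgue_Integration.density L (\<lambda>u. ennreal (g u))"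
  have XM': "?X \<in> measurable \<mu> \<sigma>" using XM by (simp add: \<mu>_def)
  have le: "distr \<mu> \<sigma> ?X \<le> \<sigma>"
  proof (subst le_measure, simp, intro ballI)
    fix B assume "B \<in> sets (distr \<mu> \<sigma> ?X)"
    then have B: "B \<in> sets \<sigma>" by simp
    let ?A = "?X -` B \<inter> ref_tri"
    have A: "?A \<in> sets L" using measurable_sets[OF XM B] by (simp add: spL)
    then have Ab: "?A \<in> sets borel" 
      using ref_tri_sets by (simp add: setsL sets_restrict_space_iff)
    have "emeasure (distr \<mu> \<sigma> ?X) B = emeasure \<mu> ?A"
      using emeasure_distr[OF XM' B] by (simp add: \<mu>_def spL)
    also have "\<dots> = (\<integral>\<^sup>+u. ennreal (g u) * indicator ?A u \<partial>L)"
      unfolding \<mu>_def by (rule emeasure_density) (use gL A in auto)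
    also have "\<dots> = (\<integral>\<^sup>+u. ennreal (g u) * indicator ?A u * indicator ref_tri u \<partial>lborel)"
      unfolding L_def using ref_tri_sets by (simp add: nn_integral_restrict_space)
    also have "\<dots> = (\<integral>\<^sup>+u\<in>?A \<inter> ref_interior. ennreal (norm (area_normal ?X u)) \<partial>lborel)"
      by (intro nn_integral_cong) (auto simp: g_def indicator_def)
    also have "\<dots> = emeasure \<sigma> (?X ` (?A \<inter> ref_interior))"
      by (rule area[unfolded area_measure_def, THEN conjunct2, THEN conjunct2, rule_format,
            OF m(2) _ Int_lower2, symmetric])
         (intro sets.Int Ab borel_open open_ref_interior)
    also have "\<dots> \<le> emeasure \<sigma> B" by (rule emeasure_mono) (use B in auto)
    finally show "emeasure (distr \<mu> \<sigma> ?X) B \<le> emeasure \<sigma> B" .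
  qed
  let ?I = "\<integral>\<^sup>+u. ennreal (norm (f (?X u))) \<partial>L"
  have fX: "(\<lambda>u. f (?X u)) \<in> borel_measurable L" by (rule measurable_compose[OF XM fm])
  have "ennreal m * ?I = (\<integral>\<^sup>+u. ennreal m * ennreal (norm (f (?X u))) \<partial>L)"
    using fX by (intro nn_integral_cmult[symmetric]) auto
  also have "\<dots> \<le> (\<integral>\<^sup>+u. ennreal (g u) * ennreal (norm (f (?X u))) \<partial>L)"
  proof (rule nn_integral_mono_AE)
    have "AE u in L. u \<in> ref_interior"
      unfolding L_def using ref_boundary_null ref_tri_sets by (simp add: AE_restrict_space_iff)
    then show "AE u in L. ennreal m * ennreal (norm (f (?X u))) \<le> ennreal (g u) * ennreal (norm (f (?X u)))"
    proof eventually_elim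
      case (elim u)
      then have "m \<le> g u" using m(3) by (simp add: g_def)
      then show ?case by (intro mult_right_mono ennreal_leI) auto
    qed
  qed
  also have "\<dots> = (\<integral>\<^sup>+u. ennreal (norm (f (?X u))) \<partial>\<mu>)"
    unfolding \<mu>_def using gL fX by (subst nn_integral_density) auto
  also have "\<dots> = (\<integral>\<^sup>+x. ennreal (norm (f x)) \<partial>distr \<mu> \<sigma> ?X)"
    using XM' fm by (subst nn_integral_distr) auto
  also have "\<dots> \<le> (\<integral>\<^sup>+x. ennreal (norm (f x)) \<partial>\<sigma>)"
    by (rule nn_integral_mono_measure[OF _ le]) simp
  also have "\<dots> < \<infinity>" using f by (simp add: integrable_iff_bounded)
  finally have "?I < \<infinity>" using m(1) by (auto simp: ennreal_mult_less_top)
  then have "integrable L (\<lambda>u. f (?X u))" using fX by (simp add: integrable_iff_bounded)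
  then show ?thesis
    unfolding L_def set_integrable_def using ref_tri_sets by (subst (asm) integrable_restrict_space) auto
qed

lemma mesh_integrable_comp_corr:
  assumes "integrable \<sigma> f" shows "mesh_integrable D (\<lambda>x. f (corr D x))"
  using pullback_integrable[OF _ assms] by (simp add: mesh_integrable_def chart_map_def)

lemma mesh_integrable_mult_continuous:
  assumes f: "mesh_integrable D f" and g: "continuous_on (mesh D) g"
  shows "mesh_integrable D (\<lambda>x. f x * g x)"
  unfolding mesh_integrable_def
proof
  fix T assume T: "T \<in> tris D"
  let ?g = "\<lambda>u. g (tri_map D T u)" and ?f = "\<lambda>u. f (tri_map D T u)"
  have cg: "continuous_on ref_tri ?g"
    by (rule continuous_on_compose2[OF g continuous_tri_map]) (use tri_map_in_mesh[OF T] in auto)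
  then have "bounded (?g ` ref_tri)" by (intro compact_imp_bounded compact_continuous_image compact_ref_tri)
  then obtain B where B: "\<forall>u\<in>ref_tri. norm (?g u) \<le> B" unfolding bounded_iff by auto
  have fi: "integrable lborel (\<lambda>u. indicator ref_tri u *\<^sub>R ?f u)"
    using f T by (simp add: mesh_integrable_def set_integrable_def)
  have gm: "(\<lambda>u. indicator ref_tri u *\<^sub>R ?g u) \<in> borel_measurable lborel"
    using borel_measurable_continuous_on_indicator[OF ref_tri_sets cg] by simp
  have "integrable lborel (\<lambda>u. (indicator ref_tri u *\<^sub>R ?f u) * (indicator ref_tri u *\<^sub>R ?g u))"
  proof (rule Bochner_Integration.integrable_bound)
    show "integrable lborel (\<lambda>u. B * (indicator ref_tri u *\<^sub>R ?f u))" using fi by (rule integrable_mult_right)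
    show "(\<lambda>u. (indicator ref_tri u *\<^sub>R ?f u) * (indicator ref_tri u *\<^sub>R ?g u)) \<in> borel_measurable lborel"
      using fi gm by (intro borel_measurable_times) auto
    show "AE u in lborel. norm ((indicator ref_tri u *\<^sub>R ?f u) * (indicator ref_tri u *\<^sub>R ?g u)) \<le> norm (B * (indicator ref_tri u *\<^sub>R ?f u))"
    proof (rule AE_I2)
      fix u
      show "norm ((indicator ref_tri u *\<^sub>R ?f u) * (indicator ref_tri u *\<^sub>R ?g u)) \<le> norm (B * (indicator ref_tri u *\<^sub>R ?f u))"
      proof (cases "u \<in> ref_tri")
        case True
        then have "\<bar>?g u\<bar> \<le> \<bar>B\<bar>" using B by force
        then have "\<bar>?f u\<bar> * \<bar>?g u\<bar> \<le> \<bar>?f u\<bar> * \<bar>B\<bar>" by (intro mult_left_mono) auto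
        then show ?thesis using True by (simp add: abs_mult mult.commute)
      qed simp
    qed
  qed
  moreover have "(\<lambda>u. (indicator ref_tri u *\<^sub>R ?f u) * (indicator ref_tri u *\<^sub>R ?g u)) = (\<lambda>u. indicator ref_tri u *\<^sub>R (?f u * ?g u))"
    by (auto simp: fun_eq_iff indicator_def)
  ultimately show "set_integrable lborel ref_tri (\<lambda>u. ?f u * ?g u)" by (simp add: set_integrable_def)
qed

section \<open>The reference load\<close>

lemma classical_div_continuous:
  assumes z: "smooth_field P z"
  shows "continuous_on (Qclosed P) (classical_div P z)"
proof -
  obtain f' where f': "\<And>q. q\<in>Qclosed P \<Longrightarrow> (z has_derivative f' q) (at q within Qclosed P)"
    "\<And>v. continuous_on (Qclosed P) (\<lambda>q. f' q v)" using z unfolding smooth_field_def C1_on_def by blast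
  have eq: "classical_div P z q = fst (f' q (1, 0))
      + (\<Sum>d\<in>UNIV. tproj \<nu> (snd q) (\<chi> k. snd (f' q (0, axis k 1)) $ d) $ d)" if q: "q \<in> Qclosed P" for q
  proof -
    obtain t x where tx: "q = (t, x)" by (cases q)
    have tx': "t \<in> {0..1}" "x \<in> surf P" using q by (auto simp: Qclosed_def tx)
    note d = section_derivatives[OF f'(1) q[unfolded tx]]
    have "((\<lambda>s. fst (z (s, x))) has_vector_derivative fst (f' (t, x) (1, 0))) (at t within {0..1})"
      using bounded_linear.has_vector_derivative[OF bounded_linear_fst d(1)] by simp
    then have 1: "vector_derivative (\<lambda>s. fst (z (s, x))) (at t within {0..1}) = fst (f' (t, x) (1, 0))"
      using vector_derivative_within_cbox[of 0 1 t "\<lambda>s. fst (z (s, x))"] tx' by simp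
    have "((\<lambda>y. snd (z (t, y)) $ k) has_derivative (\<lambda>v. snd (f' (t, x) (0, v)) $ k)) (at x within surf P)" for k
      by (rule bounded_linear.has_derivative[OF bounded_linear_vec_nth])
         (rule bounded_linear.has_derivative[OF bounded_linear_snd d(2)])
    then have 2: "surf_grad (surf P) (\<lambda>y. snd (z (t, y)) $ k) x = tproj \<nu> x (\<chi> j. snd (f' (t, x) (0, axis j 1)) $ k)" for k
      by (rule surf_grad_eq[OF tx'(2)])
    show ?thesis by (simp add: classical_div_def tx 1 surf_div_def 2)
  qed
  have "continuous_on (Qclosed P) (\<lambda>q. fst (f' q (1, 0))
      + (\<Sum>d\<in>UNIV. tproj \<nu> (snd q) (\<chi> k. snd (f' q (0, axis k 1)) $ d) $ d))"
    by (intro continuous_on_add continuous_on_fst f'(2) continuous_on_sum continuous_on_component continuous_on_tproj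
        continuous_on_snd continuous_on_id continuous_on_vec_lambda) (auto simp: Qclosed_def)
  then show ?thesis by (rule continuous_on_eq) (simp add: eq)
qed

lemma load_ref_density_integrable:
  assumes z: "smooth_field P z" and j: "j \<le> Nt D"
  shows "mesh_integrable D (\<lambda>x. classical_div P z (tnode D j, corr D x) + b_ref P D z j (corr D x))"
proof -
  have tn: "tnode D j \<in> {0..1}" using j Nt2 by (simp add: tnode_def tau_def)
  have "continuous_on (mesh D) (\<lambda>x. classical_div P z (tnode D j, corr D x))"
    by (rule continuous_on_compose2[OF classical_div_continuous[OF z], of _ "\<lambda>x. (tnode D j, corr D x)"])
       (use tn corr_in in \<open>auto simp: Qclosed_def intro!: continuous_intros corr_cont\<close>)
  then have 1: "mesh_integrable D (\<lambda>x. classical_div P z (tnode D j, corr D x))"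
    by (rule mesh_integrable_continuous)
  have L1: "integrable \<sigma> (rho0 P)" "integrable \<sigma> (rho1 P)"
    using setting finite_measure.L2_integrable[OF finite_area] by (auto simp: continuous_setting_def density_def)
  have fz: "integrable \<sigma> (\<lambda>x. fst (z (s, x)))" if s: "s \<in> {0..1}" for s
  proof -
    have "continuous_on (surf P) (\<lambda>x. z (s, x))"
      by (rule continuous_on_compose2[OF C1_on_continuous, of "Qclosed P" z])
         (use z s in \<open>auto simp: smooth_field_def Qclosed_def intro!: continuous_intros\<close>)
    then have "continuous_on (surf P) (\<lambda>x. fst (z (s, x)))" by (rule continuous_on_fst)
    then show ?thesis by (intro finite_measure.L2_integrable[OF finite_area] continuous_L2_area)
  qed
  have "integrable \<sigma> (\<lambda>x. b_ref P D z j x)"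
    unfolding b_ref_def using L1 fz[of 0] fz[of 1]
    by (cases "j = 0"; cases "j = Nt D") auto
  then have 2: "mesh_integrable D (\<lambda>x. b_ref P D z j (corr D x))" by (rule mesh_integrable_comp_corr)
  show ?thesis by (rule mesh_integrable_add[OF 1 2])
qed

text \<open>Additivity of the integral needs the densities of the load to be integrable on every triangle.\<close>

lemma linear_load_ref:
  assumes z: "smooth_field P z"
  shows "linear (load_ref P D z)"
proof -
  let ?r = "\<lambda>j x. classical_div P z (tnode D j, corr D x) + b_ref P D z j (corr D x)"
  have i: "mesh_integrable D (\<lambda>x. ?r j x * pl D w x)" if "j \<le> Nt D" for j w
    by (rule mesh_integrable_mult_continuous[OF load_ref_density_integrable[OF z that] continuous_pl])
  show ?thesis
  proof (rule linearI)
    fix u v :: "nat \<Rightarrow> 'v \<Rightarrow> real" and c :: real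
    have "mesh_integral D (\<lambda>x. ?r j x * pl D ((u + v) j) x)
        = mesh_integral D (\<lambda>x. ?r j x * pl D (u j) x) + mesh_integral D (\<lambda>x. ?r j x * pl D (v j) x)" if "j \<le> Nt D" for j
      using mesh_integral_add[OF i[OF that] i[OF that], of "u j" "v j"] by (simp add: pl_add distrib_left)
    then show "load_ref P D z (u + v) = load_ref P D z u + load_ref P D z v"
      unfolding load_ref_def by (simp add: distrib_left sum.distrib[symmetric])
    have "mesh_integral D (\<lambda>x. ?r j x * pl D ((c *\<^sub>R u) j) x) = c * mesh_integral D (\<lambda>x. ?r j x * pl D (u j) x)" for j
      using mesh_integral_cmult[of D c "\<lambda>x. ?r j x * pl D (u j) x"] by (simp add: pl_scale mult.left_commute)
    then show "load_ref P D z (c *\<^sub>R u) = c *\<^sub>R load_ref P D z u"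
      unfolding load_ref_def by (simp add: sum_distrib_left mult.left_commute)
  qed
qed

end

section \<open>Dual norms and stability constants\<close>

context discretization
begin

lemma a_norm_eq: "a_norm D v = inner_form.form_norm (a_form D) v"
  by (simp add: a_norm_def inner_form.form_norm_def[OF Vh_form])

lemma h_norm_eq: "h_norm D z = inner_form.form_norm (h_inner D) z"
  by (simp add: h_norm_def inner_form.form_norm_def[OF Xh_form])

lemma zero_fun2: "(\<lambda>j i. 0) = 0" by (simp add: fun_eq_iff)

lemma a_norm_pos: "v \<in> Vh D - {\<lambda>j i. 0} \<Longrightarrow> 0 < a_norm D v"
  using inner_form.pos[OF Vh_form, of v] by (simp add: a_norm_def zero_fun2)

lemma h_norm_pos: "z \<in> Xh D - {\<lambda>j i. 0} \<Longrightarrow> 0 < h_norm D z"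
  using inner_form.pos[OF Xh_form, of z] by (simp add: h_norm_def zero_fun2)

lemma a_norm_nonneg: "0 \<le> a_norm D v" by (simp add: a_norm_def a_form_nonneg)

lemma a_norm_zero: "a_norm D 0 = 0"
  using linear_0[OF inner_form.lin[OF Vh_form]] by (simp add: a_norm_def)

lemma h_norm_nonneg: "0 \<le> h_norm D v" by (simp add: h_norm_def h_inner_nonneg)

text \<open>The supremum of the empty set is an unspecified real number, so the dual norm must not range over an
empty set. The witness lives on the first two time layers, with values that balance its mean.\<close>

lemma Vh_nontrivial: "Vh D - {\<lambda>j i. 0} \<noteq> {}"
proof -
  define c :: "nat \<Rightarrow> real" where "c j = (if j = 0 then wt D 1 else if j = 1 then - wt D 0 else 0)" for j
  define v where "v j = (\<lambda>i::'v. c j)" for j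
  have "(\<Sum>j\<le>Nt D. wt D j * mesh_integral D (pl D (v j))) = (\<Sum>j\<le>Nt D. wt D j * c j) * mesh_integral D (\<lambda>x. 1)"
    by (simp add: v_def mesh_integral_pl_const sum_distrib_right mult.assoc)
  also have "(\<Sum>j\<le>Nt D. wt D j * c j) = (\<Sum>j\<in>{0, 1}. wt D j * c j)"
    using Nt2 by (intro sum.mono_neutral_right) (auto simp: c_def)
  also have "\<dots> = 0" by (simp add: c_def)
  finally have "v \<in> Vh D" using Nt2 by (simp add: Vh_def Qh_def v_def c_def)
  moreover have "v \<noteq> (\<lambda>j i. 0)"
  proof
    assume "v = (\<lambda>j i. 0)"
    then have "v 0 undefined = 0" by simp
    then show False using wt_pos[of 1] by (simp add: v_def c_def)
  qed
  ultimately show ?thesis by blast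
qed

lemma Xh_nontrivial: "Xh D - {\<lambda>j i. 0} \<noteq> {}"
proof -
  define z :: "'v dfield" where "z j i = (if j = 0 then (1, 0) else 0)" for j i
  have "z \<in> Xh D" by (simp add: Xh_def Qh_def z_def)
  moreover have "z \<noteq> (\<lambda>j i. 0)"
  proof
    assume "z = (\<lambda>j i. 0)"
    then have "z 0 undefined = 0" by simp
    then show False by (simp add: z_def zero_prod_def)
  qed
  ultimately show ?thesis by blast
qed

text \<open>The norm of the Riesz representer is an upper bound.\<close>

lemma dual_quotients_bounded:
  assumes "linear l"
  shows "bdd_above ((\<lambda>v. \<bar>l v\<bar> / a_norm D v) ` (Vh D - {\<lambda>j i. 0}))"
proof -
  obtain u where u: "u \<in> Vh D" "\<And>v. v \<in> Vh D \<Longrightarrow> a_form D u v = l v"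
    using inner_form.riesz[OF Vh_form assms] by blast
  show ?thesis
  proof (rule bdd_aboveI2)
    fix v assume v: "v \<in> Vh D - {\<lambda>j i. 0}"
    then have "\<bar>l v\<bar> \<le> a_norm D u * a_norm D v"
      using inner_form.cauchy_schwarz[OF Vh_form u(1), of v] u(2)[of v] by (simp add: a_norm_eq)
    then show "\<bar>l v\<bar> / a_norm D v \<le> a_norm D u" using a_norm_pos[OF v] by (simp add: divide_le_eq)
  qed
qed

lemma dual_norm_upper:
  assumes l: "linear l" and v: "v \<in> Vh D"
  shows "\<bar>l v\<bar> \<le> dual_norm D l * a_norm D v"
proof (cases "v = 0")
  case True
  then show ?thesis using linear_0[OF l] a_norm_zero by simp
next
  case False
  then have v': "v \<in> Vh D - {\<lambda>j i. 0}" using v by (simp add: zero_fun2)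
  have "\<bar>l v\<bar> / a_norm D v \<le> dual_norm D l"
    unfolding dual_norm_def by (rule cSUP_upper[OF v' dual_quotients_bounded[OF l]])
  then show ?thesis using a_norm_pos[OF v'] by (simp add: divide_le_eq)
qed

lemma dual_norm_nonneg: "linear l \<Longrightarrow> 0 \<le> dual_norm D l"
proof -
  assume l: "linear l"
  obtain v where v: "v \<in> Vh D - {\<lambda>j i. 0}" using Vh_nontrivial by blast
  have "0 \<le> \<bar>l v\<bar> / a_norm D v" using a_norm_nonneg by simp
  also have "\<dots> \<le> dual_norm D l"
    unfolding dual_norm_def by (rule cSUP_upper[OF v dual_quotients_bounded[OF l]])
  finally show ?thesis .
qed

lemma dual_norm_least:
  assumes "\<And>v. v \<in> Vh D \<Longrightarrow> \<bar>l v\<bar> \<le> C * a_norm D v"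
  shows "dual_norm D l \<le> C"
  unfolding dual_norm_def
proof (rule cSUP_least[OF Vh_nontrivial])
  fix v assume v: "v \<in> Vh D - {\<lambda>j i. 0}"
  show "\<bar>l v\<bar> / a_norm D v \<le> C" using assms[of v] v a_norm_pos[OF v] by (simp add: divide_le_eq)
qed

lemma dual_norm_add:
  assumes "linear l" "linear l'"
  shows "dual_norm D (\<lambda>v. l v + l' v) \<le> dual_norm D l + dual_norm D l'"
proof (rule dual_norm_least)
  fix v assume v: "v \<in> Vh D"
  show "\<bar>l v + l' v\<bar> \<le> (dual_norm D l + dual_norm D l') * a_norm D v"
    using dual_norm_upper[OF assms(1) v] dual_norm_upper[OF assms(2) v] abs_triangle_ineq[of "l v" "l' v"]
    by (simp add: distrib_right)
qed

lemma dual_norm_scale: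
  assumes l: "linear l"
  shows "dual_norm D (\<lambda>v. c * l v) = \<bar>c\<bar> * dual_norm D l"
proof (rule antisym)
  show "dual_norm D (\<lambda>v. c * l v) \<le> \<bar>c\<bar> * dual_norm D l"
  proof (rule dual_norm_least)
    fix v assume v: "v \<in> Vh D"
    show "\<bar>c * l v\<bar> \<le> \<bar>c\<bar> * dual_norm D l * a_norm D v"
      using mult_left_mono[OF dual_norm_upper[OF l v], of "\<bar>c\<bar>"] by (simp add: abs_mult mult.assoc)
  qed
  have cl: "linear (\<lambda>v. c * l v)"
    using linear_compose_scale_right[OF l, of c] by simp
  show "\<bar>c\<bar> * dual_norm D l \<le> dual_norm D (\<lambda>v. c * l v)"
  proof (cases "c = 0")
    case True
    then show ?thesis using dual_norm_nonneg[OF cl] by simp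
  next
    case False
    have "dual_norm D l \<le> dual_norm D (\<lambda>v. c * l v) / \<bar>c\<bar>"
    proof (rule dual_norm_least)
      fix v assume v: "v \<in> Vh D"
      show "\<bar>l v\<bar> \<le> dual_norm D (\<lambda>v. c * l v) / \<bar>c\<bar> * a_norm D v"
        using dual_norm_upper[OF cl v] False by (simp add: abs_mult field_simps)
    qed
    then show ?thesis using False by (simp add: field_simps)
  qed
qed

end

context recovery
begin

lemma Lam_quotient_eq: "(\<lambda>w. load D z w - load D (\<lambda>j i. 0) w) = load_lin z"
  by (rule ext, subst load_eq) simp

lemma Lam_eq: "Lam D = (SUP z\<in>Xh D - {\<lambda>j i. 0}. dual_norm D (load_lin z) / h_norm D z)"
  by (simp only: Lam_def Lam_quotient_eq)

text \<open>The quotient compares a seminorm of \<open>z\<close> with a norm on a finite-dimensional space.\<close>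

lemma Lam_bdd: "bdd_above ((\<lambda>z. dual_norm D (load_lin z) / h_norm D z) ` (Xh D - {\<lambda>j i. 0}))"
proof -
  have add: "dual_norm D (load_lin (u + v)) \<le> dual_norm D (load_lin u) + dual_norm D (load_lin v)" for u v
  proof -
    have "load_lin (u + v) = (\<lambda>w. load_lin u w + load_lin v w)" by (rule ext) (rule load_lin_add_left)
    then show ?thesis using dual_norm_add[OF linear_load_lin linear_load_lin] by simp
  qed
  have scale: "dual_norm D (load_lin (c *\<^sub>R v)) = \<bar>c\<bar> * dual_norm D (load_lin v)" for c v
  proof -
    have "load_lin (c *\<^sub>R v) = (\<lambda>w. c * load_lin v w)" by (rule ext) (rule load_lin_scale_left)
    then show ?thesis using dual_norm_scale[OF linear_load_lin] by simp
  qed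
  obtain C where C: "\<forall>z\<in>Xh D. dual_norm D (load_lin z) \<le> C * h_norm D z"
    using inner_form.seminorm_bounded[OF Xh_form, of "\<lambda>z. dual_norm D (load_lin z)"] add scale
    unfolding h_norm_eq by blast
  show ?thesis
  proof (rule bdd_aboveI2)
    fix z assume z: "z \<in> Xh D - {\<lambda>j i. 0}"
    then show "dual_norm D (load_lin z) / h_norm D z \<le> C" using C h_norm_pos[OF z] by (simp add: divide_le_eq)
  qed
qed

lemma Lam_nonneg: "0 \<le> Lam D"
proof -
  obtain z where z: "z \<in> Xh D - {\<lambda>j i. 0}" using Xh_nontrivial by blast
  have "0 \<le> dual_norm D (load_lin z) / h_norm D z" using dual_norm_nonneg[OF linear_load_lin] h_norm_nonneg by simp
  also have "\<dots> \<le> Lam D" unfolding Lam_eq by (rule cSUP_upper[OF z Lam_bdd])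
  finally show ?thesis .
qed

lemma Lam_upper:
  assumes z: "z \<in> Xh D" and v: "v \<in> Vh D"
  shows "\<bar>load_lin z v\<bar> \<le> Lam D * h_norm D z * a_norm D v"
proof (cases "z = 0")
  case True
  have "load_lin 0 v = 0" using load_lin_scale_left[of 0 0 v] by simp
  moreover have "h_norm D 0 = 0" by (simp add: h_norm_def h_inner_def)
  ultimately show ?thesis using True by simp
next
  case False
  then have z': "z \<in> Xh D - {\<lambda>j i. 0}" using z by (simp add: zero_fun2)
  have "dual_norm D (load_lin z) / h_norm D z \<le> Lam D" unfolding Lam_eq by (rule cSUP_upper[OF z' Lam_bdd])
  then have "dual_norm D (load_lin z) \<le> Lam D * h_norm D z" using h_norm_pos[OF z'] by (simp add: divide_le_eq)
  then have "dual_norm D (load_lin z) * a_norm D v \<le> Lam D * h_norm D z * a_norm D v"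
    using a_norm_nonneg by (rule mult_right_mono)
  then show ?thesis using dual_norm_upper[OF linear_load_lin v, of z] by simp
qed

text \<open>Both expansions are compared along a small multiple of the difference \<open>d\<close> of the two gradients. With
\<open>\<epsilon>\<close> a quarter of the norm of \<open>d\<close>, the remainders add up to at most half of the difference of the
linear terms.\<close>

lemma has_discrete_grad_unique:
  assumes g: "has_discrete_grad P D E z g" and g': "has_discrete_grad P D E z g'"
  shows "g = g'"
proof (rule ccontr)
  assume "g \<noteq> g'"
  interpret X: inner_form "Xh D" "h_inner D" by (rule Xh_form)
  define d where "d = g - g'"
  have dX: "d \<in> Xh D" using g g' subspace_Xh by (auto simp: d_def has_discrete_grad_def intro: subspace_diff)
  have d0: "0 < h_inner D d d" using X.pos[OF dX] \<open>g \<noteq> g'\<close> by (simp add: d_def)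
  define N where "N = h_norm D d"
  have N: "0 < N" "h_inner D d d = N\<^sup>2" using d0 by (simp_all add: N_def h_norm_def)
  define \<epsilon> where "\<epsilon> = N / 4"
  have \<epsilon>: "0 < \<epsilon>" using N by (simp add: \<epsilon>_def)
  obtain r where r: "r > 0" "\<And>v. v \<in> Xh D \<Longrightarrow> h_norm D v < r \<Longrightarrow>
        \<bar>real_of_ereal (discrete_energy P D E (\<lambda>j i. z j i + v j i))
          - real_of_ereal (discrete_energy P D E z) - h_inner D g v\<bar> \<le> \<epsilon> * h_norm D v"
    using g \<epsilon> unfolding has_discrete_grad_def by blast
  obtain r' where r': "r' > 0" "\<And>v. v \<in> Xh D \<Longrightarrow> h_norm D v < r' \<Longrightarrow>
        \<bar>real_of_ereal (discrete_energy P D E (\<lambda>j i. z j i + v j i))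
          - real_of_ereal (discrete_energy P D E z) - h_inner D g' v\<bar> \<le> \<epsilon> * h_norm D v"
    using g' \<epsilon> unfolding has_discrete_grad_def by blast
  \<comment> \<open>With this factor \<open>s d\<close> has norm \<open>min r r' / 2\<close>, inside both neighbourhoods.\<close>
  define s where "s = min r r' / (2 * N)"
  have s: "0 < s" using r(1) r'(1) N by (simp add: s_def)
  define v where "v = s *\<^sub>R d"
  have vX: "v \<in> Xh D" unfolding v_def by (rule subspace_scale[OF subspace_Xh dX])
  have "h_inner D v v = s\<^sup>2 * h_inner D d d"
    by (simp add: v_def linear_cmul[OF X.lin] linear_cmul[OF X.lin_right] power2_eq_square)
  then have nv: "h_norm D v = s * N" using s N by (simp add: h_norm_def real_sqrt_mult)
  have "s * N = min r r' / 2" using N by (simp add: s_def)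
  then have small: "h_norm D v < r" "h_norm D v < r'"
    using r(1) r'(1) nv min.cobounded1[of r r'] min.cobounded2[of r r'] by linarith+
  have "\<bar>h_inner D g v - h_inner D g' v\<bar> \<le> 2 * (\<epsilon> * (s * N))"
    using r(2)[OF vX small(1)] r'(2)[OF vX small(2)] unfolding nv by linarith
  moreover have "h_inner D g v - h_inner D g' v = s * N\<^sup>2"
  proof -
    have "h_inner D g v - h_inner D g' v = h_inner D d v" by (simp add: d_def linear_diff[OF X.lin])
    then show ?thesis by (simp add: v_def linear_cmul[OF X.lin_right] N)
  qed
  ultimately have "s * N\<^sup>2 \<le> 2 * (\<epsilon> * (s * N))" by simp
  also have "\<dots> = s * N\<^sup>2 / 2" by (simp add: \<epsilon>_def power2_eq_square)
  finally show False using s N by simp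
qed

lemma discrete_grad_Xh:
  assumes "has_discrete_grad P D E z g" shows "discrete_grad P D E z \<in> Xh D"
proof -
  have "discrete_grad P D E z = g"
    unfolding discrete_grad_def using assms has_discrete_grad_unique by (intro the_equality) blast+
  then show ?thesis using assms by (simp add: has_discrete_grad_def)
qed

lemma interp_Xh: "interp D z \<in> Xh D"
proof -
  have "nrm D i \<bullet> nrm D i = 1" for i using data by (simp add: recovery_data_def dot_square_norm)
  then have "Pi_nrm D i m \<bullet> nrm D i = 0" for i m
    by (simp add: Pi_nrm_def inner_diff_left inner_commute[of m])
  then show ?thesis by (simp add: Xh_def Qh_def interp_def)
qed

end

context paired
begin

text \<open>Recovery and lift are linear, so the numerator is a seminorm on the finite-dimensional space \<open>V\<^sub>h\<close>.\<close>

lemma kappa_bdd: "bdd_above ((\<lambda>v. Hnorm P (lift P D (GGh D v)) / a_norm D v) ` (Vh D - {\<lambda>j i. 0}))"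
proof -
  have "\<exists>C. \<forall>v\<in>Vh D. Hnorm P (lift P D (GGh D v)) \<le> C * inner_form.form_norm (a_form D) v"
    by (rule inner_form.seminorm_bounded[OF Vh_form])
       (simp_all add: GGh_add GGh_scale Hnorm_lift_add Hnorm_lift_scale)
  then obtain C where C: "\<forall>v\<in>Vh D. Hnorm P (lift P D (GGh D v)) \<le> C * a_norm D v"
    unfolding a_norm_eq by blast
  show ?thesis
  proof (rule bdd_aboveI2)
    fix v assume v: "v \<in> Vh D - {\<lambda>j i. 0}"
    then show "Hnorm P (lift P D (GGh D v)) / a_norm D v \<le> C" using C a_norm_pos[OF v] by (simp add: divide_le_eq)
  qed
qed

lemma kappa_nonneg: "0 \<le> kappa P D"
proof -
  obtain v where v: "v \<in> Vh D - {\<lambda>j i. 0}" using Vh_nontrivial by blast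
  have "0 \<le> Hnorm P (lift P D (GGh D v)) / a_norm D v" using a_norm_nonneg by simp
  also have "\<dots> \<le> kappa P D" unfolding kappa_def by (rule cSUP_upper[OF v kappa_bdd])
  finally show ?thesis .
qed

lemma kappa_upper:
  assumes v: "v \<in> Vh D" shows "Hnorm P (lift P D (GGh D v)) \<le> kappa P D * a_norm D v"
proof (cases "v = 0")
  case True
  have "GGh D 0 = 0" using GGh_scale[of 0 0] by simp
  then show ?thesis using True a_norm_zero Hnorm_lift_scale[of 0 0] by simp
next
  case False
  then have v': "v \<in> Vh D - {\<lambda>j i. 0}" using v by (simp add: zero_fun2)
  have "Hnorm P (lift P D (GGh D v)) / a_norm D v \<le> kappa P D"
    unfolding kappa_def by (rule cSUP_upper[OF v' kappa_bdd])
  then show ?thesis using a_norm_pos[OF v'] by (simp add: divide_le_eq)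
qed

lemma phi_h_solves:
  assumes "smooth_field P z"
  shows "phi_h P D z \<in> Vh D" "\<And>v. v \<in> Vh D \<Longrightarrow> a_form D (phi_h P D z) v = load_ref P D z v"
  using theI'[OF inner_form.riesz[OF Vh_form linear_load_ref[OF assms]]] by (auto simp: phi_h_def)

section \<open>One step of the paired iterations\<close>

lemma err_triangle_lift:
  assumes "L2 (Qmeas P) z"
  shows "Hnorm P (\<lambda>q. z q - lift P D v q) \<le> Hnorm P (\<lambda>q. z q - lift P D u q) + Hnorm P (\<lambda>q. lift P D u q - lift P D v q)"
  by (rule L2_triangle[OF assms lift_L2 lift_L2])

text \<open>The inverse estimate moves the distance to \<open>H\<close>, where it can be split at \<open>z\<close>.\<close>

lemma interp_distance:
  assumes inv: "\<And>z. z \<in> Xh D \<Longrightarrow> h_norm D z \<le> Cinv * Hnorm P (lift P D z)"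
    and Cinv: "0 \<le> Cinv" and z: "L2 (Qmeas P) z" and zh: "zh \<in> Xh D"
  shows "h_norm D (interp D z - zh) \<le> Cinv * (eps_I P D z + err P D z zh)"
proof -
  have X: "interp D z - zh \<in> Xh D" by (rule subspace_diff[OF subspace_Xh interp_Xh zh])
  have "interp D z - zh = (\<lambda>j i. interp D z j i - zh j i)" by (simp add: fun_eq_iff)
  then have "Hnorm P (lift P D (interp D z - zh)) = Hnorm P (\<lambda>q. lift P D (interp D z) q - lift P D zh q)"
    by (simp add: Hnorm_lift_diff)
  also have "\<dots> \<le> Hnorm P (\<lambda>q. lift P D (interp D z) q - z q) + Hnorm P (\<lambda>q. z q - lift P D zh q)"
    by (rule L2_triangle[OF lift_L2 z lift_L2])
  also have "\<dots> = eps_I P D z + err P D z zh"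
    by (simp add: eps_I_def err_def L2_norm_diff_commute[of _ "lift P D (interp D z)"])
  finally show ?thesis using inv[OF X] Cinv by (meson mult_left_mono order_trans)
qed

text \<open>The squared energy norm of \<open>d = \<phi>\<^sub>h - \<phi>'\<close> is the functional \<open>a(d, \<cdot>)\<close> tested with \<open>d\<close> itself.
Adding and subtracting the loads of the interpolated and of the discrete state splits this functional into
three parts, bounded by the inconsistency of the load, by \<open>\<Lambda>\<close> and by the residual.\<close>

lemma poisson_error:
  assumes z: "smooth_field P z" and zh: "zh \<in> Xh D" and ph: "ph \<in> Vh D"
  shows "a_norm D (phi_h P D z - ph)
    \<le> d_err P D z + Lam D * h_norm D (interp D z - zh) + eps_s D ph zh"
proof -
  define d where "d = phi_h P D z - ph"
  note sol = phi_h_solves[OF z]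
  have dV: "d \<in> Vh D" unfolding d_def by (rule subspace_diff[OF subspace_Vh sol(1) ph])
  have X: "interp D z - zh \<in> Xh D" by (rule subspace_diff[OF subspace_Xh interp_Xh zh])
  interpret V: inner_form "Vh D" "a_form D" by (rule Vh_form)
  have l1: "linear (\<lambda>v. load D (interp D z) v - load_ref P D z v)"
    by (rule linear_compose_sub[OF linear_load linear_load_ref[OF z]])
  have l2: "linear (\<lambda>v. a_form D ph v - load D zh v)"
    by (rule linear_compose_sub[OF V.lin_right linear_load])
  have "load_lin (interp D z) d = load_lin (interp D z - zh) d + load_lin zh d"
    using load_lin_add_left[of "interp D z - zh" zh d] by simp
  then have ll: "load_lin (interp D z - zh) d = load D (interp D z) d - load D zh d"
    using load_eq[of "interp D z" d] load_eq[of zh d] by simp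
  have "a_form D d d = load_ref P D z d - a_form D ph d"
    using sol(2)[OF dV] by (simp add: d_def linear_diff[OF V.lin])
  also have "\<dots> = - (load D (interp D z) d - load_ref P D z d) + load_lin (interp D z - zh) d
      - (a_form D ph d - load D zh d)" by (simp add: ll)
  also have "\<dots> \<le> \<bar>load D (interp D z) d - load_ref P D z d\<bar> + \<bar>load_lin (interp D z - zh) d\<bar>
      + \<bar>a_form D ph d - load D zh d\<bar>" by linarith
  also have "\<dots> \<le> d_err P D z * a_norm D d + Lam D * h_norm D (interp D z - zh) * a_norm D d
      + eps_s D ph zh * a_norm D d"
    unfolding d_err_def eps_s_def
    by (intro add_mono dual_norm_upper[OF l1 dV] dual_norm_upper[OF l2 dV] Lam_upper[OF X dV])
  finally have "a_norm D d * a_norm D d \<le> (d_err P D z + Lam D * h_norm D (interp D z - zh) + eps_s D ph zh) * a_norm D d"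
    using a_form_nonneg by (simp add: a_norm_def algebra_simps)
  moreover have "0 \<le> d_err P D z + Lam D * h_norm D (interp D z - zh) + eps_s D ph zh"
    unfolding d_err_def eps_s_def
    using dual_norm_nonneg[OF l1] dual_norm_nonneg[OF l2] Lam_nonneg h_norm_nonneg by simp
  ultimately show ?thesis
    unfolding d_def[symmetric] using a_norm_nonneg[of d]
    by (cases "a_norm D d = 0") (auto simp: mult_le_cancel_right)
qed

lemma quantities_nonneg:
  assumes "smooth_field P z"
  shows "0 \<le> d_err P D z" "0 \<le> eps_s D ph zh"
  unfolding d_err_def eps_s_def
  by (intro dual_norm_nonneg linear_compose_sub linear_load linear_load_ref assms inner_form.lin_right[OF Vh_form])+

text \<open>The states before and after \<open>R\<^sub>h\<close> differ by \<open>\<epsilon>\<^sub>R\<close>. Before \<open>R\<^sub>h\<close> the error is the sum of the error of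
\<open>z\<close> and that of the gradient of the potential, which is split at the recovered gradient of the reference
solution.\<close>

lemma projection_step:
  assumes inv: "\<And>z. z \<in> Xh D \<Longrightarrow> h_norm D z \<le> Cinv * Hnorm P (lift P D z)" and Cinv: "0 \<le> Cinv"
    and z: "smooth_field P z" and \<phi>: "poisson_solution P z \<phi>" and w: "is_proj_C P z w"
    and zh: "zh \<in> Xh D" and ph: "ph \<in> Vh D"
  shows "err P D w (Rh D (corrected D zh ph)) \<le> (1 + kappa P D * Lam D * Cinv) * err P D z zh
    + eps_rec P D \<phi> z + kappa P D * (d_err P D z + eps_s D ph zh)
    + kappa P D * Lam D * Cinv * eps_I P D z + eps_R P D ph zh"
proof -
  let ?c = "corrected D zh ph" and ?g = "grad P \<phi>"
  have zH: "z \<in> Hspace P" by (rule smooth_field_Hspace[OF z])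
  have \<phi>H: "\<phi> \<in> H1 P" using \<phi> by (simp add: poisson_solution_def Vspace_def)
  have zL: "L2 (Qmeas P) z" and gL: "L2 (Qmeas P) ?g" using zH grad_Hspace[OF \<phi>H] by (auto simp: Hspace_L2)
  have sL: "L2 (Qmeas P) (\<lambda>q. z q + ?g q)" by (rule L2_add[OF zL gL])
  have wL: "L2 (Qmeas P) w" using w by (auto simp: is_proj_C_def Cset_def Hspace_L2)
  have eq: "AE q in Qmeas P. w q - lift P D (Rh D ?c) q = (z q + ?g q) - lift P D (Rh D ?c) q"
    using projection_eq[OF zH \<phi> w] unfolding Heq_def by eventually_elim simp
  have "err P D w (Rh D ?c) = Hnorm P (\<lambda>q. (z q + ?g q) - lift P D (Rh D ?c) q)"
    unfolding err_def by (rule L2_norm_cong_AE[OF L2_diff[OF wL lift_L2] L2_diff[OF sL lift_L2] eq])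
  also have "\<dots> \<le> Hnorm P (\<lambda>q. (z q + ?g q) - lift P D ?c q) + Hnorm P (\<lambda>q. lift P D ?c q - lift P D (Rh D ?c) q)"
    by (rule err_triangle_lift[OF sL])
  also have "Hnorm P (\<lambda>q. lift P D ?c q - lift P D (Rh D ?c) q) = eps_R P D ph zh"
    unfolding eps_R_def by (subst L2_norm_diff_commute) (rule Hnorm_lift_diff)
  also have "Hnorm P (\<lambda>q. (z q + ?g q) - lift P D ?c q)
      = Hnorm P (\<lambda>q. (z q - lift P D zh q) + (?g q - lift P D (GGh D ph) q))"
  proof (rule Hnorm_cong)
    fix q assume q: "q \<in> Qclosed P"
    have "?c = zh + GGh D ph" by (simp add: corrected_def fun_eq_iff)
    then show "(z q + ?g q) - lift P D ?c q = (z q - lift P D zh q) + (?g q - lift P D (GGh D ph) q)"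
      using lift_add[OF q, of zh "GGh D ph"] by simp
  qed
  also have "\<dots> \<le> err P D z zh + Hnorm P (\<lambda>q. ?g q - lift P D (GGh D ph) q)"
    unfolding err_def by (rule L2_minkowski[OF L2_diff[OF zL lift_L2] L2_diff[OF gL lift_L2]])
  also have "Hnorm P (\<lambda>q. ?g q - lift P D (GGh D ph) q)
      \<le> eps_rec P D \<phi> z + kappa P D * a_norm D (phi_h P D z - ph)"
  proof -
    have "Hnorm P (\<lambda>q. lift P D (GGh D (phi_h P D z)) q - lift P D (GGh D ph) q)
        = Hnorm P (lift P D (\<lambda>j i. GGh D (phi_h P D z) j i - GGh D ph j i))" by (rule Hnorm_lift_diff)
    also have "(\<lambda>j i. GGh D (phi_h P D z) j i - GGh D ph j i) = GGh D (phi_h P D z - ph)"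
      using GGh_add[of "phi_h P D z - ph" ph] by (simp add: fun_eq_iff)
    also have "Hnorm P (lift P D (GGh D (phi_h P D z - ph))) \<le> kappa P D * a_norm D (phi_h P D z - ph)"
      by (rule kappa_upper[OF subspace_diff[OF subspace_Vh phi_h_solves(1)[OF z] ph]])
    finally show ?thesis
      using err_triangle_lift[OF gL, of "GGh D ph" "GGh D (phi_h P D z)"] by (simp add: eps_rec_def)
  qed
  also have "kappa P D * a_norm D (phi_h P D z - ph)
      \<le> kappa P D * (d_err P D z + Lam D * (Cinv * (eps_I P D z + err P D z zh)) + eps_s D ph zh)"
  proof (rule mult_left_mono[OF _ kappa_nonneg])
    have "Lam D * h_norm D (interp D z - zh) \<le> Lam D * (Cinv * (eps_I P D z + err P D z zh))"
      by (rule mult_left_mono[OF interp_distance[OF inv Cinv zL zh] Lam_nonneg])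
    then show "a_norm D (phi_h P D z - ph) \<le> d_err P D z + Lam D * (Cinv * (eps_I P D z + err P D z zh)) + eps_s D ph zh"
      using poisson_error[OF z zh ph] by linarith
  qed
  finally show ?thesis by (simp add: algebra_simps)
qed

text \<open>The error of the gradient is split at the discrete gradient of the interpolated exact state. The
first part is the consistency error. The second is a difference of discrete gradients, bounded by
\<open>C\<^sub>l\<^sub>i\<^sub>f\<^sub>t L\<^sub>h\<close> times the distance of the states in \<open>X\<^sub>h\<close>.\<close>

lemma gradient_step:
  assumes inv: "\<And>z. z \<in> Xh D \<Longrightarrow> h_norm D z \<le> Cinv * Hnorm P (lift P D z)" and Cinv: "0 \<le> Cinv"
    and up: "\<And>z. z \<in> Qh D \<Longrightarrow> Hnorm P (lift P D z) \<le> Clift * h_norm D z" and Clift: "0 \<le> Clift"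
    and z: "smooth_field P z" and gz: "\<exists>g. has_energy_grad P E z g"
    and lip: "grad_lipschitz P D E R Lh" and R: "R \<subseteq> Xh D" "zh \<in> R" "interp D z \<in> R"
    and \<eta>: "0 < \<eta>" and zL': "L2 (Qmeas P) zhalf" and half: "Heq P zhalf (\<lambda>q. z q - \<eta> *\<^sub>R energy_grad P E z q)"
    and hhalf: "zhhalf = (\<lambda>j i. zh j i - \<eta> *\<^sub>R discrete_grad P D E zh j i)"
  shows "err P D zhalf zhhalf \<le> err P D z zh
      + \<eta> * (eps_g P D E z + Clift * Lh * Cinv * (eps_I P D z + err P D z zh))"
    and "zhhalf \<in> Xh D"
proof -
  let ?G = "energy_grad P E z" and ?d = "discrete_grad P D E zh" and ?di = "discrete_grad P D E (interp D z)"
  have zhX: "zh \<in> Xh D" using R by blast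
  have ex: "\<exists>g. has_discrete_grad P D E y g" if "y \<in> R" for y using lip that by (simp add: grad_lipschitz_def)
  have dX: "?d \<in> Xh D" "?di \<in> Xh D" using ex R(2,3) discrete_grad_Xh by blast+
  have hh: "zhhalf = zh - \<eta> *\<^sub>R ?d" by (simp add: hhalf fun_eq_iff)
  show "zhhalf \<in> Xh D" unfolding hh by (intro subspace_diff subspace_scale subspace_Xh zhX dX)
  have zL: "L2 (Qmeas P) z" by (rule Hspace_L2[OF smooth_field_Hspace[OF z]])
  have "has_energy_grad P E z ?G" unfolding energy_grad_def using gz by (rule someI_ex)
  then have GL: "L2 (Qmeas P) ?G" by (simp add: has_energy_grad_def Hspace_L2)
  have sL: "L2 (Qmeas P) (\<lambda>q. z q - \<eta> *\<^sub>R ?G q)" by (intro L2_diff L2_scale zL GL)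
  have "err P D zhalf zhhalf = Hnorm P (\<lambda>q. (z q - \<eta> *\<^sub>R ?G q) - lift P D zhhalf q)"
    unfolding err_def
  proof (rule L2_norm_cong_AE[OF L2_diff[OF zL' lift_L2] L2_diff[OF sL lift_L2]])
    show "AE q in Qmeas P. zhalf q - lift P D zhhalf q = z q - \<eta> *\<^sub>R ?G q - lift P D zhhalf q"
      using half unfolding Heq_def by eventually_elim simp
  qed
  also have "\<dots> = Hnorm P (\<lambda>q. (z q - lift P D zh q) + (- \<eta>) *\<^sub>R (?G q - lift P D ?d q))"
  proof (rule Hnorm_cong)
    fix q assume q: "q \<in> Qclosed P"
    have "zhhalf = zh + (- \<eta>) *\<^sub>R ?d" by (simp add: hh)
    then have "lift P D zhhalf q = lift P D zh q + (- \<eta>) *\<^sub>R lift P D ?d q"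
      by (simp only: lift_add[OF q] lift_scale[OF q])
    then show "(z q - \<eta> *\<^sub>R ?G q) - lift P D zhhalf q = (z q - lift P D zh q) + (- \<eta>) *\<^sub>R (?G q - lift P D ?d q)"
      by (simp add: algebra_simps)
  qed
  also have "\<dots> \<le> err P D z zh + Hnorm P (\<lambda>q. (- \<eta>) *\<^sub>R (?G q - lift P D ?d q))"
    unfolding err_def by (rule L2_minkowski[OF L2_diff[OF zL lift_L2] L2_scale[OF L2_diff[OF GL lift_L2]]])
  also have "Hnorm P (\<lambda>q. (- \<eta>) *\<^sub>R (?G q - lift P D ?d q)) = \<eta> * Hnorm P (\<lambda>q. ?G q - lift P D ?d q)"
    using \<eta> by (simp only: L2_norm_scale abs_minus_cancel abs_of_pos)
  also have "Hnorm P (\<lambda>q. ?G q - lift P D ?d q) \<le> eps_g P D E z + Clift * Lh * Cinv * (eps_I P D z + err P D z zh)"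
  proof -
    have "Hnorm P (\<lambda>q. lift P D ?di q - lift P D ?d q) = Hnorm P (lift P D (\<lambda>j i. ?di j i - ?d j i))"
      by (rule Hnorm_lift_diff)
    also have "\<dots> \<le> Clift * h_norm D (\<lambda>j i. ?di j i - ?d j i)"
      by (rule up) (use dX in \<open>auto simp: Xh_def Qh_def\<close>)
    also have "\<dots> \<le> Clift * (Lh * (Cinv * (eps_I P D z + err P D z zh)))"
    proof (rule mult_left_mono[OF _ Clift])
      have Lh: "0 \<le> Lh" using lip by (simp add: grad_lipschitz_def)
      have "h_norm D (\<lambda>j i. ?di j i - ?d j i) \<le> Lh * h_norm D (\<lambda>j i. interp D z j i - zh j i)"
        using lip R(2,3) by (simp add: grad_lipschitz_def)
      also have "(\<lambda>j i. interp D z j i - zh j i) = interp D z - zh" by (simp add: fun_eq_iff)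
      also have "Lh * h_norm D (interp D z - zh) \<le> Lh * (Cinv * (eps_I P D z + err P D z zh))"
        by (rule mult_left_mono[OF interp_distance[OF inv Cinv zL zhX] Lh])
      finally show "h_norm D (\<lambda>j i. ?di j i - ?d j i) \<le> Lh * (Cinv * (eps_I P D z + err P D z zh))" .
    qed
    finally show ?thesis
      using err_triangle_lift[OF GL, of ?d ?di] by (simp add: eps_g_def mult.assoc)
  qed
  finally show "err P D zhalf zhhalf \<le> err P D z zh
      + \<eta> * (eps_g P D E z + Clift * Lh * Cinv * (eps_I P D z + err P D z zh))"
    using \<eta> by (simp add: mult_left_mono)
qed

text \<open>The two estimates are applied to a nonzero element of \<open>X\<^sub>h\<close>, whose norms are positive.\<close>

lemma lift_constants_nonneg:
  assumes inv: "\<And>z. z \<in> Xh D \<Longrightarrow> h_norm D z \<le> Cinv * Hnorm P (lift P D z)"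
    and up: "\<And>z. z \<in> Qh D \<Longrightarrow> Hnorm P (lift P D z) \<le> Clift * h_norm D z"
  shows "0 \<le> Cinv" "0 \<le> Clift"
proof -
  obtain z where z: "z \<in> Xh D - {\<lambda>j i. 0}" using Xh_nontrivial by blast
  have h: "0 < h_norm D z" by (rule h_norm_pos[OF z])
  have p: "0 < Cinv * Hnorm P (lift P D z)" using inv[of z] z h by simp
  have n: "0 \<le> Hnorm P (lift P D z)" by simp
  show "0 \<le> Cinv" using p n by (simp add: zero_less_mult_iff)
  have "0 < Hnorm P (lift P D z)" using p n by (simp add: zero_less_mult_iff)
  moreover have "z \<in> Qh D" using z by (simp add: Xh_def)
  ultimately have "0 < Clift * h_norm D z" using up by (meson less_le_trans)
  then show "0 \<le> Clift" using h by (simp add: zero_less_mult_iff)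
qed

text \<open>As the lift is linear, the error of the extrapolated states is the combination \<open>(1 + \<omega>) e' - \<omega> e\<close> of
the errors.\<close>

lemma extrapolation_error:
  assumes z: "L2 (Qmeas P) z" and z': "L2 (Qmeas P) z'" and zb: "L2 (Qmeas P) zb"
    and eq: "Heq P zb (\<lambda>q. z' q + \<omega> *\<^sub>R (z' q - z q))"
  shows "err P D zb (\<lambda>j i. zh' j i + \<omega> *\<^sub>R (zh' j i - zh j i))
    \<le> (1 + \<bar>\<omega>\<bar>) * err P D z' zh' + \<bar>\<omega>\<bar> * err P D z zh"
proof -
  let ?x = "\<lambda>j i. zh' j i + \<omega> *\<^sub>R (zh' j i - zh j i)"
  have eL: "L2 (Qmeas P) (\<lambda>q. z q - lift P D zh q)" "L2 (Qmeas P) (\<lambda>q. z' q - lift P D zh' q)"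
    by (intro L2_diff z z' lift_L2)+
  have "err P D zb ?x = Hnorm P (\<lambda>q. (z' q + \<omega> *\<^sub>R (z' q - z q)) - lift P D ?x q)"
    unfolding err_def
  proof (rule L2_norm_cong_AE[OF L2_diff[OF zb lift_L2] L2_diff[OF L2_add[OF z' L2_scale[OF L2_diff[OF z' z]]] lift_L2]])
    show "AE q in Qmeas P. zb q - lift P D ?x q = z' q + \<omega> *\<^sub>R (z' q - z q) - lift P D ?x q"
      using eq unfolding Heq_def by eventually_elim simp
  qed
  also have "\<dots> = Hnorm P (\<lambda>q. (1 + \<omega>) *\<^sub>R (z' q - lift P D zh' q) + (- \<omega>) *\<^sub>R (z q - lift P D zh q))"
  proof (rule Hnorm_cong)
    fix q assume q: "q \<in> Qclosed P"
    have "?x = (1 + \<omega>) *\<^sub>R zh' + (- \<omega>) *\<^sub>R zh" by (simp add: fun_eq_iff algebra_simps)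
    then have "lift P D ?x q = (1 + \<omega>) *\<^sub>R lift P D zh' q + (- \<omega>) *\<^sub>R lift P D zh q"
      by (simp only: lift_add[OF q] lift_scale[OF q])
    then show "(z' q + \<omega> *\<^sub>R (z' q - z q)) - lift P D ?x q
      = (1 + \<omega>) *\<^sub>R (z' q - lift P D zh' q) + (- \<omega>) *\<^sub>R (z q - lift P D zh q)"
      by (simp add: algebra_simps)
  qed
  also have "\<dots> \<le> Hnorm P (\<lambda>q. (1 + \<omega>) *\<^sub>R (z' q - lift P D zh' q)) + Hnorm P (\<lambda>q. (- \<omega>) *\<^sub>R (z q - lift P D zh q))"
    by (rule L2_minkowski[OF L2_scale[OF eL(2)] L2_scale[OF eL(1)]])
  also have "\<dots> = \<bar>1 + \<omega>\<bar> * err P D z' zh' + \<bar>\<omega>\<bar> * err P D z zh"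
    by (simp only: L2_norm_scale err_def abs_minus_cancel)
  also have "\<dots> \<le> (1 + \<bar>\<omega>\<bar>) * err P D z' zh' + \<bar>\<omega>\<bar> * err P D z zh"
    by (intro add_right_mono mult_right_mono) (auto simp: err_def)
  finally show ?thesis .
qed

lemma err_cong: 
  "L2 (Qmeas P) z \<Longrightarrow> L2 (Qmeas P) w \<Longrightarrow> Heq P z w \<Longrightarrow> err P D z zh = err P D w zh"
  unfolding err_def Heq_def
  by (intro L2_norm_cong_AE L2_diff lift_L2) auto

end

section \<open>Accumulation of the errors\<close>

text \<open>The right-hand side \<open>B n\<close> obeys \<open>B (n + 1) = M B n + \<delta> n\<close> and increases, as \<open>M \<ge> 1\<close>. If it bounds
all errors up to \<open>n\<close>, then the extrapolated error is at most \<open>(1 + 2\<Omega>) B n\<close>, and one step leads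
below \<open>B (n + 1)\<close>.\<close>

lemma error_recursion:
  fixes e ebar \<delta> A :: "nat \<Rightarrow> real"
  assumes e: "\<And>k. 0 \<le> e k" and \<delta>: "\<And>k. k < K \<Longrightarrow> 0 \<le> \<delta> k" and A: "\<And>k. k < K \<Longrightarrow> 0 \<le> A k"
    and step: "\<And>k. k < K \<Longrightarrow> e (Suc k) \<le> A k * ebar k + \<delta> k"
    and start: "ebar 0 \<le> e 0"
    and extra: "\<And>k. Suc k < K \<Longrightarrow> ebar (Suc k) \<le> (1 + \<Omega>) * e (Suc k) + \<Omega> * e k"
    and \<Omega>: "0 \<le> \<Omega>" and M: "1 \<le> M" "\<And>k. k < K \<Longrightarrow> (1 + 2 * \<Omega>) * A k \<le> M"
  shows "Max (e ` {..K}) \<le> M ^ K * e 0 + (\<Sum>k<K. M ^ (K - 1 - k) * \<delta> k)"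
proof -
  define B where "B n = M ^ n * e 0 + (\<Sum>k<n. M ^ (n - 1 - k) * \<delta> k)" for n
  have B_Suc: "B (Suc n) = M * B n + \<delta> n" for n
  proof -
    have "(\<Sum>k<n. M ^ (n - k) * \<delta> k) = (\<Sum>k<n. M * (M ^ (n - 1 - k) * \<delta> k))"
    proof (rule sum.cong[OF refl])
      fix k assume "k \<in> {..<n}"
      then have "n - k = Suc (n - 1 - k)" by auto
      then show "M ^ (n - k) * \<delta> k = M * (M ^ (n - 1 - k) * \<delta> k)" by simp
    qed
    then show ?thesis by (simp add: B_def distrib_left sum_distrib_left)
  qed
  have main: "0 \<le> B n \<and> (\<forall>k\<le>n. e k \<le> B n)" if "n \<le> K" for n
    using that
  proof (induction n)
    case 0
    then show ?case using e by (simp add: B_def)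
  next
    case (Suc n)
    then have IH: "0 \<le> B n" "\<And>k. k \<le> n \<Longrightarrow> e k \<le> B n" and n: "n < K" by auto
    have "B n \<le> M * B n" using M(1) IH(1) mult_right_mono[of 1 M "B n"] by simp
    then have mono: "B n \<le> B (Suc n)" using \<delta>[OF n] by (simp add: B_Suc)
    have "ebar n \<le> (1 + 2 * \<Omega>) * B n"
    proof (cases n)
      case 0
      have "ebar n \<le> B n" using start IH(2)[of 0] by (simp add: 0)
      also have "\<dots> \<le> (1 + 2 * \<Omega>) * B n" using \<Omega> IH(1) mult_right_mono[of 1 "1 + 2 * \<Omega>" "B n"] by simp
      finally show ?thesis .
    next
      case (Suc m)
      have "ebar n \<le> (1 + \<Omega>) * e n + \<Omega> * e m" using extra[of m] n by (simp add: Suc)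
      also have "\<dots> \<le> (1 + \<Omega>) * B n + \<Omega> * B n"
        using \<Omega> IH(2) by (intro add_mono mult_left_mono) (auto simp: Suc)
      finally show ?thesis by (simp add: algebra_simps)
    qed
    then have "A n * ebar n \<le> A n * ((1 + 2 * \<Omega>) * B n)" using A[OF n] by (intro mult_left_mono)
    also have "\<dots> = ((1 + 2 * \<Omega>) * A n) * B n" by simp
    also have "\<dots> \<le> M * B n" using M(2)[OF n] IH(1) by (intro mult_right_mono)
    finally have "e (Suc n) \<le> B (Suc n)" using step[OF n] by (simp add: B_Suc)
    then show ?case using IH mono by (auto simp: le_Suc_eq intro: order_trans)
  qed
  have "Max (e ` {..K}) \<le> B K" using main[of K] by (intro Max.boundedI) auto
  then show ?thesis by (simp add: B_def)
qed

theorem theorem5p1: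
  fixes P :: problem
    and D :: "'v::finite discr"
    and E :: "'v interaction"
    and \<phi> :: "field \<Rightarrow> real \<times> (real^3) \<Rightarrow> real"
    and sch :: scheme
    and K :: nat
    and \<eta> :: "nat \<Rightarrow> real"
    and z zbar zhalf :: "nat \<Rightarrow> field"
    and zh zhbar zhhalf :: "nat \<Rightarrow> 'v dfield"
    and phat :: "nat \<Rightarrow> nat \<Rightarrow> 'v \<Rightarrow> real"
    and Cshape Cp Clift Cinv Lh :: real
  assumes "continuous_setting P"
    and "proper_lsc_convex P (energy P E)"
    and phi: "\<And>w. w \<in> Hspace P \<Longrightarrow> poisson_solution P w (\<phi> w)"
    and "discrete_setting P D"
    and "assumption_A P D Cshape Cp Clift Cinv"
    and "1 \<le> K"
    and "\<And>k. k < K \<Longrightarrow> 0 < \<eta> k"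
    and "exact_iteration P E sch K \<eta> z zbar zhalf"
    and "discrete_iteration P D E sch K \<eta> zh zhbar zhhalf phat"
    and "assumption_B P D E K Lh zbar zhalf zhbar"
  shows "let ah = 1 + kappa P D * Lam D * Cinv;
             Lsharp = Clift * Lh * Cinv;
             e = (\<lambda>k. err P D (z k) (zh k));
             ebar = (\<lambda>k. err P D (zbar k) (zhbar k));
             \<delta> = (\<lambda>k. ah * \<eta> k * (eps_g P D E (zbar k) + Lsharp * eps_I P D (zbar k))
                    + eps_rec P D (\<phi> (zhalf k)) (zhalf k)
                    + kappa P D * (d_err P D (zhalf k) + eps_s D (phat k) (zhhalf k))
                    + (ah - 1) * eps_I P D (zhalf k)
                    + eps_R P D (phat k) (zhhalf k));
             \<Omega> = Omega_max sch K;
             Mh = max 1 ((1 + 2 * \<Omega>) * Max ((\<lambda>k. ah * (1 + \<eta> k * Lsharp)) ` {..<K}))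
         in (\<forall>k<K. e (Suc k) \<le> ah * (1 + \<eta> k * Lsharp) * ebar k + \<delta> k) \<and>
            (Heq P (zbar 0) (z 0) \<and> zhbar 0 = zh 0 \<longrightarrow>
               Max (e ` {..K}) \<le> Mh ^ K * e 0 + (\<Sum>k<K. Mh ^ (K - 1 - k) * \<delta> k))"
proof -
  note cs = assms(1) and ds = assms(4) and A = assms(5) and K = assms(6) and \<eta> = assms(7)
    and ex = assms(8) and di = assms(9) and B = assms(10)
  obtain \<nu> where \<nu>: "unit_normal_field (surf P) \<nu>"
    using cs by (auto simp: continuous_setting_def closed_oriented_surface_def)
  interpret paired P \<nu> D Cp
    by unfold_locales (use cs \<nu> ds A in \<open>auto simp: discrete_setting_def assumption_A_def\<close>)
  have inv: "\<And>z. z \<in> Xh D \<Longrightarrow> h_norm D z \<le> Cinv * Hnorm P (lift P D z)"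
    and up: "\<And>z. z \<in> Qh D \<Longrightarrow> Hnorm P (lift P D z) \<le> Clift * h_norm D z"
    using A by (auto simp: assumption_A_def)
  have Cinv: "0 \<le> Cinv" and Clift: "0 \<le> Clift" using lift_constants_nonneg[OF inv up] by blast+
  obtain R where R: "convex_region D R" "grad_lipschitz P D E R Lh"
      "\<And>k. k < K \<Longrightarrow> zhbar k \<in> R" "\<And>k. k < K \<Longrightarrow> interp D (zbar k) \<in> R"
    using B unfolding assumption_B_def by blast
  have Lh: "0 \<le> Lh" using R(2) by (simp add: grad_lipschitz_def)
  have sm: "smooth_field P (zbar k)" "smooth_field P (zhalf k)" "\<exists>g. has_energy_grad P E (zbar k) g" if "k < K" for k
    using B that unfolding assumption_B_def by blast+
  define ah where "ah = 1 + kappa P D * Lam D * Cinv"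
  define Ls where "Ls = Clift * Lh * Cinv"
  define e where "e k = err P D (z k) (zh k)" for k
  define ebar where "ebar k = err P D (zbar k) (zhbar k)" for k
  define \<delta> where "\<delta> k = ah * \<eta> k * (eps_g P D E (zbar k) + Ls * eps_I P D (zbar k))
                    + eps_rec P D (\<phi> (zhalf k)) (zhalf k)
                    + kappa P D * (d_err P D (zhalf k) + eps_s D (phat k) (zhhalf k))
                    + (ah - 1) * eps_I P D (zhalf k)
                    + eps_R P D (phat k) (zhhalf k)" for k
  define \<Omega> where "\<Omega> = Omega_max sch K"
  define A where "A k = ah * (1 + \<eta> k * Ls)" for k
  define Mh where "Mh = max 1 ((1 + 2 * \<Omega>) * Max (A ` {..<K}))"
  have ah: "1 \<le> ah" using kappa_nonneg Lam_nonneg Cinv by (simp add: ah_def)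
  have Ls: "0 \<le> Ls" using Clift Lh Cinv by (simp add: Ls_def)
  have step: "e (Suc k) \<le> A k * ebar k + \<delta> k" if k: "k < K" for k
  proof -
    note s = sm[OF k]
    have half: "Heq P (zhalf k) (\<lambda>q. zbar k q - \<eta> k *\<^sub>R energy_grad P E (zbar k) q)"
      and pr: "is_proj_C P (zhalf k) (z (Suc k))" using ex k by (auto simp: exact_iteration_def)
    have hh: "zhhalf k = (\<lambda>j i. zhbar k j i - \<eta> k *\<^sub>R discrete_grad P D E (zhbar k) j i)"
      and ph: "phat k \<in> Vh D" and zS: "zh (Suc k) = Rh D (corrected D (zhhalf k) (phat k))"
      using di k by (auto simp: discrete_iteration_def)
    have RX: "R \<subseteq> Xh D" using R(1) by (simp add: convex_region_def)
    have hL: "L2 (Qmeas P) (zhalf k)" by (rule Hspace_L2[OF smooth_field_Hspace[OF s(2)]])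
    note g = gradient_step[OF inv Cinv up Clift s(1) s(3) R(2) RX R(3)[OF k] R(4)[OF k] \<eta>[OF k] hL half hh]
    have "e (Suc k) \<le> ah * err P D (zhalf k) (zhhalf k)
        + eps_rec P D (\<phi> (zhalf k)) (zhalf k)
        + kappa P D * (d_err P D (zhalf k) + eps_s D (phat k) (zhhalf k))
        + (ah - 1) * eps_I P D (zhalf k) + eps_R P D (phat k) (zhhalf k)"
      using projection_step[OF inv Cinv s(2) phi[OF smooth_field_Hspace[OF s(2)]] pr g(2) ph]
      by (simp add: e_def zS ah_def)
    moreover have "ah * err P D (zhalf k) (zhhalf k)
        \<le> ah * (ebar k + \<eta> k * (eps_g P D E (zbar k) + Ls * (eps_I P D (zbar k) + ebar k)))"
      using g(1) ah by (intro mult_left_mono) (auto simp: ebar_def Ls_def)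
    ultimately show ?thesis by (simp add: A_def \<delta>_def algebra_simps)
  qed
  have final: "Max (e ` {..K}) \<le> Mh ^ K * e 0 + (\<Sum>k<K. Mh ^ (K - 1 - k) * \<delta> k)"
    if start: "Heq P (zbar 0) (z 0)" "zhbar 0 = zh 0"
  proof (rule error_recursion[where ebar = ebar and A = A and \<Omega> = \<Omega>])
    have zL: "L2 (Qmeas P) (z k)" if "k \<le> K" for k
      using ex that by (cases k) (auto simp: exact_iteration_def is_proj_C_def Cset_def Hspace_L2)
    have zbL: "L2 (Qmeas P) (zbar k)" if "k < K" for k
      by (rule Hspace_L2[OF smooth_field_Hspace[OF sm(1)[OF that]]])
    show "0 \<le> e k" for k by (simp add: e_def err_def)
    show "0 \<le> A k" if "k < K" for k using ah Ls \<eta>[OF that] by (simp add: A_def)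
    show "0 \<le> \<delta> k" if k: "k < K" for k
      using ah Ls \<eta>[OF k] kappa_nonneg quantities_nonneg(1)[OF sm(2)[OF k]] quantities_nonneg(2)[OF sm(2)[OF k], where ph = "phat k" and zh = "zhhalf k"]
      unfolding \<delta>_def
      by (intro add_nonneg_nonneg mult_nonneg_nonneg) (auto simp: eps_g_def eps_I_def eps_rec_def eps_R_def)
    show "e (Suc k) \<le> A k * ebar k + \<delta> k" if "k < K" for k by (rule step[OF that])
    have "ebar 0 = e 0"
      unfolding ebar_def e_def start(2) using K start(1) by (intro err_cong zL zbL) auto
    then show "ebar 0 \<le> e 0" by simp
    show \<Omega>0: "0 \<le> \<Omega>"
    proof (cases sch)
      case FISTA
      have "\<bar>omega 0\<bar> \<le> \<Omega>" unfolding \<Omega>_def Omega_max_def using FISTA K by (simp add: Max_ge)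
      then show ?thesis by linarith
    qed (simp add: \<Omega>_def Omega_max_def)
    show "1 \<le> Mh" by (simp add: Mh_def)
    show "(1 + 2 * \<Omega>) * A k \<le> Mh" if "k < K" for k
    proof -
      have "A k \<le> Max (A ` {..<K})" using that by (intro Max_ge) auto
      then have "(1 + 2 * \<Omega>) * A k \<le> (1 + 2 * \<Omega>) * Max (A ` {..<K})" using \<Omega>0 by (intro mult_left_mono) auto
      then show ?thesis by (simp add: Mh_def)
    qed
    show "ebar (Suc k) \<le> (1 + \<Omega>) * e (Suc k) + \<Omega> * e k" if k: "Suc k < K" for k
    proof (cases sch)
      case ISTA
      have "Heq P (zbar (Suc k)) (z (Suc k))" "zhbar (Suc k) = zh (Suc k)"
        using ex di k by (auto simp: exact_iteration_def discrete_iteration_def ISTA)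
      then have "ebar (Suc k) = e (Suc k)"
        unfolding ebar_def e_def using k by (simp, intro err_cong zL zbL) auto
      then show ?thesis by (simp add: \<Omega>_def Omega_max_def ISTA)
    next
      case FISTA
      have q: "Heq P (zbar (Suc k)) (\<lambda>q. z (Suc k) q + omega k *\<^sub>R (z (Suc k) q - z k q))"
        "zhbar (Suc k) = (\<lambda>j i. zh (Suc k) j i + omega k *\<^sub>R (zh (Suc k) j i - zh k j i))"
        using ex di k by (auto simp: exact_iteration_def discrete_iteration_def FISTA)
      have "ebar (Suc k) \<le> (1 + \<bar>omega k\<bar>) * e (Suc k) + \<bar>omega k\<bar> * e k"
        unfolding ebar_def e_def q(2) by (rule extrapolation_error[OF zL zL zbL q(1)]) (use k in auto)
      also have "\<dots> \<le> (1 + \<Omega>) * e (Suc k) + \<Omega> * e k"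
      proof -
        have "\<bar>omega k\<bar> \<le> \<Omega>" unfolding \<Omega>_def Omega_max_def using FISTA k by (simp add: Max_ge)
        then show ?thesis by (intro add_mono mult_right_mono) (auto simp: e_def err_def)
      qed
      finally show ?thesis .
    qed
  qed
  show ?thesis
    unfolding Let_def ah_def[symmetric] Ls_def[symmetric]
    using step final unfolding A_def[abs_def] Mh_def \<delta>_def e_def ebar_def \<Omega>_def by blast
qed

end
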